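(* There is an algorithm that, given a tree $T$ of order $n$ and a positive integer $k$, decides whether $T$ has a detection pair $(W,L)$ with $|W|+|L|\le k$, in time $2^{O(k\log k)}n^2$.
   Context: All graphs are finite, simple and undirected, and $d(u,v)$ denotes the distance in the graph. A vertex $w$ dominates all vertices of its closed neighbourhood $N[w]$. A vertex $l$ separates vertices $u,v$ if $d(u,l)\neq d(v,l)$. Given $W\subseteq V(G)$ (watchers) and $L\subseteq V(G)$ (listeners), a vertex $u$ is distinguished by $(W,L)$ if either $u$ is dominated by a vertex of $W$, or for every other vertex $v$, either $v$ is dominated by a vertex of $W$ or some vertex of $L$ separates $u$ and $v$. The pair $(W,L)$ (possibly with $W\cap L\neq\emptyset$) is a detection pair of $G$ if every vertex of $G$ is distinguished by $(W,L)$; its size is $|W|+|L|$. Here $\log$ is the natural logarithm. *)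

theory Defs
  imports "HOL-Library.Landau_Symbols" "Graph_Theory.Graph_Theory"
begin

section \<open>Trees and detection pairs\<close>

text \<open>
  A finite simple undirected graph is a graph \<open>G\<close> with \<^term>\<open>pair_graph G\<close>: an edge \<open>uv\<close> is
  represented by the two arcs \<open>(u, v)\<close> and \<open>(v, u)\<close>.

  The library's \<open>tree\<close> is not usable here: in a symmetric digraph the closed walk along \<open>(u, v)\<close>
  and back along \<open>(v, u)\<close> counts as a cycle, so no graph with an edge is a \<open>tree\<close>. The cycles of
  the undirected graph are the directed cycles of length at least 3. Connectedness in the
  library's sense excludes the graph without vertices.
\<close>

definition is_tree :: "'a pair_pre_digraph \<Rightarrow> bool" where
  "is_tree G \<longleftrightarrow> pair_graph G \<and> Digraph_Component.connected (with_proj G) \<and>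
     \<not> (\<exists>p. pre_digraph.cycle (with_proj G) p \<and> 3 \<le> length p)"

definition gdist :: "'a pair_pre_digraph \<Rightarrow> 'a \<Rightarrow> 'a \<Rightarrow> ereal" where
  "gdist G u v = wf_digraph.\<mu> (with_proj G) (\<lambda>_. 1) u v"

definition closed_nbhd :: "'a pair_pre_digraph \<Rightarrow> 'a \<Rightarrow> 'a set" where
  "closed_nbhd G w = insert w {v \<in> pverts G. (w, v) \<in> parcs G}"

definition dominated_by :: "'a pair_pre_digraph \<Rightarrow> 'a set \<Rightarrow> 'a \<Rightarrow> bool" where
  "dominated_by G W u \<longleftrightarrow> (\<exists>w\<in>W. u \<in> closed_nbhd G w)"

definition separates :: "'a pair_pre_digraph \<Rightarrow> 'a \<Rightarrow> 'a \<Rightarrow> 'a \<Rightarrow> bool" where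
  "separates G l u v \<longleftrightarrow> gdist G u l \<noteq> gdist G v l"

definition distinguished :: "'a pair_pre_digraph \<Rightarrow> 'a set \<Rightarrow> 'a set \<Rightarrow> 'a \<Rightarrow> bool" where
  "distinguished G W L u \<longleftrightarrow> dominated_by G W u \<or>
     (\<forall>v\<in>pverts G. v \<noteq> u \<longrightarrow> dominated_by G W v \<or> (\<exists>l\<in>L. separates G l u v))"

definition detection_pair :: "'a pair_pre_digraph \<Rightarrow> 'a set \<Rightarrow> 'a set \<Rightarrow> bool" where
  "detection_pair G W L \<longleftrightarrow>
     W \<subseteq> pverts G \<and> L \<subseteq> pverts G \<and> (\<forall>u\<in>pverts G. distinguished G W L u)"


section \<open>Algorithms and running time\<close>

text \<open>
  Algorithms are programs for a word RAM. The memory consists of arrays of natural numbers; a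
  program mentions only finitely many array names, so interleaving its arrays turns it into a
  program for a RAM with a single array at the cost of a constant factor. Scalar variables are
  arrays of which only entry 0 is used.
\<close>

type_synonym state = "string \<Rightarrow> nat \<Rightarrow> nat"

datatype binop = Plus | Minus | Times | Div | Mod | Less | Equal

fun apply_op :: "binop \<Rightarrow> nat \<Rightarrow> nat \<Rightarrow> nat" where
  "apply_op Plus x y = x + y"
| "apply_op Minus x y = x - y"
| "apply_op Times x y = x * y"
| "apply_op Div x y = x div y"
| "apply_op Mod x y = x mod y"
| "apply_op Less x y = (if x < y then 1 else 0)"
| "apply_op Equal x y = (if x = y then 1 else 0)"

datatype expr = Const nat | Read string expr | BinOp binop expr expr

fun eval_expr :: "expr \<Rightarrow> state \<Rightarrow> nat" where
  "eval_expr (Const m) s = m"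
| "eval_expr (Read a i) s = s a (eval_expr i s)"
| "eval_expr (BinOp f d e) s = apply_op f (eval_expr d s) (eval_expr e s)"

fun expr_cost :: "expr \<Rightarrow> nat" where
  "expr_cost (Const m) = 1"
| "expr_cost (Read a i) = 1 + expr_cost i"
| "expr_cost (BinOp f d e) = 1 + expr_cost d + expr_cost e"

text \<open>All values that occur in the evaluation, array indices included, are at most \<open>B\<close>.\<close>

fun fits :: "nat \<Rightarrow> expr \<Rightarrow> state \<Rightarrow> bool" where
  "fits B (Const m) s \<longleftrightarrow> m \<le> B"
| "fits B (Read a i) s \<longleftrightarrow> fits B i s \<and> eval_expr (Read a i) s \<le> B"
| "fits B (BinOp f d e) s \<longleftrightarrow> fits B d s \<and> fits B e s \<and> eval_expr (BinOp f d e) s \<le> B"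

datatype prog =
  Skip
| Assign string expr expr  \<comment> \<open>\<open>Assign a i e\<close> stores \<open>e\<close> in entry \<open>i\<close> of array \<open>a\<close>\<close>
| Seq prog prog
| Cond expr prog prog
| While expr prog

text \<open>
  \<open>exec B P s t s'\<close>: started in \<open>s\<close>, the program \<open>P\<close> terminates in \<open>s'\<close> after exactly \<open>t\<close>
  elementary steps, and no word exceeds \<open>B\<close> during the run. A run in which a word would exceed
  \<open>B\<close> has no derivation.
\<close>

inductive exec :: "nat \<Rightarrow> prog \<Rightarrow> state \<Rightarrow> nat \<Rightarrow> state \<Rightarrow> bool" for B :: nat where
  Skip: "exec B Skip s 1 s"
| Assign: "fits B i s \<Longrightarrow> fits B e s \<Longrightarrow>
    exec B (Assign a i e) s (1 + expr_cost i + expr_cost e)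
      (s(a := (s a)(eval_expr i s := eval_expr e s)))"
| Seq: "exec B P s t s' \<Longrightarrow> exec B Q s' t' s'' \<Longrightarrow> exec B (Seq P Q) s (t + t') s''"
| CondTrue: "fits B b s \<Longrightarrow> eval_expr b s \<noteq> 0 \<Longrightarrow> exec B P s t s' \<Longrightarrow>
    exec B (Cond b P Q) s (1 + expr_cost b + t) s'"
| CondFalse: "fits B b s \<Longrightarrow> eval_expr b s = 0 \<Longrightarrow> exec B Q s t s' \<Longrightarrow>
    exec B (Cond b P Q) s (1 + expr_cost b + t) s'"
| WhileFalse: "fits B b s \<Longrightarrow> eval_expr b s = 0 \<Longrightarrow> exec B (While b P) s (1 + expr_cost b) s"
| WhileTrue: "fits B b s \<Longrightarrow> eval_expr b s \<noteq> 0 \<Longrightarrow> exec B P s t s' \<Longrightarrow>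
    exec B (While b P) s' t' s'' \<Longrightarrow> exec B (While b P) s (1 + expr_cost b + t + t') s''"

lemma exec_deterministic:
  "exec B P s t s' \<Longrightarrow> exec B' P s t' s'' \<Longrightarrow> t' = t \<and> s'' = s'"
proof (induction arbitrary: t' s'' rule: exec.induct)
  case Skip
  from Skip.prems show ?case by cases auto
next
  case Assign
  from Assign.prems show ?case by cases auto
next
  case Seq
  from Seq.prems show ?case by cases (use Seq.IH in blast)
next
  case CondTrue
  from CondTrue.prems show ?case by cases (use CondTrue in auto)
next
  case CondFalse
  from CondFalse.prems show ?case by cases (use CondFalse in auto)
next
  case WhileFalse
  from WhileFalse.prems show ?case by cases (use WhileFalse in auto)
next
  case WhileTrue
  from WhileTrue.prems show ?case
  proof cases
    case WhileFalse
    with WhileTrue.hyps show ?thesis by simp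
  next
    case WhileTrue': WhileTrue
    with WhileTrue.IH show ?thesis by blast
  qed
qed

text \<open>
  Besides the number of steps, the size of the words is bounded: they have \<open>O(log T)\<close> bits for
  running time \<open>T\<close>. Without such a bound, unit-cost arithmetic on huge numbers would be too powerful.
\<close>

definition halts_within :: "nat \<Rightarrow> prog \<Rightarrow> state \<Rightarrow> real \<Rightarrow> state \<Rightarrow> bool" where
  "halts_within c P s T s' \<longleftrightarrow>
     (\<exists>B t. exec B P s t s' \<and> real t \<le> T \<and> real B \<le> T ^ c)"

text \<open>
  The input: the order \<open>n\<close>, the number \<open>k\<close>, and the adjacency matrix of a graph with vertices
  \<open>0, \<dots>, n - 1\<close>, row by row. All other memory is 0.
\<close>

definition input_state :: "nat \<Rightarrow> nat \<Rightarrow> nat pair_pre_digraph \<Rightarrow> state" where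
  "input_state n k G =
     (\<lambda>_ _. 0)
       (''n'' := (\<lambda>_. 0)(0 := n),
        ''k'' := (\<lambda>_. 0)(0 := k),
        ''adj'' := (\<lambda>m. if m < n * n \<and> (m div n, m mod n) \<in> parcs G then 1 else 0))"

definition accepting :: "state \<Rightarrow> bool" where
  "accepting s \<longleftrightarrow> s ''out'' 0 \<noteq> 0"

end

theory Submission
  imports Defs "HOL-Real_Asymp.Real_Asymp"
begin

text \<open>A vertex pair is in conflict with a partial choice of watchers and listeners if neither vertex is
  dominated and no listener separates them; every detection pair has to resolve every conflict.
  Suppose one listener \<open>r\<close> is known and let \<open>(u, v)\<close> be a conflict whose midpoint \<open>m\<close> is as deep as
  possible below \<open>r\<close>. A listener resolving it lies in the branch at \<open>m\<close> that contains \<open>u\<close>, or in that of \<open>v\<close>.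
  As there is no conflict inside these branches, all positions in a branch are equally good, so that \<open>u\<close> or
  \<open>v\<close> itself may be chosen. A watcher resolving it is one of \<open>u\<close>, \<open>v\<close> or their neighbours, and a vertex of
  degree more than \<open>k + 1\<close> must be a watcher itself, so \<open>O(k)\<close> choices suffice. This gives a search
  tree with \<open>(2 k + 8) ^ (k + 1)\<close> branches, in each of which a deepest conflict is found in time
  \<open>O(k n\<^sup>2)\<close>.

  If there are at least two listeners, the first one need not be guessed: root the tree at vertex 0, and the
  same exchange argument provides the first listener. If there is at most one listener, all its positions
  are tried; then only watchers remain to be found, and a conflict is found in time \<open>O(k n)\<close> by
  bucketing the vertices by their distance to the listener.\<close>

section \<open>Tree metrics\<close>

text \<open>The factor \<open>n * n\<close> shapes the search. Trying all positions of a listener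
  multiplies the work by \<open>n\<close>, so a round may then take only linear time. With a single
  listener this works, because a conflict is just two undominated vertices in the same distance
  class. With several listeners the choice follows a deepest conflict, whose quadratic search leaves
  no room for guessing; hence the provisional root. No listener of the solution need see its
  distances, so a second listener has to play that part in the exchange.

  The solution that certifies a branch is not fixed in advance: each exchange alters it without
  making it larger, while the entries chosen so far remain part of it. Progress is therefore
  measured by the length of the list alone. Apart from a placeholder at the head, its distinct
  entries embed into a solution of size at most \<open>k\<close>.

  The machine has no recursion. A branch of the search tree is a number below
  \<open>M ^ (k + 1)\<close>, replayed from the root by reading its digits in base \<open>M\<close>;
  branches share nothing and no choice has to be undone.\<close>

locale tree_metric =
  fixes V :: "'a set" and d :: "'a \<Rightarrow> 'a \<Rightarrow> nat"
  assumes fin: "finite V"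
    and sym: "x \<in> V \<Longrightarrow> y \<in> V \<Longrightarrow> d x y = d y x"
    and zero: "x \<in> V \<Longrightarrow> y \<in> V \<Longrightarrow> d x y = 0 \<longleftrightarrow> x = y"
    and four: "x \<in> V \<Longrightarrow> y \<in> V \<Longrightarrow> z \<in> V \<Longrightarrow> w \<in> V \<Longrightarrow>
      d x y + d z w \<le> max (d x z + d y w) (d x w + d y z)"
    and par: "x \<in> V \<Longrightarrow> y \<in> V \<Longrightarrow> s \<in> V \<Longrightarrow> d x y = 1 \<Longrightarrow> d s x \<noteq> d s y"
begin

lemma refl0 [simp]: "x \<in> V \<Longrightarrow> d x x = 0"
  using zero by blast

lemma triangle: "x \<in> V \<Longrightarrow> y \<in> V \<Longrightarrow> z \<in> V \<Longrightarrow> d x y \<le> d x z + d z y"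
  using four[of x y z z] sym[of y z] by simp

text \<open>Twice the Gromov product, that is, twice the depth of the last common ancestor of \<open>x\<close> and \<open>y\<close> when the tree
  is rooted at \<open>r\<close>. The exchange arguments use only that it is an ultrametric similarity.\<close>

definition gprod :: "'a \<Rightarrow> 'a \<Rightarrow> 'a \<Rightarrow> int" where
  "gprod r x y = int (d r x) + int (d r y) - int (d x y)"

lemma gprod_sym: "x \<in> V \<Longrightarrow> y \<in> V \<Longrightarrow> gprod r x y = gprod r y x"
  by (simp add: gprod_def sym)

lemma gprod_ultra:
  assumes "r \<in> V" "x \<in> V" "y \<in> V" "z \<in> V"
  shows "min (gprod r x y) (gprod r y z) \<le> gprod r x z"
  using four[OF assms(2,4,1,3)] assms sym[of x r] sym[of z r] sym[of z y] sym[of y x]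
  unfolding gprod_def by linarith

definition sol :: "'a set \<Rightarrow> 'a set \<Rightarrow> bool" where
  "sol W L \<longleftrightarrow> W \<subseteq> V \<and> L \<subseteq> V \<and>
    (\<forall>x\<in>V. \<forall>y\<in>V. x \<noteq> y \<longrightarrow> (\<exists>w\<in>W. d w x \<le> 1 \<or> d w y \<le> 1) \<or> (\<exists>l\<in>L. d l x \<noteq> d l y))"

lemma solD:
  "sol W L \<Longrightarrow> x \<in> V \<Longrightarrow> y \<in> V \<Longrightarrow> x \<noteq> y \<Longrightarrow> (\<And>w. w \<in> W \<Longrightarrow> 2 \<le> d w x \<and> 2 \<le> d w y) \<Longrightarrow>
   \<exists>l\<in>L. d l x \<noteq> d l y"
  unfolding sol_def by (metis Suc_1 not_less_eq_eq)

text \<open>Each watcher or listener is nearer to at most one neighbour of \<open>x\<close> than to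
  \<open>x\<close>. Among \<open>k + 2\<close> neighbours, two are therefore reached only through
  \<open>x\<close> by all of them; nobody tells these two apart, and only a watcher at
  \<open>x\<close> could dominate either.\<close>

lemma high_degree_watcher:
  assumes "sol W L" "card W + card L \<le> k" "x \<in> V" "k + 2 \<le> card {y \<in> V. d x y = 1}"
  shows "x \<in> W"
proof (rule ccontr)
  assume x: "x \<notin> W"
  define N where "N = {y \<in> V. d x y = 1}"
  define S where "S = W \<union> L"
  have SV: "S \<subseteq> V" "W \<subseteq> V" "L \<subseteq> V" using assms(1) unfolding sol_def S_def by auto
  have finS: "finite S" using SV fin finite_subset by blast
  have cS: "card S \<le> k" using card_Un_le[of W L] assms(2) unfolding S_def by linarith
  define f where "f s = {y \<in> N. d s y < d s x}" for s
  have f1: "card (f s) \<le> 1" if s: "s \<in> S" for s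
  proof -
    have "y = z" if "y \<in> f s" "z \<in> f s" for y z
    proof -
      have yz: "y \<in> V" "z \<in> V" "d x y = 1" "d x z = 1" "d s y < d s x" "d s z < d s x"
        using that unfolding f_def N_def by auto
      \<comment> \<open>The right-hand side is at most \<open>d s x\<close>, so there is only one
        first step from \<open>x\<close> towards \<open>s\<close>.\<close>
      have "d s x + d y z \<le> max (d s y + d x z) (d s z + d x y)"
        using four[of s x y z] yz s SV assms(3) by blast
      hence "d y z = 0" using yz by linarith
      thus ?thesis using zero yz by blast
    qed
    moreover have "finite (f s)" unfolding f_def N_def using fin by simp
    ultimately show ?thesis by (metis card_le_Suc0_iff_eq One_nat_def)
  qed
  have "card (\<Union>s\<in>S. f s) \<le> (\<Sum>s\<in>S. card (f s))" by (rule card_UN_le[OF finS])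
  also have "\<dots> \<le> (\<Sum>s\<in>S. 1)" by (rule sum_mono) (use f1 in auto)
  finally have "card (\<Union>s\<in>S. f s) \<le> k" using cS by simp
  moreover have finN: "finite N" unfolding N_def using fin by simp
  moreover have "(\<Union>s\<in>S. f s) \<subseteq> N" unfolding f_def by auto
  ultimately have "2 \<le> card (N - (\<Union>s\<in>S. f s))"
    using assms(4) card_Diff_subset[of "\<Union>s\<in>S. f s" N] finite_subset unfolding N_def[symmetric] by fastforce
  then obtain T where T: "T \<subseteq> N - (\<Union>s\<in>S. f s)" "card T = 2" by (meson obtain_subset_with_card_n)
  then obtain y z where yz: "y \<noteq> z" "T = {y,z}" by (meson card_2_iff)
  have yz': "y \<in> V" "z \<in> V" "d x y = 1" "d x z = 1" using T yz unfolding N_def by auto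
  \<comment> \<open>Parity (\<open>par\<close>) excludes equality with \<open>d s x\<close>, so
    every distance to \<open>y\<close> and \<open>z\<close> is exactly one larger.\<close>
  have far: "d s y = d s x + 1 \<and> d s z = d s x + 1" if s: "s \<in> S" for s
  proof -
    have "\<not> d s y < d s x" "\<not> d s z < d s x"
      using T yz s unfolding f_def N_def by auto
    moreover have "d s y \<noteq> d s x" "d s z \<noteq> d s x"
      using par[of x y s] par[of x z s] yz' s SV assms(3) by (metis subsetD)+
    moreover have "d s y \<le> d s x + 1" "d s z \<le> d s x + 1"
      using triangle[of s y x] triangle[of s z x] yz' s SV assms(3) by (metis subsetD)+
    ultimately show ?thesis by linarith
  qed
  have "2 \<le> d w y \<and> 2 \<le> d w z" if w: "w \<in> W" for w
  proof -
    have "d w x \<noteq> 0" using x w SV assms(3) zero by (metis subsetD)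
    thus ?thesis using far[of w] w unfolding S_def by auto
  qed
  from solD[OF assms(1) yz'(1,2) yz(1) this] obtain l where "l \<in> L" "d l y \<noteq> d l z" by blast
  thus False using far[of l] unfolding S_def by auto
qed

text \<open>Limits the candidates for a watcher near \<open>u\<close>: if \<open>u\<close> itself
  does not qualify, it has few neighbours.\<close>

lemma ball_card_bound:
  assumes "sol W L" "card W + card L \<le> k" "w \<in> W" "u \<in> V" "d w u \<le> 1"
  shows "u \<in> W \<or> (d u w = 1 \<and> card {y \<in> V. d u y = 1} \<le> k + 1)"
proof (cases "u \<in> W")
  case False
  have "w \<in> V" using assms unfolding sol_def by auto
  hence "d u w \<noteq> 0" using False assms zero[of u w] by metis
  hence "d u w = 1" using assms sym \<open>w \<in> V\<close> by (metis One_nat_def le_SucE le_zero_eq)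
  moreover have "\<not> k + 2 \<le> card {y \<in> V. d u y = 1}" using high_degree_watcher assms False by blast
  ultimately show ?thesis by simp
qed simp

section \<open>Conflicts and the exchange of listeners\<close>

definition conflict :: "'a set \<Rightarrow> 'a set \<Rightarrow> 'a \<Rightarrow> 'a \<Rightarrow> bool" where
  "conflict W L x y \<longleftrightarrow> x \<in> V \<and> y \<in> V \<and> x \<noteq> y \<and> (\<forall>w\<in>W. 2 \<le> d w x \<and> 2 \<le> d w y) \<and> (\<forall>l\<in>L. d l x = d l y)"

lemma sol_conflict: "sol W L \<longleftrightarrow> W \<subseteq> V \<and> L \<subseteq> V \<and> (\<forall>x y. \<not> conflict W L x y)"
proof -
  have "(2 \<le> d w x) = (\<not> d w x \<le> 1)" for w x by linarith
  thus ?thesis unfolding sol_def conflict_def by (simp only:) blast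
qed

lemma conflict_sym: "conflict W L x y \<longleftrightarrow> conflict W L y x"
  unfolding conflict_def by metis

text \<open>The vertices \<open>l\<close> and \<open>u\<close> hang in the same branch below the
  midpoint of \<open>u\<close> and \<open>v\<close>. Seen from outside this branch they differ only
  by a constant, and inside it a pair left unseparated would be a deeper conflict. So nothing is
  lost when the listener moves from \<open>l\<close> to \<open>u\<close>.\<close>

lemma exchange_real:
  assumes sol: "sol W L" and sub: "W0 \<subseteq> W" "L0 \<subseteq> L" "r \<in> L0"
    and c: "conflict W0 L0 u v"
    and mx: "\<And>x y. conflict W0 L0 x y \<Longrightarrow> gprod r x y \<le> gprod r u v"
    and l: "l \<in> L" "gprod r u v < gprod r l u"
  shows "sol W (insert u (L - {l}))" and "L0 \<subseteq> insert u (L - {l})"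
proof -
  have V: "W \<subseteq> V" "L \<subseteq> V" "u \<in> V" "v \<in> V" "r \<in> V" "l \<in> V" using sol sub c l unfolding sol_def conflict_def by auto
  \<comment> \<open>A chosen listener does not separate \<open>u\<close> and \<open>v\<close>. It
    would have the same product with both, which would then share at least that much with each
    other.\<close>
  have "l \<notin> L0"
  proof
    assume "l \<in> L0"
    hence "d l u = d l v" "d r u = d r v" using c sub unfolding conflict_def by auto
    hence "gprod r l u = gprod r l v" unfolding gprod_def by simp
    thus False using gprod_ultra[of r u l v] gprod_sym[of u l r] V l(2) by linarith
  qed
  thus L0: "L0 \<subseteq> insert u (L - {l})" using sub by auto
  show "sol W (insert u (L - {l}))"
    unfolding sol_conflict
  proof (intro conjI allI notI)
    fix x y assume c2: "conflict W (insert u (L - {l})) x y"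
    hence xy: "x \<in> V" "y \<in> V" "x \<noteq> y" unfolding conflict_def by auto
    have c0: "conflict W0 L0 x y" using c2 sub L0 unfolding conflict_def by blast
    have "\<not> conflict W L x y" using sol sol_conflict by blast
    hence ne: "d l x \<noteq> d l y" using c2 unfolding conflict_def by auto
    have eq: "d r x = d r y" "d u x = d u y" using c0 c2 sub unfolding conflict_def by auto
    have g: "gprod r u x = gprod r u y" "gprod r l x \<noteq> gprod r l y" using ne eq unfolding gprod_def by auto
    note U = gprod_ultra[OF V(5)] and S = gprod_sym
    \<comment> \<open>Below the value \<open>gprod r l u\<close> products with \<open>u\<close> and
      with \<open>l\<close> coincide. As \<open>l\<close> distinguishes \<open>x\<close> from
      \<open>y\<close> and \<open>u\<close> does not, their common product with \<open>u\<close> is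
      at least \<open>gprod r l u\<close>, and then so is their product with each other.\<close>
    have "gprod r u v < gprod r x y"
      using U[of x l y] U[of x u y] U[of l x u] U[of l y u] U[of u l x] U[of u l y] U[of u x l] U[of u y l]
        U[of l u x] U[of l u y] U[of x y u] U[of y x l] U[of x y l] U[of l x y] U[of l y x]
        S[of x l r] S[of x u r] S[of y l r] S[of y u r] S[of x y r] S[of l u r] l(2) g xy V
      by (smt (verit))
    with mx[OF c0] show False by simp
  qed (use V in auto)
qed

text \<open>Here \<open>r\<close> is not a listener. If some other listener lies outside the branch of \<open>u\<close>, it plays the role of the
  root after \<open>l\<close> has been moved to \<open>u\<close>; otherwise all listeners can be replaced by \<open>u\<close> and \<open>r\<close>.\<close>

lemma exchange_virtual:
  assumes sol: "sol W L" "2 \<le> card L" and sub: "W0 \<subseteq> W" "r \<in> V"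
    and c: "conflict W0 {r} u v"
    and mx: "\<And>x y. conflict W0 {r} x y \<Longrightarrow> gprod r x y \<le> gprod r u v"
    and l: "l \<in> L" "gprod r u v < gprod r l u"
  shows "\<exists>L'. sol W L' \<and> u \<in> L' \<and> card L' \<le> card L"
proof -
  have V: "W \<subseteq> V" "L \<subseteq> V" "u \<in> V" "v \<in> V" "r \<in> V" "l \<in> V" using sol sub c l unfolding sol_def conflict_def by auto
  have finL: "finite L" using V fin finite_subset by blast
  note U = gprod_ultra[OF V(5)] and S = gprod_sym
  show ?thesis
  proof (cases "\<exists>l'\<in>L. gprod r l' u \<le> gprod r u v")
    case True
    then obtain l' where l': "l' \<in> L" "gprod r l' u \<le> gprod r u v" by blast
    have l'V: "l' \<in> V" using l' V by auto
    let ?L = "insert u (L - {l})"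
    have "sol W ?L"
      unfolding sol_conflict
    proof (intro conjI allI notI)
      fix x y assume c2: "conflict W ?L x y"
      hence xy: "x \<in> V" "y \<in> V" "x \<noteq> y" unfolding conflict_def by auto
      have "\<not> conflict W L x y" using sol sol_conflict by blast
      hence ne: "d l x \<noteq> d l y" using c2 unfolding conflict_def by auto
      have "l' \<noteq> l" using l l' by auto
      hence eq: "d l' x = d l' y" "d u x = d u y" using c2 l' unfolding conflict_def by auto
      define X Y where "X = int (d r x)" and "Y = int (d r y)"
      have E1: "X - gprod r l' x = Y - gprod r l' y" and E2: "X - gprod r u x = Y - gprod r u y"
        and E3: "X - gprod r l x \<noteq> Y - gprod r l y"
        using eq ne unfolding gprod_def X_def Y_def by auto
      define h where "h = gprod r u v"
      \<comment> \<open>If both vertices lie in the branch of \<open>u\<close>, then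
        \<open>l'\<close> sees them through the same point and forces equal depth. If exactly one
        does, \<open>E1\<close> and \<open>E2\<close> would make its product with \<open>u\<close>
        equal to \<open>gprod r l' u\<close>, which is at most \<open>h\<close>. If neither does,
        \<open>l\<close> and \<open>u\<close> see the same and \<open>E2\<close> contradicts
        \<open>E3\<close>.\<close>
      have "X = Y \<and> h < gprod r x y"
      proof (cases "h < gprod r u x")
        case A: True
        show ?thesis
        proof (cases "h < gprod r u y")
          case True
          have "gprod r l' x = gprod r l' u" 
            using A l' U[of l' x u] U[of l' u x] S[of x u r] V l'V xy unfolding h_def by force
          moreover have "gprod r l' y = gprod r l' u"
            using True l' U[of l' y u] U[of l' u y] S[of y u r] V l'V xy unfolding h_def by force
          ultimately have "X = Y" using E1 by simp
          moreover have "h < gprod r x y" using A True U[of x u y] S[of x u r] V xy by force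
          ultimately show ?thesis by simp
        next
          case False
          have "gprod r l' x = gprod r l' u" 
            using A l' U[of l' x u] U[of l' u x] S[of x u r] V l'V xy unfolding h_def by force
          thus ?thesis using E1 E2 A False l' U[of l' y u] U[of l' u y] S[of y u r] U[of u l' y] S[of u l' r] V l'V xy
            unfolding h_def by (smt (verit))
        qed
      next
        case A: False
        show ?thesis
        proof (cases "h < gprod r u y")
          case True
          have "gprod r l' y = gprod r l' u" 
            using True l' U[of l' y u] U[of l' u y] S[of y u r] V l'V xy unfolding h_def by force
          thus ?thesis using E1 E2 A True l' U[of l' x u] U[of l' u x] S[of x u r] U[of u l' x] S[of u l' r] V l'V xy
            unfolding h_def by (smt (verit))
        next
          case False
          have "gprod r l x = gprod r u x"
            using A l U[of l u x] U[of u l x] S[of l u r] V xy unfolding h_def by force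
          moreover have "gprod r l y = gprod r u y"
            using False l U[of l u y] U[of u l y] S[of l u r] V xy unfolding h_def by force
          ultimately show ?thesis using E2 E3 by simp
        qed
      qed
      moreover from this have "conflict W0 {r} x y"
        using c2 sub unfolding conflict_def X_def Y_def by auto
      ultimately show False using mx unfolding h_def by force
    qed (use V in auto)
    moreover have "card ?L \<le> card L"
      by (metis card_Suc_Diff1 card_insert_le_m1 finL l(1) zero_less_Suc diff_Suc_1 finite_Diff order_refl)
    ultimately show ?thesis by blast
  next
    case False
    hence all: "gprod r u v < gprod r l' u" if "l' \<in> L" for l' using that by force
    \<comment> \<open>Now \<open>r\<close> becomes a listener, so an unresolved pair in the branch
      of \<open>u\<close> would be a deeper conflict. Outside the branch, every old listener sees
      what \<open>u\<close> sees. The two new listeners are paid for by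
      \<open>2 \<le> card L\<close>.\<close>
    have "sol W {u,r}"
      unfolding sol_conflict
    proof (intro conjI allI notI)
      fix x y assume c2: "conflict W {u,r} x y"
      hence xy: "x \<in> V" "y \<in> V" "x \<noteq> y" "d r x = d r y" "d u x = d u y" unfolding conflict_def by auto
      hence g: "gprod r u x = gprod r u y" unfolding gprod_def by simp
      show False
      proof (cases "gprod r u v < gprod r u x")
        case True
        hence "gprod r u v < gprod r x y" using g U[of x u y] S[of x u r] V xy by force
        moreover have "conflict W0 {r} x y" using c2 sub unfolding conflict_def by auto
        ultimately show False using mx by force
      next
        case False
        have "d l' x = d l' y" if l': "l' \<in> L" for l'
        proof -
          have "l' \<in> V" using l' V by auto
          have "gprod r l' x = gprod r l' y"
            using False g all[OF l'] U[of l' u x] U[of u l' x] U[of l' u y] U[of u l' y] S[of l' u r] V xy \<open>l' \<in> V\<close>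
            by force
          thus ?thesis using xy unfolding gprod_def by simp
        qed
        hence "conflict W L x y" using c2 unfolding conflict_def by auto
        thus False using sol sol_conflict by blast
      qed
    qed (use V in auto)
    moreover have "card {u,r} \<le> card L" using sol(2) card_insert_le_m1[of 2 "{r}" u] by simp
    ultimately show ?thesis by blast
  qed
qed

text \<open>Among the three products of three points the minimum is attained twice. Those of
  \<open>l\<close> with \<open>u\<close> and \<open>v\<close> differ, so the larger one exceeds
  \<open>gprod r u v\<close>: the separator hangs in the branch of \<open>u\<close> or of
  \<open>v\<close>.\<close>

lemma separator_side:
  assumes "r \<in> V" "l \<in> V" "u \<in> V" "v \<in> V" "d r u = d r v" "d l u \<noteq> d l v"
  shows "gprod r u v < gprod r l u \<or> gprod r v u < gprod r l v"
  using gprod_ultra[of r l u v] gprod_ultra[of r l v u] gprod_sym[of u v r] assms unfolding gprod_def by linarith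

end

section \<open>Distances in trees\<close>

text \<open>Distances are built up by attaching leaves, which is both how the program computes them and how
  the four-point condition is proved.\<close>

inductive grown :: "('a \<Rightarrow> 'a \<Rightarrow> bool) \<Rightarrow> 'a set \<Rightarrow> ('a \<Rightarrow> 'a \<Rightarrow> nat) \<Rightarrow> bool" for adj where
  single: "d a a = 0 \<Longrightarrow> grown adj {a} d"
| leaf: "grown adj A d \<Longrightarrow> p \<in> A \<Longrightarrow> y \<notin> A \<Longrightarrow> adj p y \<Longrightarrow>
    (\<And>x z. x \<in> A \<Longrightarrow> z \<in> A \<Longrightarrow> d' x z = d x z) \<Longrightarrow> d' y y = 0 \<Longrightarrow>
    (\<And>x. x \<in> A \<Longrightarrow> d' x y = d p x + 1 \<and> d' y x = d p x + 1) \<Longrightarrow> grown adj (insert y A) d'"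

lemma grown_finite: "grown adj A d \<Longrightarrow> finite A"
  by (induction rule: grown.induct) auto

lemma grown_sym: "grown adj A d \<Longrightarrow> x \<in> A \<Longrightarrow> y \<in> A \<Longrightarrow> d x y = d y x"
  by (induction arbitrary: x y rule: grown.induct) auto

lemma grown_zero: "grown adj A d \<Longrightarrow> x \<in> A \<Longrightarrow> y \<in> A \<Longrightarrow> d x y = 0 \<longleftrightarrow> x = y"
  by (induction arbitrary: x y rule: grown.induct) auto

lemma grown_less_card: "grown adj A d \<Longrightarrow> x \<in> A \<Longrightarrow> y \<in> A \<Longrightarrow> d x y < card A"
proof (induction arbitrary: x y rule: grown.induct)
  case (leaf A d p v d' x y)
  have "card (insert v A) = Suc (card A)" using leaf.hyps grown_finite[OF leaf.hyps(1)] by simp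
  thus ?case using leaf.IH[of p x] leaf.IH[of p y] leaf.IH[of x y] leaf.hyps leaf.prems by auto
qed simp

text \<open>The perimeter of a triangle in a tree counts every edge of the spanned tripod twice.
  Consequently no vertex is equidistant from the two ends of an edge, which is the assumption
  \<open>par\<close>.\<close>

lemma grown_even: "grown adj A d \<Longrightarrow> x \<in> A \<Longrightarrow> y \<in> A \<Longrightarrow> z \<in> A \<Longrightarrow> even (d x y + d y z + d x z)"
proof (induction arbitrary: x y z rule: grown.induct)
  case (leaf A d p v d' a b c)
  have S: "d u w = d w u" if "u \<in> A" "w \<in> A" for u w using grown_sym leaf.hyps that by metis
  have two: "even (d p u + d p w + d u w)" if "u \<in> A" "w \<in> A" for u w
    using leaf.IH[of p u w] leaf.hyps(2) that by (simp add: ac_simps)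
  show ?case
    using leaf.prems two[of a b] two[of b c] two[of a c] leaf.IH[of a b c] leaf.hyps(3)
    apply (elim insertE)
           apply (simp_all add: leaf.hyps(5-7))
   apply satx+
   done
qed simp

text \<open>The new leaf is its attachment point \<open>p\<close> plus one step. If it occurs once,
  all three pairings grow by 1. If it forms one pair with itself, the triangle inequality through
  \<open>p\<close> suffices. If it occurs in both pairs on the left, one pairing on the right is the
  left side again, by symmetry.\<close>

lemma grown_four:
  "grown adj A d \<Longrightarrow> x \<in> A \<Longrightarrow> y \<in> A \<Longrightarrow> z \<in> A \<Longrightarrow> w \<in> A \<Longrightarrow>
   d x y + d z w \<le> max (d x z + d y w) (d x w + d y z)"
proof (induction arbitrary: x y z w rule: grown.induct)
  case (leaf A d p v d' a b c e)
  have S: "d u w = d w u" if "u \<in> A" "w \<in> A" for u w using grown_sym leaf.hyps(1) that by metis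
  have p: "p \<in> A" "d p p = 0" using leaf.hyps(2) grown_zero[OF leaf.hyps(1)] by auto
  have tri: "d u w \<le> d p u + d p w" if "u \<in> A" "w \<in> A" for u w
    using leaf.IH[OF that p(1) p(1)] S[OF that(1) p(1)] S[OF that(2) p(1)] p(2) by simp
  note E = leaf.hyps(5-7)
  note IH = leaf.IH
  have S': "d' u w = d' w u" if "u \<in> insert v A" "w \<in> insert v A" for u w
    using that S by (elim insertE) (simp_all add: E)
  have pv: "d' x' v = d p x' + 1" "d' v x' = d p x' + 1" if "x' \<in> A" for x' using E(3)[OF that] by auto
  consider "a = v" "b = v" "c \<in> A" "e \<in> A" | "a \<in> A" "b \<in> A" "c = v" "e = v" | "a = v" "b \<in> A" "c \<in> A" "e \<in> A"
    | "a \<in> A" "b = v" "c \<in> A" "e \<in> A" | "a \<in> A" "b \<in> A" "c = v" "e \<in> A" | "a \<in> A" "b \<in> A" "c \<in> A" "e = v"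
    | "a \<in> A" "b \<in> A" "c \<in> A" "e \<in> A" | "a = v \<and> c = v \<or> a = v \<and> e = v \<or> b = v \<and> c = v \<or> b = v \<and> e = v"
    using leaf.prems unfolding insert_iff by argo
  thus ?case
  proof cases
    case 1
    thus ?thesis using tri[of c e] by (simp add: E(1,2) pv)
  next
    case 2
    thus ?thesis using tri[of a b] by (simp add: E(1,2) pv)
  next
    case 3
    thus ?thesis using IH[of p b c e] p by (simp add: E(1) pv)
  next
    case 4
    thus ?thesis using IH[of a p c e] S[of a p] S[of p c] S[of p e] p by (simp add: E(1) pv)
  next
    case 5
    thus ?thesis using IH[of a b p e] S[of a p] S[of b p] S[of p e] p by (simp add: E(1) pv)
  next
    case 6
    thus ?thesis using IH[of a b c p] S[of a p] S[of b p] S[of c p] p by (simp add: E(1) pv)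
  next
    case 7
    thus ?thesis using IH[of a b c e] by (simp add: E(1))
  next
    case 8
    thus ?thesis using S'[OF leaf.prems(1,2)] S'[OF leaf.prems(3,4)] S'[OF leaf.prems(1,4)] S'[OF leaf.prems(2,3)]
      S'[OF leaf.prems(1,3)] S'[OF leaf.prems(2,4)] E(2) by (elim disjE) simp_all
  qed
qed simp

text \<open>Turns table entries into walks: from \<open>y\<close> one can always step to a neighbour
  that is nearer to \<open>x\<close>.\<close>

lemma grown_predecessor:
  "grown adj A d \<Longrightarrow> symp adj \<Longrightarrow> x \<in> A \<Longrightarrow> y \<in> A \<Longrightarrow> x \<noteq> y \<Longrightarrow> \<exists>z\<in>A. adj z y \<and> d x z + 1 = d x y"
proof (induction arbitrary: x y rule: grown.induct)
  case (leaf A d p v d')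
  have S: "d u w = d w u" if "u \<in> A" "w \<in> A" for u w using grown_sym leaf.hyps that by metis
  show ?case
  proof (cases "x = v")
    case False
    hence x: "x \<in> A" using leaf.prems by auto
    show ?thesis
    proof (cases "y = v")
      case True
      thus ?thesis using x leaf.hyps S[of p x] by (intro bexI[of _ p]) auto
    next
      case False
      then obtain z where "z \<in> A" "adj z y" "d x z + 1 = d x y" using leaf.IH[of x y] x leaf.prems by auto
      thus ?thesis using x False leaf.hyps leaf.prems by (intro bexI[of _ z]) auto
    qed
  next
    case True
    hence y: "y \<in> A" using leaf.prems by auto
    show ?thesis
    proof (cases "y = p")
      case True
      thus ?thesis using \<open>x = v\<close> leaf.hyps leaf.prems grown_zero[OF leaf.hyps(1), of p p]
        by (intro bexI[of _ v]) (auto dest: sympD)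
    next
      case False
      then obtain z where "z \<in> A" "adj z y" "d p z + 1 = d p y" using leaf.IH[of p y] y leaf.prems leaf.hyps by auto
      thus ?thesis using True False leaf.hyps y by (intro bexI[of _ z]) auto
    qed
  qed
qed simp

lemma grown_tree_metric:
  assumes g: "grown adj A d"
  shows "tree_metric A d"
proof
  show "d s x \<noteq> d s y" if "x \<in> A" "y \<in> A" "s \<in> A" "d x y = 1" for x y s
    using grown_even[OF g that(3,1,2)] that(4) by auto
qed (fact grown_finite[OF g] grown_sym[OF g] grown_zero[OF g] grown_four[OF g])+

section \<open>The distance table and the graph distance\<close>

definition edge :: "'a pair_pre_digraph \<Rightarrow> 'a \<Rightarrow> 'a \<Rightarrow> bool" where
  "edge T u v \<longleftrightarrow> (u, v) \<in> parcs T"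

locale tree_graph =
  fixes T :: "'a pair_pre_digraph"
  assumes tree: "is_tree T"
begin

sublocale pair_graph T
  using tree unfolding is_tree_def by simp

lemma acyclic: "\<not> (cycle p \<and> 3 \<le> length p)"
  using tree unfolding is_tree_def by auto

lemma edge_symp: "symp (edge T)"
  unfolding symp_def edge_def using arcs_symmetric by blast

lemma edge_in_verts: "edge T u v \<Longrightarrow> u \<in> pverts T \<and> v \<in> pverts T"
  unfolding edge_def using in_arcsD1 in_arcsD2 by auto

text \<open>Connectedness in the form needed for growing: a nonempty proper set of vertices is left
  by some edge.\<close>

lemma edge_closed_eq_verts:
  assumes "A \<subseteq> pverts T" "A \<noteq> {}" "\<And>u v. u \<in> A \<Longrightarrow> edge T u v \<Longrightarrow> v \<in> A"
  shows "A = pverts T"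
proof -
  obtain a where a: "a \<in> A" using assms by auto
  have sc: "strongly_connected (with_proj T)"
    using tree symmetric_connected_imp_strongly_connected pair_sym_arcs unfolding is_tree_def by blast
  have "v \<in> A" if "v \<in> pverts T" for v
  proof -
    have "a \<rightarrow>\<^sup>*\<^bsub>with_proj T\<^esub> v" using sc that a assms(1) unfolding strongly_connected_def by auto
    then obtain p where "awalk a p v" using reachable_awalk by blast
    thus ?thesis using a
    proof (induction p arbitrary: a)
      case (Cons e p)
      hence "edge T a (snd e)" "awalk (snd e) p v" unfolding edge_def
        by (cases e, auto simp: awalk_Cons_iff)+
      thus ?case using Cons assms(3) by blast
    qed (simp add: awalk_Nil_iff)
  qed
  thus ?thesis using assms(1) by blast
qed

text \<open>The bound on the distances along the path makes the induction work: the next vertex is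
  farther from \<open>x\<close> than everything before it, so the path stays simple.\<close>

lemma grown_path:
  assumes g: "grown (edge T) (pverts T) d" and "x \<in> pverts T" "y \<in> pverts T"
  shows "\<exists>p. awalk x p y \<and> length p = d x y \<and> distinct (awalk_verts x p) \<and> (\<forall>z\<in>set (awalk_verts x p). d x z \<le> d x y)"
  using assms(3)
proof (induction "d x y" arbitrary: y)
  case 0
  hence "x = y" using grown_zero[OF g] assms by metis
  thus ?case using 0 assms by (intro exI[of _ "[]"]) (auto simp: awalk_Nil_iff)
next
  case (Suc m)
  have "x \<noteq> y" using Suc grown_zero[OF g] assms by (metis nat.distinct(1))
  then obtain z where z: "z \<in> pverts T" "edge T z y" "d x z + 1 = d x y"
    using grown_predecessor[OF g edge_symp assms(2) Suc(3)] by blast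
  then obtain p where p: "awalk x p z" "length p = d x z" "distinct (awalk_verts x p)"
    "\<forall>w\<in>set (awalk_verts x p). d x w \<le> d x z" using Suc(1)[of z] Suc(2) by auto
  have w: "awalk z [(z,y)] y" using z unfolding edge_def by (auto simp: awalk_Cons_iff awalk_Nil_iff edge_in_verts in_arcsD2)
  have "awalk x (p @ [(z,y)]) y" using p w by auto
  moreover have "awalk_verts x (p @ [(z,y)]) = awalk_verts x p @ [y]"
    using awalk_verts_append[OF calculation] by simp
  moreover have "y \<notin> set (awalk_verts x p)" using p(4) z(3) by force
  ultimately show ?case using p z(3) by (intro exI[of _ "p @ [(z,y)]"]) auto
qed

text \<open>This is where acyclicity enters. The predicate \<open>grown\<close> knows only the edges
  along which leaves were attached; an edge between vertices at tabulated distance at least 2 would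
  close their path to a cycle of length at least 3.\<close>

lemma grown_edge_iff:
  assumes g: "grown (edge T) (pverts T) d" and "x \<in> pverts T" "y \<in> pverts T"
  shows "edge T x y \<longleftrightarrow> d x y = 1"
proof
  assume e: "edge T x y"
  show "d x y = 1"
  proof (rule ccontr)
    assume "d x y \<noteq> 1"
    moreover have "x \<noteq> y" using e no_loops' unfolding edge_def by blast
    hence "d x y \<noteq> 0" using grown_zero[OF g] assms by blast
    ultimately have 2: "2 \<le> d x y" by linarith
    obtain p where p: "awalk x p y" "length p = d x y" "distinct (awalk_verts x p)"
      using grown_path[OF assms] by blast
    have "awalk y [(y,x)] x" using e arcs_symmetric assms unfolding edge_def
      by (auto simp: awalk_Cons_iff awalk_Nil_iff)
    hence w: "awalk x (p @ [(y,x)]) x" using p by auto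
    have "awalk_verts x (p @ [(y,x)]) = awalk_verts x p @ [x]"
      using awalk_verts_append[OF w] by simp
    moreover obtain vs where "awalk_verts x p = x # vs"
      using p(1) by (cases p) (auto simp: awalk_Cons_iff)
    ultimately have "distinct (tl (awalk_verts x (p @ [(y,x)])))" using p(3) by auto
    hence "cycle (p @ [(y,x)])" using w unfolding cycle_def by auto
    thus False using acyclic[of "p @ [(y,x)]"] p(2) 2 by auto
  qed
next
  assume 1: "d x y = 1"
  hence "x \<noteq> y" using grown_zero[OF g] assms by force
  then obtain z where "z \<in> pverts T" "edge T z y" "d x z + 1 = d x y"
    using grown_predecessor[OF g edge_symp assms(2,3)] by blast
  thus "edge T x y" using 1 grown_zero[OF g, of x z] assms by auto
qed

lemma gdist_grown:
  assumes g: "grown (edge T) (pverts T) d" and "x \<in> pverts T" "y \<in> pverts T"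
  shows "gdist T x y = ereal (real (d x y))"
proof -
  interpret M: tree_metric "pverts T" d using grown_tree_metric[OF g] .
  have cost: "awalk_cost (\<lambda>_. 1) p = real (length p)" for p
    by (induction p) (auto simp: awalk_cost_def)
  \<comment> \<open>By the triangle inequality no walk is shorter than the tabulated distance, so
    the infimum over all walks is attained by the path of \<open>grown_path\<close>.\<close>
  have low: "d u v \<le> length p" if "awalk u p v" for u v p
    using that
  proof (induction p arbitrary: u)
    case Nil
    thus ?case by (auto simp: awalk_Nil_iff)
  next
    case (Cons e p)
    hence 1: "edge T u (snd e)" "awalk (snd e) p v" unfolding edge_def by (cases e, auto simp: awalk_Cons_iff)+
    hence V: "u \<in> pverts T" "snd e \<in> pverts T" "v \<in> pverts T" using edge_in_verts awalk_last_in_verts by auto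
    hence "d u (snd e) = 1" using grown_edge_iff[OF g] 1 by blast
    thus ?case using Cons.IH[OF 1(2)] M.triangle[of u v "snd e"] V by simp
  qed
  obtain p where p: "awalk x p y" "length p = d x y" using grown_path[OF assms] by blast
  have "\<mu> (\<lambda>_. 1) x y \<le> ereal (real (d x y))" using min_cost_le_walk_cost[OF p(1), of "\<lambda>_. 1"] p(2) cost by simp
  moreover have "ereal (real (d x y)) \<le> \<mu> (\<lambda>_. 1) x y"
    unfolding \<mu>_def by (rule INF_greatest) (use low cost in auto)
  ultimately show ?thesis unfolding gdist_def by simp
qed

lemma detection_pair_iff_sol:
  assumes g: "grown (edge T) (pverts T) d"
  shows "detection_pair T W L \<longleftrightarrow> tree_metric.sol (pverts T) d W L"
proof -
  interpret M: tree_metric "pverts T" d using grown_tree_metric[OF g] .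
  show ?thesis
  proof (cases "W \<subseteq> pverts T \<and> L \<subseteq> pverts T")
    case True
    have dom: "dominated_by T W u \<longleftrightarrow> (\<exists>w\<in>W. d w u \<le> 1)" if "u \<in> pverts T" for u
    proof -
      have "u \<in> closed_nbhd T w \<longleftrightarrow> d w u \<le> 1" if "w \<in> W" for w
      proof -
        have "w \<in> pverts T" using that True by auto
        thus ?thesis using grown_edge_iff[OF g, of w u] grown_zero[OF g, of w u] \<open>u \<in> pverts T\<close>
          unfolding closed_nbhd_def edge_def by auto
      qed
      thus ?thesis unfolding dominated_by_def by blast
    qed
    have sep: "separates T l u v \<longleftrightarrow> d l u \<noteq> d l v" if "l \<in> L" "u \<in> pverts T" "v \<in> pverts T" for l u v
    proof -
      have "l \<in> pverts T" using that True by auto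
      thus ?thesis using that M.sym[of l u] M.sym[of l v] unfolding separates_def by (simp add: gdist_grown[OF g])
    qed
    have dist: "distinguished T W L u \<longleftrightarrow> (\<forall>v\<in>pverts T. u \<noteq> v \<longrightarrow>
        (\<exists>w\<in>W. d w u \<le> 1 \<or> d w v \<le> 1) \<or> (\<exists>l\<in>L. d l u \<noteq> d l v))" if u: "u \<in> pverts T" for u
    proof (cases "dominated_by T W u")
      case True
      thus ?thesis using dom[OF u] unfolding distinguished_def by auto
    next
      case False
      have "dominated_by T W v \<or> (\<exists>l\<in>L. separates T l u v) \<longleftrightarrow>
          (\<exists>w\<in>W. d w u \<le> 1 \<or> d w v \<le> 1) \<or> (\<exists>l\<in>L. d l u \<noteq> d l v)" if v: "v \<in> pverts T" for v
        using False sep[OF _ u v] dom[OF v] dom[OF u] by blast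
      thus ?thesis using False unfolding distinguished_def by auto
    qed
    show ?thesis unfolding detection_pair_def M.sol_def using True dist by simp
  qed (auto simp: detection_pair_def M.sol_def)
qed

end

section \<open>The search tree\<close>

locale search = tree_metric "{0..<n}" d for n :: nat and d +
  fixes k :: nat
  assumes n_pos: "0 < n"
begin

text \<open>Row \<open>n\<close> of the distance table is 0, so that a listener at the non-vertex \<open>n\<close> separates nothing; it stands for
  \<open>no listener\<close>.\<close>

definition dt :: "nat \<Rightarrow> nat \<Rightarrow> nat" where
  "dt x y = (if x < n \<and> y < n then d x y else 0)"

text \<open>A partial choice is a list of codes, \<open>2 w\<close> for a watcher \<open>w\<close> and \<open>2 l + 1\<close> for a listener \<open>l\<close>. The head of the
  list is always a listener, the root of the tree.\<close>

definition opn :: "nat list \<Rightarrow> nat \<Rightarrow> nat \<Rightarrow> bool" where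
  "opn xs u v \<longleftrightarrow> (\<forall>a\<in>set xs. if even a then 2 \<le> dt (a div 2) u \<and> 2 \<le> dt (a div 2) v
     else dt (a div 2) u = dt (a div 2) v)"

text \<open>Packing the pair into the key makes the conflict found a function of the list, so that a branch of the
  search tree is determined by its digits; the height dominates the comparison of keys.\<close>

definition key :: "nat \<Rightarrow> nat \<Rightarrow> nat \<Rightarrow> nat" where
  "key h u v = 1 + h * (n * n) + u * n + v"

definition slot0 :: "nat list \<Rightarrow> nat" where
  "slot0 xs = hd xs div 2"

text \<open>When the head is the only listener, a conflict splits into two conditions on single
  vertices, \<open>opn xs u u\<close> and \<open>opn xs v v\<close>, and one comparison of
  distances. This is what makes bucketing possible. No exchange takes place in these modes, so the
  height is left at 0.\<close>

definition fast_keys :: "nat list \<Rightarrow> nat \<Rightarrow> nat set" where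
  "fast_keys xs m = {key 0 u v |u v. v < u \<and> u < m \<and> opn xs u u \<and> opn xs v v \<and> dt (slot0 xs) u = dt (slot0 xs) v}"

text \<open>The height is the Gromov product \<open>gprod\<close> at the root: a conflict has both
  ends equidistant from a listening root, and the triangle inequality makes the truncated
  subtraction exact.\<close>

definition slow_keys :: "nat list \<Rightarrow> nat \<Rightarrow> nat set" where
  "slow_keys xs m = {key (2 * dt (slot0 xs) u - dt u v) u v |u v. u < m \<and> v < n \<and> u \<noteq> v \<and> opn xs u v}"

definition find_key :: "nat \<Rightarrow> nat list \<Rightarrow> nat" where
  "find_key q xs = Max (insert 0 (if q \<le> n then fast_keys xs n else slow_keys xs n))"

text \<open>Enumerates the possible watchers at \<open>x\<close>: index 0 is \<open>x\<close>, index
  \<open>j\<close> its \<open>j\<close>-th neighbour. An index beyond the degree falls back to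
  \<open>x\<close>, so that every digit names a vertex.\<close>

primrec pick :: "nat \<Rightarrow> nat \<Rightarrow> nat \<Rightarrow> nat" where
  "pick x j 0 = x"
| "pick x j (Suc m) = (if dt x m = 1 \<and> card {y. y < m \<and> dt x y = 1} + 1 = j then m else pick x j m)"

text \<open>Mode \<open>q \<le> n\<close> looks for solutions with \<open>q\<close> as the only listener (none at all if \<open>q = n\<close>), mode \<open>n + 1\<close> for those
  with at least two listeners. In the latter the head of the list is a provisional listener 0, and
  the choice \<open>e = 0\<close> replaces it by the first real one.\<close>

definition step :: "nat \<Rightarrow> nat list \<Rightarrow> nat \<Rightarrow> nat list" where
  "step q xs dg = (let f = find_key q xs in if f = 0 then xs else
     let x = (if dg mod 2 = 0 then (f - 1) mod (n * n) div n else (f - 1) mod n);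
         e = dg div 2 + (if q < n + 1 then 2 else 0)
     in if e = 0 then xs[0 := 2 * x + 1] else if e = 1 then xs @ [2 * x + 1] else xs @ [2 * pick x (e - 2) n])"

text \<open>A digit combines the choice between the two ends of the conflict with one of
  \<open>k + 4\<close> actions: replace the head, append a listener, or append the watcher with
  index 0 to \<open>k + 1\<close>.\<close>

definition M :: nat where "M = 2 * k + 8"

text \<open>The digits of \<open>z\<close> are consumed from the least significant one, so that a
  play can be prolonged by adding a multiple of a higher power of \<open>M\<close>.\<close>

primrec items :: "nat \<Rightarrow> nat \<Rightarrow> nat \<Rightarrow> nat list" where
  "items q z 0 = [2 * (if q \<le> n then q else 0) + 1]"
| "items q z (Suc i) = step q (items q z i) (z div M ^ i mod M)"

text \<open>A head at the non-vertex \<open>n\<close> occupies a place in the list but is no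
  listener; it is free of charge.\<close>

definition accepts_at :: "nat \<Rightarrow> nat \<Rightarrow> nat \<Rightarrow> bool" where
  "accepts_at q z i \<longleftrightarrow> find_key q (items q z i) = 0 \<and>
     length (items q z i) < k + 1 + (if slot0 (items q z i) = n then 1 else 0)"

lemma key_decode: "u < n \<Longrightarrow> v < n \<Longrightarrow> (key h u v - 1) mod (n * n) div n = u"
  "u < n \<Longrightarrow> v < n \<Longrightarrow> (key h u v - 1) mod n = v"
proof -
  assume uv: "u < n" "v < n"
  have "u * n + v < Suc u * n" using uv by simp
  also have "\<dots> \<le> n * n" using uv by (intro mult_le_mono) auto
  finally have "(key h u v - 1) mod (n * n) = u * n + v" unfolding key_def by (simp add: add.assoc)
  thus "(key h u v - 1) mod (n * n) div n = u" using uv by simp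
  have "key h u v - 1 = (h * n + u) * n + v" unfolding key_def by (simp add: algebra_simps)
  thus "(key h u v - 1) mod n = v" using uv by simp
qed

lemma finite_fast_keys: "finite (fast_keys xs m)"
proof -
  have "fast_keys xs m \<subseteq> (\<lambda>(u, v). key 0 u v) ` ({..<m} \<times> {..<m})" unfolding fast_keys_def by auto
  thus ?thesis using finite_subset by blast
qed

lemma finite_slow_keys: "finite (slow_keys xs m)"
proof -
  have "slow_keys xs m \<subseteq> (\<lambda>(u, v). key (2 * dt (slot0 xs) u - dt u v) u v) ` ({..<m} \<times> {..<n})"
    unfolding slow_keys_def by auto
  thus ?thesis using finite_subset by blast
qed

lemma find_in_keys:
  "find_key q xs \<noteq> 0 \<Longrightarrow> find_key q xs \<in> (if q \<le> n then fast_keys xs n else slow_keys xs n)"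
  using Max_in[of "insert 0 (if q \<le> n then fast_keys xs n else slow_keys xs n)"]
  unfolding find_key_def using finite_fast_keys finite_slow_keys by auto

lemma find_ge: "y \<in> (if q \<le> n then fast_keys xs n else slow_keys xs n) \<Longrightarrow> y \<le> find_key q xs"
  unfolding find_key_def using finite_fast_keys finite_slow_keys by (intro Max_ge) auto

lemma find_zero:
  assumes "find_key q xs = 0" "odd (hd xs)" "xs \<noteq> []" "x < n" "y < n" "x \<noteq> y"
  shows "\<not> opn xs x y"
proof
  assume o: "opn xs x y"
  have o': "opn xs x x" "opn xs y y" "opn xs y x" using o unfolding opn_def by metis+
  have r: "dt (slot0 xs) x = dt (slot0 xs) y" using o assms(2,3) unfolding opn_def slot0_def by (metis list.set_sel(1))
  have "\<exists>y. y \<in> (if q \<le> n then fast_keys xs n else slow_keys xs n)"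
  proof (cases "q \<le> n")
    case True
    have "key 0 a b \<in> fast_keys xs n" if "b < a" "a < n" "opn xs a a" "opn xs b b" "dt (slot0 xs) a = dt (slot0 xs) b" for a b
      using that unfolding fast_keys_def by blast
    thus ?thesis using True o' r assms by (metis nat_neq_iff)
  next
    case False
    thus ?thesis unfolding slow_keys_def using o assms by auto
  qed
  moreover have "0 \<notin> (if q \<le> n then fast_keys xs n else slow_keys xs n)"
    unfolding fast_keys_def slow_keys_def key_def by auto
  ultimately show False using find_ge assms(1) by (metis le_zero_eq)
qed

lemma find_vertices:
  assumes "find_key q xs \<noteq> 0"
  defines "u \<equiv> (find_key q xs - 1) mod (n * n) div n" and "v \<equiv> (find_key q xs - 1) mod n"
  shows "u < n" "v < n" "u \<noteq> v"
    and "q \<le> n \<Longrightarrow> opn xs u u \<and> opn xs v v \<and> dt (slot0 xs) u = dt (slot0 xs) v"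
    and "n < q \<Longrightarrow> opn xs u v"
    and "n < q \<Longrightarrow> x < n \<Longrightarrow> y < n \<Longrightarrow> x \<noteq> y \<Longrightarrow> opn xs x y \<Longrightarrow>
      2 * dt (slot0 xs) x - dt x y \<le> 2 * dt (slot0 xs) u - dt u v"
proof -
  obtain h a b where ab: "find_key q xs = key h a b" "a < n" "b < n" "a \<noteq> b"
    "q \<le> n \<Longrightarrow> opn xs a a \<and> opn xs b b \<and> dt (slot0 xs) a = dt (slot0 xs) b"
    "n < q \<Longrightarrow> opn xs a b \<and> h = 2 * dt (slot0 xs) a - dt a b"
    using find_in_keys[OF assms(1)] unfolding fast_keys_def slow_keys_def by (cases "q \<le> n") force+
  have uv: "u = a" "v = b" unfolding u_def v_def ab(1) using key_decode ab by auto
  show "u < n" "v < n" "u \<noteq> v" "q \<le> n \<Longrightarrow> opn xs u u \<and> opn xs v v \<and> dt (slot0 xs) u = dt (slot0 xs) v"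
    "n < q \<Longrightarrow> opn xs u v" using uv ab by auto
  show "2 * dt (slot0 xs) x - dt x y \<le> 2 * dt (slot0 xs) u - dt u v"
    if q: "n < q" and xy: "x < n" "y < n" "x \<noteq> y" "opn xs x y"
  proof (rule ccontr)
    assume "\<not> ?thesis"
    hence lt: "Suc h \<le> 2 * dt (slot0 xs) x - dt x y" using uv ab(6)[OF q] by simp
    have "a * n + b < Suc a * n" using ab by simp
    also have "\<dots> \<le> n * n" using ab by (intro mult_le_mono) auto
    finally have "key h a b < 1 + Suc h * (n * n)" unfolding key_def by simp
    also have "\<dots> \<le> key (2 * dt (slot0 xs) x - dt x y) x y"
      unfolding key_def using mult_le_mono1[OF lt, of "n * n"] by simp
    also have "\<dots> \<le> find_key q xs" by (rule find_ge) (use q xy in \<open>auto simp: slow_keys_def\<close>)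
    finally show False using ab by simp
  qed
qed

lemma pick_cases: "pick x j m = x \<or> pick x j m < m"
  by (induction m) auto

lemma pick_0: "pick x 0 m = x"
  by (induction m) auto

lemma pick_neighbour:
  assumes "dt x y = 1" "y < m"
  shows "pick x (card {z. z < y \<and> dt x z = 1} + 1) m = y"
  using assms(2)
proof (induction m)
  case (Suc m)
  show ?case
  proof (cases "y = m")
    case False
    hence ym: "y < m" using Suc by simp
    have "card {z. z < y \<and> dt x z = 1} < card {z. z < m \<and> dt x z = 1}"
      by (rule psubset_card_mono) (use ym assms(1) in auto)
    thus ?thesis using Suc ym by simp
  qed (use assms in simp)
qed simp

text \<open>If \<open>u\<close> is a watcher, index 0 finds it, however large its degree. Otherwise
  the degree is at most \<open>k + 1\<close>, and this also bounds the rank of \<open>w\<close>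
  among the neighbours.\<close>

lemma pick_watcher:
  assumes "sol W L" "card W + card L \<le> k" "w \<in> W" "u < n" "d w u \<le> 1"
  shows "\<exists>j\<le>k+1. pick u j n \<in> W \<and> d (pick u j n) u \<le> 1"
proof (cases "u \<in> W")
  case True
  thus ?thesis using pick_0[of u n] assms(4) by (intro exI[of _ 0]) auto
next
  case False
  hence w: "d u w = 1" "card {y \<in> {0..<n}. d u y = 1} \<le> k + 1"
    using ball_card_bound[OF assms(1,2,3)] assms(4,5) by auto
  have wn: "w < n" using assms(1,3) unfolding sol_def by auto
  have "card {z. z < w \<and> dt u z = 1} < card {y \<in> {0..<n}. d u y = 1}"
  proof (rule psubset_card_mono)
    have "{z. z < w \<and> dt u z = 1} \<subseteq> {y \<in> {0..<n}. d u y = 1}" using wn assms(4) by (auto simp: dt_def)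
    moreover have "w \<in> {y \<in> {0..<n}. d u y = 1}" using wn w(1) by simp
    ultimately show "{z. z < w \<and> dt u z = 1} \<subset> {y \<in> {0..<n}. d u y = 1}" by blast
  qed simp
  moreover have "pick u (card {z. z < w \<and> dt u z = 1} + 1) n = w"
    using pick_neighbour[of u w n] w(1) wn assms(4) by (simp add: dt_def)
  ultimately show ?thesis using assms(3,5) w(2) by (intro exI[of _ "card {z. z < w \<and> dt u z = 1} + 1"]) auto
qed

section \<open>Lists of codes as sets of watchers and listeners\<close>

lemma sol_subset:
  assumes "sol W L"
  shows "W \<subseteq> {0..<n}" "L \<subseteq> {0..<n}" "finite W" "finite L"
  using assms finite_subset[of W "{0..<n}"] finite_subset[of L "{0..<n}"] unfolding sol_def by auto

text \<open>A disjoint union, so that a vertex serving as both watcher and listener counts twice, as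
  it does in the size of a detection pair.\<close>

definition code :: "nat set \<Rightarrow> nat set \<Rightarrow> nat set" where
  "code W L = (\<lambda>w. 2 * w) ` W \<union> (\<lambda>l. 2 * l + 1) ` L"

lemma card_code: "finite W \<Longrightarrow> finite L \<Longrightarrow> card (code W L) = card W + card L"
  unfolding code_def
  by (subst card_Un_disjoint) (auto simp: card_image inj_on_def, presburger)

lemma code_iff: "2 * w \<in> code W L \<longleftrightarrow> w \<in> W" "2 * l + 1 \<in> code W L \<longleftrightarrow> l \<in> L"
  unfolding code_def by (auto, presburger+)

lemma code_mono: "W \<subseteq> W' \<Longrightarrow> L \<subseteq> L' \<Longrightarrow> code W L \<subseteq> code W' L'"
  unfolding code_def by blast

definition watchers :: "nat list \<Rightarrow> nat set" where "watchers xs = {w. 2 * w \<in> set xs}"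
definition listeners :: "nat list \<Rightarrow> nat set" where "listeners xs = {l. 2 * l + 1 \<in> set xs}"

lemma code_set: "code (watchers xs) (listeners xs) = set xs"
proof (intro set_eqI iffI)
  fix a assume "a \<in> set xs"
  thus "a \<in> code (watchers xs) (listeners xs)"
    unfolding code_def watchers_def listeners_def
    by (cases "even a") (auto elim!: evenE oddE)
qed (auto simp: code_def watchers_def listeners_def)

lemma opn_iff: "opn xs u v \<longleftrightarrow> (\<forall>w\<in>watchers xs. 2 \<le> dt w u \<and> 2 \<le> dt w v) \<and> (\<forall>l\<in>listeners xs. dt l u = dt l v)"
  (is "_ \<longleftrightarrow> ?R")
proof -
  have "opn xs u v \<longleftrightarrow> (\<forall>a \<in> code (watchers xs) (listeners xs). if even a then 2 \<le> dt (a div 2) u \<and> 2 \<le> dt (a div 2) v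
     else dt (a div 2) u = dt (a div 2) v)" unfolding opn_def code_set ..
  also have "\<dots> \<longleftrightarrow> ?R" unfolding code_def by (auto simp: ball_Un)
  finally show ?thesis .
qed

lemma opn_conflict:
  assumes "u < n" "v < n" "u \<noteq> v" "watchers xs \<subseteq> {0..<n}" "listeners xs \<subseteq> {0..<n}"
  shows "opn xs u v \<longleftrightarrow> conflict (watchers xs) (listeners xs) u v"
  unfolding opn_iff conflict_def dt_def using assms by (auto simp: subset_iff)

definition wf_items :: "nat list \<Rightarrow> bool" where
  "wf_items xs \<longleftrightarrow> xs \<noteq> [] \<and> odd (hd xs) \<and> slot0 xs \<le> n \<and> (\<forall>a\<in>set (tl xs). a div 2 < n)"

lemma wf_step: "wf_items xs \<Longrightarrow> wf_items (step q xs dg)"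
proof (cases "find_key q xs = 0")
  case False
  assume wf: "wf_items xs"
  then obtain a ys where xs: "xs = a # ys" by (cases xs) (auto simp: wf_items_def)
  note f = find_vertices(1,2)[OF False]
  have p: "pick x j n < n" if "x < n" for x j using pick_cases[of x j n] that by auto
  have app: "wf_items (xs @ [b])" if "b div 2 < n" for b
    using wf that xs unfolding wf_items_def slot0_def by auto
  have upd: "wf_items (xs[0 := 2 * x + 1])" if "x < n" for x
    using wf that xs unfolding wf_items_def slot0_def by auto
  define x where "x = (if dg mod 2 = 0 then (find_key q xs - 1) mod (n * n) div n else (find_key q xs - 1) mod n)"
  have "x < n" using f unfolding x_def by simp
  thus ?thesis using app upd p False unfolding step_def Let_def x_def[symmetric] by simp
qed (simp add: step_def)

lemma wf_items_items: "wf_items (items q z i)"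
proof (induction i)
  case 0
  show ?case by (simp add: wf_items_def slot0_def)
qed (simp add: wf_step)

text \<open>The history of the list is irrelevant: any list of vertices without an open pair is a
  solution. Only a head at \<open>n\<close> must be discarded. Its constant row separates nothing,
  and the place it frees matches the extra 1 in \<open>accepts_at\<close>.\<close>

lemma soundness:
  assumes "accepts_at q z i"
  shows "\<exists>W L. sol W L \<and> card W + card L \<le> k"
proof -
  define xs where "xs = items q z i"
  have wf: "wf_items xs" unfolding xs_def by (rule wf_items_items)
  have f: "find_key q xs = 0" and len: "length xs < k + 1 + (if slot0 xs = n then 1 else 0)"
    using assms unfolding accepts_at_def xs_def by auto
  obtain a ys where xs: "xs = a # ys" using wf by (cases xs) (auto simp: wf_items_def)
  define W where "W = watchers xs"
  define L where "L = listeners xs \<inter> {0..<n}"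
  have W: "W \<subseteq> {0..<n}" using wf xs unfolding W_def watchers_def wf_items_def by auto
  have L: "L \<subseteq> {0..<n}" unfolding L_def by auto
  have "sol W L"
    unfolding sol_conflict
  proof (intro conjI allI notI W L)
    fix x y assume c: "conflict W L x y"
    hence xy: "x < n" "y < n" "x \<noteq> y" unfolding conflict_def by auto
    have "dt l x = dt l y" if "l \<in> listeners xs" for l
    proof (cases "l < n")
      case True
      thus ?thesis using c that unfolding conflict_def L_def dt_def by auto
    qed (simp add: dt_def)
    moreover have "2 \<le> dt w x \<and> 2 \<le> dt w y" if "w \<in> watchers xs" for w
    proof -
      have "w < n" using W that unfolding W_def by auto
      thus ?thesis using c that unfolding conflict_def W_def dt_def by auto
    qed
    ultimately have "opn xs x y" unfolding opn_iff by blast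
    thus False using find_zero[OF f] wf xy unfolding wf_items_def by blast
  qed
  moreover have "card W + card L \<le> k"
  proof -
    have "code W L \<subseteq> set xs - (if slot0 xs = n then {2 * n + 1} else {})"
      using code_mono[of W "watchers xs" L "listeners xs"] unfolding code_set[symmetric]
      by (auto simp: W_def L_def code_def split: if_splits, presburger+)
    hence "card (code W L) \<le> card (set xs - (if slot0 xs = n then {2 * n + 1} else {}))"
      by (intro card_mono) auto
    also have "\<dots> \<le> length xs - (if slot0 xs = n then 1 else 0)"
    proof (cases "slot0 xs = n")
      case True
      have "a = 2 * n + 1" using True wf xs unfolding wf_items_def slot0_def by (auto elim!: oddE)
      hence "2 * n + 1 \<in> set xs" using xs by simp
      thus ?thesis using True card_length[of xs] by (simp add: card_Diff_singleton)
    qed (simp add: card_length)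
    finally have "card (code W L) \<le> length xs - (if slot0 xs = n then 1 else 0)" .
    moreover have "card (code W L) = card W + card L"
      using card_code[OF finite_subset[OF W] finite_subset[OF L]] by simp
    ultimately show ?thesis using len by (auto split: if_splits)
  qed
  ultimately show ?thesis by blast
qed

section \<open>Completeness: some sequence of digits follows a solution\<close>

lemma step_watcher:
  assumes sol: "sol W L" "card W + card L \<le> k" and f: "find_key q xs \<noteq> 0"
    and x: "x = (find_key q xs - 1) mod (n * n) div n \<or> x = (find_key q xs - 1) mod n"
    and o: "opn xs x x" and w: "w \<in> W" "d w x \<le> 1"
  shows "\<exists>dg<M. \<exists>w'\<in>W. step q xs dg = xs @ [2 * w'] \<and> 2 * w' \<notin> set xs"
proof -
  have xn: "x < n" using x find_vertices(1,2)[OF f] by auto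
  obtain j where j: "j \<le> k + 1" "pick x j n \<in> W" "d (pick x j n) x \<le> 1"
    using pick_watcher[OF sol w(1) xn w(2)] by blast
  define side :: nat where "side = (if x = (find_key q xs - 1) mod (n * n) div n then 0 else 1)"
  define dg where "dg = 2 * (j + (if q < n + 1 then 0 else 2)) + side"
  have s: "dg mod 2 = side" "dg div 2 = j + (if q < n + 1 then 0 else 2)" "dg < M"
    unfolding dg_def M_def side_def using j by auto
  have "step q xs dg = xs @ [2 * pick x j n]"
    unfolding step_def Let_def s using f x by (auto simp: side_def)
  \<comment> \<open>The vertex \<open>x\<close> is not dominated by the list, so a watcher within
    distance 1 of it cannot be listed yet. The list therefore grows by a new element.\<close>
  moreover have "2 * pick x j n \<notin> set xs"
  proof
    assume "2 * pick x j n \<in> set xs"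
    hence "2 \<le> dt (pick x j n) x" using o unfolding opn_def by fastforce
    moreover have "pick x j n < n" using j(2) sol unfolding sol_def by auto
    ultimately show False using j(3) xn unfolding dt_def by auto
  qed
  ultimately show ?thesis using j(2) s(3) by blast
qed

lemma step_listener:
  assumes f: "find_key q xs \<noteq> 0" and q: "n < q"
    and x: "x = (find_key q xs - 1) mod (n * n) div n \<or> x = (find_key q xs - 1) mod n"
  shows "\<exists>dg<M. step q xs dg = xs[0 := 2 * x + 1]" "\<exists>dg<M. step q xs dg = xs @ [2 * x + 1]"
proof -
  define side :: nat where "side = (if x = (find_key q xs - 1) mod (n * n) div n then 0 else 1)"
  have "side mod 2 = side" "side div 2 = 0" "(2 + side) mod 2 = side" "(2 + side) div 2 = 1"
    unfolding side_def M_def by auto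
  moreover have "step q xs side = xs[0 := 2 * x + 1]" "step q xs (2 + side) = xs @ [2 * x + 1]"
    unfolding step_def Let_def calculation using f x q by (auto simp: side_def)
  moreover have "side < M" "2 + side < M" unfolding side_def M_def by auto
  ultimately show "\<exists>dg<M. step q xs dg = xs[0 := 2 * x + 1]" "\<exists>dg<M. step q xs dg = xs @ [2 * x + 1]"
    by blast+
qed

text \<open>The first \<open>i\<close> rounds read only the \<open>i\<close> lowest digits.\<close>

lemma items_add: "j \<le> i \<Longrightarrow> items q (z + c * M ^ i) j = items q z j"
proof (induction j)
  case (Suc j)
  obtain m where i: "i = Suc (j + m)" using Suc.prems less_iff_Suc_add[of j i] by auto
  have eq: "z + c * M ^ i = z + M ^ j * (M * (c * M ^ m))" unfolding i by (simp add: power_add algebra_simps)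
  have "M ^ j \<noteq> 0" unfolding M_def by simp
  hence "(z + c * M ^ i) div M ^ j = z div M ^ j + M * (c * M ^ m)" unfolding eq by (subst div_mult_self2) auto
  thus ?case using Suc by simp
qed simp

text \<open>The digits of an accepting branch are found one at a time. As long as the branch does
  not accept, \<open>short\<close> shows that a conflict remains, and \<open>moves\<close> supplies
  a digit that preserves \<open>P\<close>. After \<open>k + 1\<close> rounds \<open>stop\<close>
  gives a contradiction.\<close>

lemma strategy:
  assumes init: "P 0 [2 * (if q \<le> n then q else 0) + 1]"
    and moves: "\<And>i xs. P i xs \<Longrightarrow> find_key q xs \<noteq> 0 \<Longrightarrow> \<exists>dg<M. P (Suc i) (step q xs dg)"
    and short: "\<And>i xs. P i xs \<Longrightarrow> length xs < k + 1 + (if slot0 xs = n then 1 else 0)"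
    and stop: "\<And>xs. \<not> P (k + 1) xs"
  shows "\<exists>z<M ^ (k + 1). \<exists>i<k + 1. accepts_at q z i"
proof (rule ccontr)
  assume no: "\<not> ?thesis"
  have "\<exists>z<M ^ i. P i (items q z i)" if "i \<le> k + 1" for i
    using that
  proof (induction i)
    case 0
    thus ?case using init by simp
  next
    case (Suc i)
    then obtain z where z: "z < M ^ i" "P i (items q z i)" by auto
    have "M ^ i \<le> M ^ (k + 1)" using Suc.prems by (intro power_increasing) (auto simp: M_def)
    hence "\<not> accepts_at q z i" using no z(1) Suc.prems by (metis Suc_le_eq less_le_trans)
    hence "find_key q (items q z i) \<noteq> 0" using short[OF z(2)] unfolding accepts_at_def by auto
    from moves[OF z(2) this] obtain dg where dg: "dg < M" "P (Suc i) (step q (items q z i) dg)" by blast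
    let ?z = "z + dg * M ^ i"
    have "?z div M ^ i mod M = dg" using z(1) dg(1) by simp
    hence "items q ?z (Suc i) = step q (items q z i) dg" using items_add[of i i q z dg] by simp
    moreover have "?z < Suc dg * M ^ i" using z(1) by simp
    hence "?z < M ^ Suc i" using mult_le_mono1[of "Suc dg" M "M ^ i"] dg(1) by simp
    ultimately show ?case using dg(2) by metis
  qed
  thus False using stop by blast
qed

lemma complete_le_1:
  assumes sol: "sol W L" "card W + card L \<le> k" and q: "q \<le> n" "L = (if q < n then {q} else {})"
  shows "\<exists>z<M ^ (k + 1). \<exists>i<k + 1. accepts_at q z i"
proof -
  \<comment> \<open>Here the solution stays fixed: the head is its only possible listener, and each
    round collects a further watcher of \<open>W\<close>.\<close>
  let ?P = "\<lambda>i xs. \<exists>ws. xs = (2 * q + 1) # ws \<and> distinct ws \<and> set ws \<subseteq> (\<lambda>w. 2 * w) ` W \<and> length ws = i"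
  have W: "W \<subseteq> {0..<n}" "finite W" using sol_subset[OF sol(1)] by auto
  have bound: "i \<le> card W" if P: "?P i xs" for i xs
  proof -
    obtain ws where "distinct ws" "set ws \<subseteq> (\<lambda>w. 2 * w) ` W" "length ws = i" using P by blast
    thus ?thesis using card_mono[of "(\<lambda>w. 2 * w) ` W" "set ws"] W(2) distinct_card[of ws]
      card_image_le[OF W(2), of "\<lambda>w. 2 * w"] by simp
  qed
  show ?thesis
  proof (rule strategy[of ?P])
    show "?P 0 [2 * (if q \<le> n then q else 0) + 1]" using q by simp
    show "\<exists>dg<M. ?P (Suc i) (step q xs dg)" if P: "?P i xs" and f: "find_key q xs \<noteq> 0" for i xs
    proof -
      obtain ws where ws: "xs = (2 * q + 1) # ws" "distinct ws" "set ws \<subseteq> (\<lambda>w. 2 * w) ` W" "length ws = i"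
        using P by blast
      define u v where "u = (find_key q xs - 1) mod (n * n) div n" and "v = (find_key q xs - 1) mod n"
      note F = find_vertices[OF f, folded u_def v_def]
      have r: "slot0 xs = q" unfolding slot0_def ws by simp
      have "\<forall>l\<in>L. d l u = d l v" using F(1-4) q unfolding r dt_def by auto
      then obtain w where w: "w \<in> W" "d w u \<le> 1 \<or> d w v \<le> 1"
        using sol(1) F(1-3) unfolding sol_def by (metis atLeastLessThan_iff zero_le)
      then obtain x where x: "x = u \<or> x = v" "d w x \<le> 1" by blast
      have "opn xs x x" using F(4)[OF q(1)] x by blast
      from step_watcher[OF sol f x(1)[unfolded u_def v_def] this w(1) x(2)]
      obtain dg w' where "dg < M" "w' \<in> W" "step q xs dg = xs @ [2 * w']" "2 * w' \<notin> set xs" by blast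
      thus ?thesis using ws by (intro exI[of _ dg]) auto
    qed
    show "length xs < k + 1 + (if slot0 xs = n then 1 else 0)" if P: "?P i xs" for i xs
      using bound[OF P] P sol(2) q by (auto simp: slot0_def split: if_splits)
    show "\<not> ?P (k + 1) xs" for xs using bound[where i = "k + 1"] sol(2) by force
  qed
qed

lemma gprod_slot0:
  assumes "r < n" "x < n" "y < n" "d r x = d r y"
  shows "gprod r x y = int (2 * dt r x - dt x y)"
proof -
  have "d x y \<le> d x r + d r y" using triangle[of x y r] assms by simp
  hence "d x y \<le> 2 * d r x" using sym[of x r] assms by simp
  thus ?thesis using assms unfolding gprod_def dt_def by simp
qed

lemma complete_ge_2:
  assumes sol: "sol W0 L0" "card W0 + card L0 \<le> k" "2 \<le> card L0"
  shows "\<exists>z<M ^ (k + 1). \<exists>i<k + 1. accepts_at (n + 1) z i"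
proof -
  let ?q = "n + 1"
  \<comment> \<open>In the phase \<open>?V\<close> the head 1 is the code of the provisional
    listener 0, and only watchers of the given solution have been collected. In the phase
    \<open>?R\<close> the whole list belongs to a solution; it is quantified because exchanges
    replace it.\<close>
  let ?V = "\<lambda>i xs. \<exists>ws. xs = 1 # ws \<and> distinct ws \<and> set ws \<subseteq> (\<lambda>w. 2 * w) ` W0 \<and> length ws = i"
  let ?R = "\<lambda>i xs. \<exists>W L. sol W L \<and> card W + card L \<le> k \<and> xs \<noteq> [] \<and> odd (hd xs) \<and> distinct xs \<and>
    set xs \<subseteq> code W L \<and> length xs = i"
  let ?P = "\<lambda>i xs. ?V i xs \<or> ?R i xs"
  have W0: "W0 \<subseteq> {0..<n}" "finite W0" using sol_subset[OF sol(1)] by auto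
  have boundV: "i \<le> card W0" if P: "?V i xs" for i xs
  proof -
    obtain ws where "distinct ws" "set ws \<subseteq> (\<lambda>w. 2 * w) ` W0" "length ws = i" using P by blast
    thus ?thesis using card_mono[of "(\<lambda>w. 2 * w) ` W0" "set ws"] W0(2) distinct_card[of ws]
      card_image_le[OF W0(2), of "\<lambda>w. 2 * w"] by simp
  qed
  have boundR: "i \<le> k" if P: "?R i xs" for i xs
  proof -
    obtain W L where R: "sol W L" "card W + card L \<le> k" "distinct xs" "set xs \<subseteq> code W L" "length xs = i"
      using P by blast
    have f: "finite W" "finite L" using sol_subset[OF R(1)] by auto
    have "finite (code W L)" unfolding code_def using f by simp
    thus ?thesis using card_mono[OF _ R(4)] distinct_card[OF R(3)] R card_code[OF f] by simp
  qed
  have short: "length xs \<le> k" if P: "?P i xs" for i xs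
    using P
  proof
    assume V: "?V i xs"
    hence "length xs = Suc i" by auto
    thus ?thesis using boundV[OF V] sol by simp
  next
    assume R: "?R i xs"
    thus ?thesis using boundR[OF R] by auto
  qed
  show ?thesis
  proof (rule strategy[of ?P])
    show "?P 0 [2 * (if ?q \<le> n then ?q else 0) + 1]" by simp
    show "length xs < k + 1 + (if slot0 xs = n then 1 else 0)" if P: "?P i xs" for i xs
      using short[OF P] by simp
    show "\<not> ?P (k + 1) xs" for xs
    proof
      assume P: "?P (k + 1) xs"
      thus False
      proof
        assume V: "?V (k + 1) xs"
        show False using boundV[OF V] sol by simp
      next
        assume R: "?R (k + 1) xs"
        show False using boundR[OF R] by simp
      qed
    qed
    show "\<exists>dg<M. ?P (Suc i) (step ?q xs dg)" if P: "?P i xs" and f: "find_key ?q xs \<noteq> 0" for i xs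
    proof -
      define u v where "u = (find_key ?q xs - 1) mod (n * n) div n" and "v = (find_key ?q xs - 1) mod n"
      have q: "n < ?q" by simp
      note F = find_vertices(1,2,3)[OF f, folded u_def v_def] find_vertices(5,6)[OF f q, folded u_def v_def]
      have oxx: "opn xs u u" "opn xs v v" using F(4) unfolding opn_def by metis+
      define r where "r = slot0 xs"
      \<comment> \<open>Both orientations are needed: the exchange lemmas move a listener to their
        first vertex, which may be either end of the conflict.\<close>
      have mx: "gprod r x y \<le> gprod r u v \<and> gprod r x y \<le> gprod r v u"
        if sub: "watchers xs \<subseteq> {0..<n}" "listeners xs \<subseteq> {0..<n}" "r \<in> listeners xs"
          and c: "conflict (watchers xs) (listeners xs) x y" for x y
      proof -
        have xy: "x < n" "y < n" "x \<noteq> y" using c unfolding conflict_def by auto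
        have o: "opn xs x y" using c opn_conflict[OF xy sub(1,2)] by simp
        have rn: "r < n" using sub by auto
        have "d r x = d r y" "d r u = d r v"
          using o F(4) sub(3) rn xy F(1,2) unfolding opn_iff dt_def by auto
        thus ?thesis using gprod_slot0[OF rn xy(1,2)] gprod_slot0[OF rn F(1,2)] F(5)[OF xy o] gprod_sym[of u v r] F(1,2)
          unfolding r_def by simp
      qed
      from P show ?thesis
      proof
        assume "?V i xs"
        then obtain ws where ws: "xs = 1 # ws" "distinct ws" "set ws \<subseteq> (\<lambda>w. 2 * w) ` W0" "length ws = i" by blast
        have r0: "r = 0" unfolding r_def slot0_def ws by simp
        have wa: "watchers xs \<subseteq> W0" using ws unfolding watchers_def by auto
        have "2 * l + 1 \<notin> set ws" for l
        proof
          assume "2 * l + 1 \<in> set ws"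
          then obtain w where "2 * l + 1 = 2 * w" using ws(3) by auto
          thus False by presburger
        qed
        hence li: "listeners xs = {r}" unfolding listeners_def ws(1) r0 by auto
        have sub: "watchers xs \<subseteq> {0..<n}" "listeners xs \<subseteq> {0..<n}" "r \<in> listeners xs"
          using wa W0 li r0 n_pos by auto
        have c: "conflict (watchers xs) {r} u v" using F(1-4) opn_conflict[OF F(1-3) sub(1,2)] li by simp
        show ?thesis
        proof (cases "\<exists>w\<in>W0. d w u \<le> 1 \<or> d w v \<le> 1")
          case True
          then obtain w x where w: "w \<in> W0" "x = u \<or> x = v" "d w x \<le> 1" by blast
          have "opn xs x x" using oxx w by blast
          from step_watcher[OF sol(1,2) f w(2)[unfolded u_def v_def] this w(1,3)]
          obtain dg w' where "dg < M" "w' \<in> W0" "step ?q xs dg = xs @ [2 * w']" "2 * w' \<notin> set xs" by blast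
          thus ?thesis using ws by (intro exI[of _ dg]) auto
        next
          case False
          then obtain l where l: "l \<in> L0" "d l u \<noteq> d l v"
            using sol(1) F(1-3) unfolding sol_def by (metis atLeastLessThan_iff zero_le)
          have ln: "l < n" using l sol(1) unfolding sol_def by auto
          have rV: "r \<in> {0..<n}" using sub by auto
          have "d r u = d r v" using c unfolding conflict_def by simp
          hence side: "gprod r u v < gprod r l u \<or> gprod r v u < gprod r l v"
            using separator_side[of r l u v] rV ln F(1,2) l(2) by simp
          have "\<exists>x L'. (x = u \<or> x = v) \<and> sol W0 L' \<and> x \<in> L' \<and> card L' \<le> card L0"
            using side
          proof
            assume "gprod r u v < gprod r l u"
            from exchange_virtual[OF sol(1,3) wa rV c _ l(1) this] mx[OF sub] li show ?thesis by metis
          next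
            assume "gprod r v u < gprod r l v"
            from exchange_virtual[OF sol(1,3) wa rV _ _ l(1) this] c[unfolded conflict_sym[of _ _ u]] mx[OF sub] li
            show ?thesis by metis
          qed
          then obtain x L' where x: "x = u \<or> x = v" "sol W0 L'" "x \<in> L'" "card L' \<le> card L0" by blast
          from step_listener(1)[OF f q x(1)[unfolded u_def v_def]]
          obtain dg where dg: "dg < M" "step ?q xs dg = (2 * x + 1) # ws" unfolding ws by auto
          \<comment> \<open>Replacing the head does not lengthen the list. It already has
            \<open>i + 1\<close> entries, but the head counts as progress only from now on.\<close>
          have "?R (Suc i) (step ?q xs dg)"
            unfolding dg(2)
          proof (rule exI[of _ W0], rule exI[of _ L'], intro conjI)
            show "card W0 + card L' \<le> k" using x sol(2) by simp
            have "2 * x + 1 \<notin> (\<lambda>w. 2 * w) ` W0" by (auto, presburger)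
            thus "distinct ((2 * x + 1) # ws)" using ws by auto
            show "set ((2 * x + 1) # ws) \<subseteq> code W0 L'" using ws x unfolding code_def by auto
          qed (use x ws in auto)
          thus ?thesis using dg(1) by blast
        qed
      next
        assume "?R i xs"
        then obtain W L where R: "sol W L" "card W + card L \<le> k" "xs \<noteq> []" "odd (hd xs)" "distinct xs"
          "set xs \<subseteq> code W L" "length xs = i" by blast
        have wa: "watchers xs \<subseteq> W" and li: "listeners xs \<subseteq> L"
          using R(6) code_iff unfolding watchers_def listeners_def by auto
        have "hd xs = 2 * r + 1" using R(4) unfolding r_def slot0_def by (auto elim!: oddE)
        hence rl: "r \<in> listeners xs" unfolding listeners_def using R(3) hd_in_set by (metis mem_Collect_eq)
        have sub: "watchers xs \<subseteq> {0..<n}" "listeners xs \<subseteq> {0..<n}" "r \<in> listeners xs"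
          using wa li R(1) rl unfolding sol_def by auto
        have c: "conflict (watchers xs) (listeners xs) u v" using F(1-4) opn_conflict[OF F(1-3) sub(1,2)] by simp
        show ?thesis
        proof (cases "\<exists>w\<in>W. d w u \<le> 1 \<or> d w v \<le> 1")
          case True
          then obtain w x where w: "w \<in> W" "x = u \<or> x = v" "d w x \<le> 1" by blast
          have "opn xs x x" using oxx w by blast
          from step_watcher[OF R(1,2) f w(2)[unfolded u_def v_def] this w(1,3)]
          obtain dg w' where dg: "dg < M" "w' \<in> W" "step ?q xs dg = xs @ [2 * w']" "2 * w' \<notin> set xs" by blast
          have "?R (Suc i) (step ?q xs dg)" unfolding dg(3)
            using R dg(2,4) code_iff(1)[of w' W L] by - (rule exI[of _ W], rule exI[of _ L], simp)
          thus ?thesis using dg(1) by blast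
        next
          case False
          then obtain l where l: "l \<in> L" "d l u \<noteq> d l v"
            using R(1) F(1-3) unfolding sol_def by (metis atLeastLessThan_iff zero_le)
          have ln: "l < n" using l R(1) unfolding sol_def by auto
          have rV: "r \<in> {0..<n}" using sub by auto
          have "d r u = d r v" using c rl unfolding conflict_def by simp
          hence side: "gprod r u v < gprod r l u \<or> gprod r v u < gprod r l v"
            using separator_side[of r l u v] rV ln F(1,2) l(2) by simp
          have "\<exists>x. (x = u \<or> x = v) \<and> sol W (insert x (L - {l})) \<and> listeners xs \<subseteq> insert x (L - {l})"
            using side
          proof
            assume "gprod r u v < gprod r l u"
            from exchange_real[OF R(1) wa li rl c _ l(1) this] mx[OF sub] show ?thesis by metis
          next
            assume "gprod r v u < gprod r l v"
            from exchange_real[OF R(1) wa li rl _ _ l(1) this] c[unfolded conflict_sym[of _ _ u]] mx[OF sub]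
            show ?thesis by metis
          qed
          then obtain x where x: "x = u \<or> x = v" "sol W (insert x (L - {l}))" "listeners xs \<subseteq> insert x (L - {l})" by blast
          from step_listener(2)[OF f q x(1)[unfolded u_def v_def]]
          obtain dg where dg: "dg < M" "step ?q xs dg = xs @ [2 * x + 1]" by auto
          have "finite L" using sol_subset[OF R(1)] by auto
          hence cl: "card (insert x (L - {l})) \<le> card L" using l(1)
            by (metis card_Suc_Diff1 card_insert_le_m1 zero_less_Suc diff_Suc_1 order_refl)
          have new: "2 * x + 1 \<notin> set xs"
          proof
            assume "2 * x + 1 \<in> set xs"
            hence "x \<in> listeners xs" unfolding listeners_def by simp
            hence "d x u = d x v" using c unfolding conflict_def by blast
            thus False using x(1) F(1-3) zero[of u v] zero[of v u] refl0[of u] refl0[of v] by auto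
          qed
          have "?R (Suc i) (step ?q xs dg)"
            unfolding dg(2)
          proof (rule exI[of _ W], rule exI[of _ "insert x (L - {l})"], intro conjI)
            show "card W + card (insert x (L - {l})) \<le> k" using cl R(2) by simp
            have "set xs \<subseteq> code W (insert x (L - {l}))" using code_mono[OF wa x(3)] unfolding code_set .
            moreover have "2 * x + 1 \<in> code W (insert x (L - {l}))" unfolding code_iff by simp
            ultimately show "set (xs @ [2 * x + 1]) \<subseteq> code W (insert x (L - {l}))" by simp
          qed (use x R new in auto)
          thus ?thesis using dg(1) by blast
        qed
      qed
    qed
  qed
qed

theorem accepts_iff:
  "(\<exists>q<n + 2. \<exists>z<M ^ (k + 1). \<exists>i<k + 1. accepts_at q z i) \<longleftrightarrow> (\<exists>W L. sol W L \<and> card W + card L \<le> k)"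
proof
  assume "\<exists>W L. sol W L \<and> card W + card L \<le> k"
  then obtain W L where sol: "sol W L" "card W + card L \<le> k" by blast
  have L: "L \<subseteq> {0..<n}" "finite L" using sol_subset[OF sol(1)] by auto
  consider "card L = 0" | "card L = 1" | "2 \<le> card L" by linarith
  thus "\<exists>q<n + 2. \<exists>z<M ^ (k + 1). \<exists>i<k + 1. accepts_at q z i"
  proof cases
    case 1
    thus ?thesis using complete_le_1[OF sol, of n] L by (intro exI[of _ n]) auto
  next
    case 2
    then obtain l where "L = {l}" by (meson card_1_singletonE)
    thus ?thesis using complete_le_1[OF sol, of l] L by (intro exI[of _ l]) auto
  next
    case 3
    thus ?thesis using complete_ge_2[OF sol] by (intro exI[of _ "n + 1"]) auto
  qed
qed (use soundness in blast)

end

section \<open>A program logic with time bounds\<close>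

abbreviation Var :: "string \<Rightarrow> expr" where "Var x \<equiv> Read x (Const 0)"
abbreviation Plus' (infixl "[+]" 65) where "d [+] e \<equiv> BinOp Plus d e"
abbreviation Minus' (infixl "[-]" 65) where "d [-] e \<equiv> BinOp Minus d e"
abbreviation Times' (infixl "[*]" 70) where "d [*] e \<equiv> BinOp Times d e"
abbreviation Div' (infixl "[div]" 70) where "d [div] e \<equiv> BinOp Div d e"
abbreviation Mod' (infixl "[mod]" 70) where "d [mod] e \<equiv> BinOp Mod d e"
abbreviation Less' (infix "[<]" 50) where "d [<] e \<equiv> BinOp Less d e"
abbreviation Equal' (infix "[=]" 50) where "d [=] e \<equiv> BinOp Equal d e"
abbreviation Set' ("_ ::= _" [61, 61] 60) where "x ::= e \<equiv> Assign x (Const 0) e"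
abbreviation Seq' (infixr ";;" 55) where "P ;; Q \<equiv> Seq P Q"

definition For :: "string \<Rightarrow> expr \<Rightarrow> prog \<Rightarrow> prog" where
  "For x e P = (x ::= Const 0 ;; While (Var x [<] e) (P ;; x ::= Var x [+] Const 1))"

fun consts_le :: "nat \<Rightarrow> expr \<Rightarrow> bool" where
  "consts_le b (Const m) \<longleftrightarrow> m \<le> b"
| "consts_le b (Read a i) \<longleftrightarrow> consts_le b i"
| "consts_le b (BinOp f d e) \<longleftrightarrow> consts_le b d \<and> consts_le b e"

fun reads :: "expr \<Rightarrow> string set" where
  "reads (Const m) = {}"
| "reads (Read a i) = insert a (reads i)"
| "reads (BinOp f d e) = reads d \<union> reads e"

fun mods :: "prog \<Rightarrow> string set" where
  "mods Skip = {}"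
| "mods (Assign a i e) = {a}"
| "mods (P ;; Q) = mods P \<union> mods Q"
| "mods (Cond b P Q) = mods P \<union> mods Q"
| "mods (While b P) = mods P"

lemma mods_For [simp]: "mods (For x e P) = insert x (mods P)"
  by (auto simp: For_def)

definition small :: "expr \<Rightarrow> bool" where
  "small e \<longleftrightarrow> consts_le 8 e \<and> expr_cost e \<le> 40"

definition mem_le :: "nat \<Rightarrow> state \<Rightarrow> bool" where
  "mem_le R s \<longleftrightarrow> (\<forall>a i. s a i \<le> R)"

definition frame :: "string set \<Rightarrow> state \<Rightarrow> state \<Rightarrow> bool" where
  "frame X s s' \<longleftrightarrow> (\<forall>a. a \<notin> X \<longrightarrow> s' a = s a)"

lemma frameD: "frame X s s' \<Longrightarrow> a \<notin> X \<Longrightarrow> s' a = s a"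
  by (simp add: frame_def)

lemma frame_mono: "frame X s s' \<Longrightarrow> X \<subseteq> Y \<Longrightarrow> frame Y s s'"
  unfolding frame_def by blast

lemma frame_trans: "frame X s s' \<Longrightarrow> frame X s' s'' \<Longrightarrow> frame X s s''"
  unfolding frame_def by simp

lemma frame_refl: "frame X s s"
  unfolding frame_def by simp

lemma exec_frame: "exec B P s t s' \<Longrightarrow> frame (mods P) s s'"
proof (induction rule: exec.induct)
  case (Seq P s t s' Q t' s'')
  thus ?case using frame_mono[of "mods P" s s' "mods P \<union> mods Q"] frame_mono[of "mods Q" s' s'' "mods P \<union> mods Q"]
    frame_trans by auto
qed (auto simp: frame_def)

lemma eval_frame: "frame X s s' \<Longrightarrow> reads e \<inter> X = {} \<Longrightarrow> eval_expr e s' = eval_expr e s"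
  by (induction e) (auto simp: frame_def Int_Un_distrib2)

lemma fits_mono: "fits B e s \<Longrightarrow> B \<le> B' \<Longrightarrow> fits B' e s"
  by (induction e) auto

lemma expr_cost_pos: "0 < expr_cost e"
  by (cases e) auto

text \<open>Both powers are at least 2, and for such numbers the sum is at most the product.\<close>

lemma pow_add_bound:
  fixes R :: nat assumes "2 \<le> R" "0 < p" "0 < q" shows "R ^ p + R ^ q \<le> R ^ (p + q)"
proof -
  obtain a b where ab: "R ^ p = Suc (Suc a)" "R ^ q = Suc (Suc b)"
  proof -
    have "2 \<le> R ^ p" "2 \<le> R ^ q" using self_le_power[of R p] self_le_power[of R q] assms by linarith+
    thus thesis using that by (metis add_2_eq_Suc le_Suc_ex)
  qed
  show ?thesis unfolding power_add ab by simp
qed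

text \<open>Multiplication is the worst operation, and it only adds exponents. The size of an
  expression therefore bounds the exponent of every intermediate value.\<close>

lemma fits_pow:
  assumes "mem_le R s" "2 \<le> R" "consts_le R e"
  shows "fits (R ^ expr_cost e) e s \<and> eval_expr e s \<le> R ^ expr_cost e"
  using assms(3)
proof (induction e)
  case (Const m)
  thus ?case by simp
next
  case (Read a i)
  hence IH: "fits (R ^ expr_cost i) i s" by simp
  have R: "s a (eval_expr i s) \<le> R" using assms(1) unfolding mem_le_def by blast
  have "R \<le> R ^ expr_cost (Read a i)" using assms(2) by simp
  moreover have "R ^ expr_cost i \<le> R ^ expr_cost (Read a i)" using assms(2) by simp
  ultimately show ?case using R fits_mono[OF IH] order_trans by (metis eval_expr.simps(2) fits.simps(2))
next
  case (BinOp f d e)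
  let ?c = "expr_cost (BinOp f d e)"
  have 1: "fits (R ^ expr_cost d) d s" "eval_expr d s \<le> R ^ expr_cost d"
      "fits (R ^ expr_cost e) e s" "eval_expr e s \<le> R ^ expr_cost e" using BinOp by auto
  have le: "R ^ expr_cost d \<le> R ^ ?c" "R ^ expr_cost e \<le> R ^ ?c" "R ^ (expr_cost d + expr_cost e) \<le> R ^ ?c"
    using assms(2) by (intro power_increasing; simp)+
  have one: "1 \<le> R ^ ?c" using assms(2) by simp
  have "apply_op f (eval_expr d s) (eval_expr e s) \<le> R ^ ?c"
  proof (cases f)
    case Plus
    have "eval_expr d s + eval_expr e s \<le> R ^ (expr_cost d + expr_cost e)"
      using 1 pow_add_bound[OF assms(2) expr_cost_pos expr_cost_pos, of d e] by linarith
    thus ?thesis using le(3) Plus by (metis apply_op.simps(1) order_trans)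
  next
    case Times
    have "eval_expr d s * eval_expr e s \<le> R ^ expr_cost d * R ^ expr_cost e" using 1 by (intro mult_mono) auto
    thus ?thesis using le(3) Times by (metis apply_op.simps(3) order_trans power_add)
  next
    case Minus
    thus ?thesis using 1 le by simp
  next
    case Div
    thus ?thesis using 1 le div_le_dividend order_trans by (metis apply_op.simps(4))
  next
    case Mod
    thus ?thesis using 1 le mod_less_eq_dividend order_trans by (metis apply_op.simps(5))
  qed (use one in auto)
  thus ?case using 1 le fits_mono by auto
qed

locale ram =
  fixes R :: nat
  assumes R8: "8 \<le> R"
begin

lemma consts_le_mono: "consts_le 8 e \<Longrightarrow> consts_le R e"
  using R8 by (induction e) auto

lemma small_fits: "small e \<Longrightarrow> mem_le R s \<Longrightarrow> fits (R ^ 40) e s"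
  using fits_pow[of R s e] consts_le_mono R8 fits_mono[of "R ^ expr_cost e" e s "R ^ 40"]
    power_increasing[of "expr_cost e" 40 R] unfolding small_def by simp

text \<open>\<open>ok\<close> is a total correctness judgement with a time bound. Keeping the whole memory below
  \<open>R\<close> keeps every word below \<open>R ^ 40\<close>, since no expression is larger than 40.\<close>

definition ok :: "prog \<Rightarrow> nat \<Rightarrow> state \<Rightarrow> (state \<Rightarrow> bool) \<Rightarrow> bool" where
  "ok P T s Q \<longleftrightarrow> (mem_le R s \<longrightarrow>
    (\<exists>t s'. exec (R ^ 40) P s t s' \<and> t \<le> T \<and> mem_le R s' \<and> Q s'))"

lemma ok_conseq:
  assumes "ok P T s Q" "T \<le> T'"
    "\<And>s'. mem_le R s' \<Longrightarrow> frame (mods P) s s' \<Longrightarrow> Q s' \<Longrightarrow> Q' s'"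
  shows "ok P T' s Q'"
  using assms exec_frame unfolding ok_def by (meson le_trans)

lemma ok_Seq:
  assumes "ok P T1 s Q1"
    and "\<And>s'. mem_le R s' \<Longrightarrow> frame (mods P) s s' \<Longrightarrow> Q1 s' \<Longrightarrow> ok Q T2 s' Q2"
    and "T1 + T2 \<le> T"
  shows "ok (P ;; Q) T s Q2"
  unfolding ok_def
proof
  assume "mem_le R s"
  then obtain t s' where 1: "exec (R ^ 40) P s t s'" "t \<le> T1" "mem_le R s'" "Q1 s'"
    using assms(1) unfolding ok_def by blast
  then obtain t' s'' where 2: "exec (R ^ 40) Q s' t' s''" "t' \<le> T2" "mem_le R s''" "Q2 s''"
    using assms(2)[of s'] exec_frame unfolding ok_def by blast
  thus "\<exists>t s'. exec (R ^ 40) (P ;; Q) s t s' \<and> t \<le> T \<and> mem_le R s' \<and> Q2 s'"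
    using exec.Seq[OF 1(1) 2(1)] 1 2 assms(3) by (meson add_mono le_trans)
qed

lemma ok_Cond:
  assumes "small b"
    and "eval_expr b s \<noteq> 0 \<Longrightarrow> ok P T1 s Q1"
    and "eval_expr b s = 0 \<Longrightarrow> ok Q T1 s Q1"
    and "1 + expr_cost b + T1 \<le> T"
  shows "ok (Cond b P Q) T s Q1"
  unfolding ok_def
proof
  assume m: "mem_le R s"
  show "\<exists>t s'. exec (R ^ 40) (Cond b P Q) s t s' \<and> t \<le> T \<and> mem_le R s' \<and> Q1 s'"
  proof (cases "eval_expr b s = 0")
    case True
    then obtain t s' where 1: "exec (R ^ 40) Q s t s'" "t \<le> T1" "mem_le R s'" "Q1 s'"
      using assms(3) m unfolding ok_def by blast
    show ?thesis using exec.CondFalse[OF small_fits[OF assms(1) m] True 1(1), of P] 1 assms(4)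
      by (meson add_mono le_trans order_refl)
  next
    case False
    then obtain t s' where 1: "exec (R ^ 40) P s t s'" "t \<le> T1" "mem_le R s'" "Q1 s'"
      using assms(2) m unfolding ok_def by blast
    show ?thesis using exec.CondTrue[OF small_fits[OF assms(1) m] False 1(1), of Q] 1 assms(4)
      by (meson add_mono le_trans order_refl)
  qed
qed

text \<open>Meant for loop-free code; loops go through \<open>ok_For\<close>. Only stored values
  have to stay below \<open>R\<close>, while intermediate ones are covered by
  \<open>small\<close>.\<close>

fun wp :: "prog \<Rightarrow> (state \<Rightarrow> bool) \<Rightarrow> state \<Rightarrow> bool" where
  "wp Skip Q s \<longleftrightarrow> Q s"
| "wp (Assign a i e) Q s \<longleftrightarrow> small i \<and> small e \<and> eval_expr e s \<le> R \<and>
    Q (s(a := (s a)(eval_expr i s := eval_expr e s)))"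
| "wp (P ;; P') Q s \<longleftrightarrow> wp P (wp P' Q) s"
| "wp (Cond b P P') Q s \<longleftrightarrow> small b \<and> (if eval_expr b s \<noteq> 0 then wp P Q s else wp P' Q s)"
| "wp (While b P) Q s \<longleftrightarrow> False"

fun time_bound :: "prog \<Rightarrow> nat" where
  "time_bound Skip = 1"
| "time_bound (Assign a i e) = 1 + expr_cost i + expr_cost e"
| "time_bound (P ;; Q) = time_bound P + time_bound Q"
| "time_bound (Cond b P Q) = 1 + expr_cost b + time_bound P + time_bound Q"
| "time_bound (While b P) = 0"

lemma ok_wp: "wp P Q s \<Longrightarrow> time_bound P \<le> T \<Longrightarrow> ok P T s Q"
proof (induction P arbitrary: Q s T)
  case Skip
  thus ?case unfolding ok_def using exec.Skip by fastforce
next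
  case (Assign a i e)
  let ?s = "s(a := (s a)(eval_expr i s := eval_expr e s))"
  have "mem_le R ?s" if "mem_le R s" using that Assign unfolding mem_le_def by simp
  thus ?case unfolding ok_def using exec.Assign[of "R ^ 40" i s e a] Assign small_fits
    by (metis time_bound.simps(2) wp.simps(2))
next
  case (Seq P1 P2)
  show ?case
    by (rule ok_Seq[OF Seq.IH(1) Seq.IH(2), of "wp P2 Q"]) (use Seq.prems in auto)
next
  case (Cond b P1 P2)
  show ?case
    by (rule ok_Cond[where ?T1.0 = "time_bound P1 + time_bound P2"])
      (use Cond in \<open>auto split: if_splits\<close>)
qed simp

text \<open>A pass costs \<open>Tb\<close> for the body, \<open>expr_cost e + 4\<close> for the
  guard and 6 for the increment; the initialisation costs 3, and the guard is evaluated once more at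
  the end. The increment comes after \<open>I (Suc j)\<close> has been established, hence the
  requirement \<open>insens\<close>.\<close>

lemma ok_For:
  assumes N: "eval_expr e s = N" "N \<le> R" "consts_le 8 e" "expr_cost e \<le> 30"
    and x: "x \<notin> mods P" "reads e \<inter> insert x (mods P) = {}"
    and I0: "I 0 s"
    and insens: "\<And>j s' v. I j s' \<Longrightarrow> I j (s'(x := v))"
    and step: "\<And>j s'. j < N \<Longrightarrow> mem_le R s' \<Longrightarrow> frame (insert x (mods P)) s s' \<Longrightarrow> s' x 0 = j \<Longrightarrow> I j s' \<Longrightarrow>
      ok P Tb s' (I (Suc j))"
    and T: "N * (Tb + expr_cost e + 10) + expr_cost e + 7 \<le> T"
  shows "ok (For x e P) T s (I N)"
proof -
  let ?B = "P ;; x ::= Var x [+] Const 1"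
  let ?W = "While (Var x [<] e) ?B"
  let ?f = "frame (insert x (mods P)) s"
  have sm: "small (Var x [<] e)" using N unfolding small_def by simp
  have loop: "ok ?W (m * (Tb + expr_cost e + 10) + expr_cost e + 4) s' (I N)"
    if "m \<le> N" "?f s'" "s' x 0 = N - m" "I (N - m) s'" for m s'
    using that
  proof (induction m arbitrary: s')
    case 0
    have "eval_expr e s' = N" using eval_frame[OF 0(2) x(2)] N by simp
    hence z: "eval_expr (Var x [<] e) s' = 0" using 0 by simp
    show ?case unfolding ok_def
      using exec.WhileFalse[OF small_fits[OF sm] z, of ?B] 0(4) by force
  next
    case (Suc m)
    let ?j = "N - Suc m"
    have "eval_expr e s' = N" using eval_frame[OF Suc(3) x(2)] N by simp
    hence nz: "eval_expr (Var x [<] e) s' \<noteq> 0" using Suc by simp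
    show ?case
      unfolding ok_def
    proof
      assume m: "mem_le R s'"
      have "ok P Tb s' (I (Suc ?j))" using step[OF _ m Suc(3) Suc(4) Suc(5)] Suc(2) by simp
      moreover have "ok (x ::= Var x [+] Const 1) 6 s2 (\<lambda>s3. s3 x 0 = Suc ?j \<and> I (Suc ?j) s3 \<and> ?f s3)"
        if "mem_le R s2" "frame (mods P) s' s2" "I (Suc ?j) s2" for s2
      proof -
        have 1: "s2 x 0 = ?j" using that(2) x(1) Suc(4) by (simp add: frameD)
        have 2: "?f s2" using frame_trans[OF Suc(3)] frame_mono[OF that(2)] by blast
        show ?thesis
          by (rule ok_wp) (use 1 2 that(3) insens Suc(2) N(2) in \<open>auto simp: small_def frame_def\<close>)
      qed
      ultimately have "ok ?B (Tb + 6) s' (\<lambda>s3. s3 x 0 = Suc ?j \<and> I (Suc ?j) s3 \<and> ?f s3)"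
        by (rule ok_Seq) simp_all
      then obtain t s3 where 1: "exec (R ^ 40) ?B s' t s3" "t \<le> Tb + 6" "mem_le R s3" "s3 x 0 = Suc ?j" "I (Suc ?j) s3" "?f s3"
        using m unfolding ok_def by blast
      have S: "Suc ?j = N - m" using Suc(2) by simp
      obtain t' s4 where 2: "exec (R ^ 40) ?W s3 t' s4" "t' \<le> m * (Tb + expr_cost e + 10) + expr_cost e + 4" "mem_le R s4" "I N s4"
        using Suc.IH[of s3] Suc(2) 1 unfolding S ok_def by fastforce
      show "\<exists>t s'a. exec (R ^ 40) ?W s' t s'a \<and> t \<le> Suc m * (Tb + expr_cost e + 10) + expr_cost e + 4 \<and> mem_le R s'a \<and> I N s'a"
        using exec.WhileTrue[OF small_fits[OF sm m] nz 1(1) 2(1)] 1(2) 2 by (intro exI conjI) auto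
    qed
  qed
  have "ok (x ::= Const 0) 3 s (\<lambda>s'. s' x 0 = 0 \<and> I 0 s' \<and> ?f s')"
    by (rule ok_wp) (use I0 insens in \<open>auto simp: small_def frame_def\<close>)
  thus ?thesis unfolding For_def
    by (rule ok_Seq[where ?T2.0 = "N * (Tb + expr_cost e + 10) + expr_cost e + 4"]) (use loop[of N] T in auto)
qed

end

section \<open>Computing the distance table\<close>

lemma index_eq_iff:
  fixes n :: nat
  assumes "b < n" "b' < n"
  shows "a * n + b = a' * n + b' \<longleftrightarrow> a = a' \<and> b = b'"
proof
  assume e: "a * n + b = a' * n + b'"
  have "a = (a * n + b) div n" "b = (a * n + b) mod n" "a' = (a' * n + b') div n" "b' = (a' * n + b') mod n"
    using assms by auto
  thus "a = a' \<and> b = b'" using e by metis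
qed simp

lemma index_less:
  fixes n :: nat
  assumes "a < n" "b < n"
  shows "a * n + b < n * n"
proof -
  have "a * n + b < Suc a * n" using assms by simp
  also have "\<dots> \<le> n * n" using assms by (intro mult_le_mono) auto
  finally show ?thesis .
qed

text \<open>An entry of \<open>par\<close> is a visited neighbour plus 1, or 0 if there is none. A
  linear scan per attached vertex replaces a queue and still fits into quadratic time. In the first
  round no vertex qualifies and vertex 0 starts the tree.\<close>

definition scan_prog :: prog where
  "scan_prog = (''c'' ::= Const 0 ;; For ''y'' (Var ''n'')
     (Cond ((Read ''vis'' (Var ''y'') [=] Const 0) [*] (Const 0 [<] Read ''par'' (Var ''y'')))
       (''c'' ::= Var ''y'') Skip))"

definition attach_prog :: prog where
  "attach_prog = (
     Cond (Read ''vis'' (Var ''x''))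
       (Assign ''D'' (Var ''c'' [*] Var ''n'' [+] Var ''x'') (Read ''D'' (Var ''p'' [*] Var ''n'' [+] Var ''x'') [+] Const 1) ;;
        Assign ''D'' (Var ''x'' [*] Var ''n'' [+] Var ''c'') (Read ''D'' (Var ''p'' [*] Var ''n'' [+] Var ''x'') [+] Const 1))
       Skip ;;
     Cond (Read ''adj'' (Var ''c'' [*] Var ''n'' [+] Var ''x'')) (Assign ''par'' (Var ''x'') (Var ''c'' [+] Const 1)) Skip)"

definition grow_prog :: prog where
  "grow_prog = For ''i'' (Var ''n'') (scan_prog ;;
     ''p'' ::= Read ''par'' (Var ''c'') [-] Const 1 ;;
     For ''x'' (Var ''n'') attach_prog ;;
     Assign ''vis'' (Var ''c'') (Const 1))"

locale grow_ram = tree_graph T + ram R for T :: "nat pair_pre_digraph" and R :: nat +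
  fixes n :: nat
  assumes verts: "pverts T = {0..<n}" and n_le: "n \<le> R"
begin

definition visited :: "state \<Rightarrow> nat set" where
  "visited s = {x. x < n \<and> s ''vis'' x \<noteq> 0}"

definition table :: "state \<Rightarrow> nat \<Rightarrow> nat \<Rightarrow> nat" where
  "table s x y = s ''D'' (x * n + y)"

text \<open>The zeros outside the visited part supply the diagonal entry of each new vertex; those
  from \<open>n * n\<close> on form row \<open>n\<close>, which the search reads for the missing
  listener.\<close>

definition grow_inv :: "nat \<Rightarrow> state \<Rightarrow> bool" where
  "grow_inv i s \<longleftrightarrow> s ''n'' 0 = n \<and> (\<forall>x<n. \<forall>y<n. s ''adj'' (x * n + y) \<noteq> 0 \<longleftrightarrow> edge T x y) \<and>
     card (visited s) = i \<and> (visited s \<noteq> {} \<longrightarrow> grown (edge T) (visited s) (table s)) \<and>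
     (\<forall>x<n. s ''par'' x \<noteq> 0 \<longrightarrow> s ''par'' x - 1 \<in> visited s \<and> edge T (s ''par'' x - 1) x) \<and>
     (\<forall>x<n. s ''par'' x = 0 \<longrightarrow> (\<forall>a\<in>visited s. \<not> edge T a x)) \<and>
     (\<forall>x<n. \<forall>y<n. \<not> (x \<in> visited s \<and> y \<in> visited s) \<longrightarrow> table s x y = 0) \<and>
     (\<forall>m\<ge>n * n. s ''D'' m = 0)"

lemma visited_finite: "finite (visited s)" "visited s \<subseteq> {0..<n}"
  unfolding visited_def by auto

lemma grow_invD:
  assumes "grow_inv i s"
  shows "s ''n'' 0 = n" "x < n \<Longrightarrow> y < n \<Longrightarrow> s ''adj'' (x * n + y) \<noteq> 0 \<longleftrightarrow> edge T x y"
    "card (visited s) = i" "visited s \<noteq> {} \<Longrightarrow> grown (edge T) (visited s) (table s)"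
    "x < n \<Longrightarrow> s ''par'' x \<noteq> 0 \<Longrightarrow> s ''par'' x - 1 \<in> visited s \<and> edge T (s ''par'' x - 1) x"
    "x < n \<Longrightarrow> s ''par'' x = 0 \<Longrightarrow> a \<in> visited s \<Longrightarrow> \<not> edge T a x"
    "x < n \<Longrightarrow> y < n \<Longrightarrow> \<not> (x \<in> visited s \<and> y \<in> visited s) \<Longrightarrow> table s x y = 0"
    "n * n \<le> m \<Longrightarrow> s ''D'' m = 0"
  using assms unfolding grow_inv_def by simp_all

lemma scan_ok:
  assumes inv: "grow_inv i s" and i: "i < n"
  shows "ok scan_prog (n * 45 + 20) s (\<lambda>s'. s' ''c'' 0 < n \<and> s' ''c'' 0 \<notin> visited s \<and>
    (visited s \<noteq> {} \<longrightarrow> s ''par'' (s' ''c'' 0) \<noteq> 0))"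
proof -
  have n: "s ''n'' 0 = n" using inv unfolding grow_inv_def by simp
  let ?I = "\<lambda>j s'. (s' ''c'' 0 < n \<and> s ''vis'' (s' ''c'' 0) = 0 \<and> s ''par'' (s' ''c'' 0) \<noteq> 0) \<or>
    (s' ''c'' 0 = 0 \<and> (\<forall>y<j. s ''vis'' y \<noteq> 0 \<or> s ''par'' y = 0))"
  have "ok scan_prog (n * 45 + 20) s (?I n)"
    unfolding scan_prog_def
  proof (rule ok_Seq[where ?T1.0 = 3 and ?T2.0 = "n * 42 + 9"])
    show "ok (''c'' ::= Const 0) 3 s (\<lambda>s'. s' ''c'' 0 = 0)"
      by (rule ok_wp) (simp_all add: small_def)
    fix s1 assume F: "frame (mods (''c'' ::= Const 0)) s s1" and c0: "s1 ''c'' 0 = 0"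
    note F = frameD[OF F, simplified]
    show "ok (For ''y'' (Var ''n'') (Cond ((Read ''vis'' (Var ''y'') [=] Const 0) [*] (Const 0 [<] Read ''par'' (Var ''y'')))
       (''c'' ::= Var ''y'') Skip)) (n * 42 + 9) s1 (?I n)"
    proof (rule ok_For[where Tb = 30 and N = n and I = ?I])
      fix j s2 assume j: "j < n" and G: "frame (insert ''y'' (mods (Cond ((Read ''vis'' (Var ''y'') [=] Const 0) [*] (Const 0 [<] Read ''par'' (Var ''y'')))
       (''c'' ::= Var ''y'') Skip))) s1 s2" and y: "s2 ''y'' 0 = j" and I: "?I j s2"
      note G = frameD[OF G, simplified]
      show "ok (Cond ((Read ''vis'' (Var ''y'') [=] Const 0) [*] (Const 0 [<] Read ''par'' (Var ''y'')))
         (''c'' ::= Var ''y'') Skip) 30 s2 (?I (Suc j))"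
        by (rule ok_wp) (use I j y F G n_le in \<open>auto simp: small_def less_Suc_eq\<close>)
    qed (use n n_le c0 F in auto)
  qed simp
  thus ?thesis
  proof (rule ok_conseq)
    fix s' assume I: "?I n s'"
    show "s' ''c'' 0 < n \<and> s' ''c'' 0 \<notin> visited s \<and> (visited s \<noteq> {} \<longrightarrow> s ''par'' (s' ''c'' 0) \<noteq> 0)"
    proof (cases "visited s = {}")
      case True
      hence "\<not> s ''par'' x \<noteq> 0" if "x < n" for x using inv that unfolding grow_inv_def by blast
      thus ?thesis using I True i by auto
    next
      case False
      \<comment> \<open>A vertex is still missing, so connectedness yields an edge leaving the
        visited set, and its far end is a candidate for the scan.\<close>
      have "visited s \<noteq> pverts T" using inv i unfolding grow_inv_def verts by auto
      then obtain a b where ab: "a \<in> visited s" "edge T a b" "b \<notin> visited s"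
        using edge_closed_eq_verts[of "visited s"] False visited_finite verts by blast
      hence bn: "b < n" using edge_in_verts verts by auto
      hence "s ''par'' b \<noteq> 0" "s ''vis'' b = 0" using inv ab unfolding grow_inv_def visited_def by auto
      thus ?thesis using I bn unfolding visited_def by auto
    qed
  qed simp
qed

lemma attach_ok:
  assumes inv: "grow_inv i s" and i: "i < n" and c: "s ''c'' 0 = c" "c < n" "c \<notin> visited s"
    and p: "s ''p'' 0 = p" "visited s \<noteq> {} \<Longrightarrow> p \<in> visited s"
  shows "ok (For ''x'' (Var ''n'') attach_prog) (n * 112 + 9) s (\<lambda>s'.
    (\<forall>a<n. \<forall>b<n. table s' a b = (if a = c \<and> b \<in> visited s then table s p b + 1
      else if b = c \<and> a \<in> visited s then table s p a + 1 else table s a b)) \<and>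
    (\<forall>m\<ge>n * n. s' ''D'' m = 0) \<and> (\<forall>x<n. s' ''par'' x = (if edge T c x then c + 1 else s ''par'' x)))"
proof -
  have n: "s ''n'' 0 = n" and adj: "\<And>x y. x < n \<Longrightarrow> y < n \<Longrightarrow> s ''adj'' (x * n + y) \<noteq> 0 \<longleftrightarrow> edge T x y"
    using inv unfolding grow_inv_def by auto
  let ?I = "\<lambda>j s'. (\<forall>a<n. \<forall>b<n. table s' a b = (if a = c \<and> b \<in> visited s \<and> b < j then table s p b + 1
      else if b = c \<and> a \<in> visited s \<and> a < j then table s p a + 1 else table s a b)) \<and>
    (\<forall>m\<ge>n * n. s' ''D'' m = 0) \<and> (\<forall>x<n. s' ''par'' x = (if x < j \<and> edge T c x then c + 1 else s ''par'' x))"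
  have "ok (For ''x'' (Var ''n'') attach_prog) (n * 112 + 9) s (?I n)"
  proof (rule ok_For[where Tb = 100 and N = n and I = ?I])
    fix j s2 assume j: "j < n" and G: "frame (insert ''x'' (mods attach_prog)) s s2" and x: "s2 ''x'' 0 = j" and I: "?I j s2"
    note G = frameD[OF G, unfolded attach_prog_def, simplified]
    have v: "s2 ''vis'' j \<noteq> 0 \<longleftrightarrow> j \<in> visited s" using j unfolding visited_def by (simp add: G)
    have jc: "j \<in> visited s \<Longrightarrow> j \<noteq> c" using c by auto
    have pn: "j \<in> visited s \<Longrightarrow> p \<in> visited s \<and> p < n \<and> p \<noteq> c" using p c visited_finite(2)[of s] by fastforce
    have e: "s2 ''adj'' (c * n + j) \<noteq> 0 \<longleftrightarrow> edge T c j" using adj[OF c(2) j] by (simp add: G)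
    \<comment> \<open>Only row and column \<open>c\<close> have been overwritten. As
      \<open>p\<close> and \<open>j\<close> are visited and \<open>c\<close> is not, the entry read
      is still the original one.\<close>
    have tp: "j \<in> visited s \<Longrightarrow> table s2 p j = table s p j" using I j pn jc by auto
    have small_t: "j \<in> visited s \<Longrightarrow> Suc (table s p j) \<le> R"
    proof -
      assume jv: "j \<in> visited s"
      hence "table s p j < card (visited s)"
        using grown_less_card[of "edge T" "visited s" "table s" p j] inv pn unfolding grow_inv_def by blast
      thus ?thesis using inv i n_le unfolding grow_inv_def by linarith
    qed
    let ?s1 = "s2(''D'' := (s2 ''D'')(c * n + j := Suc (table s p j), j * n + c := Suc (table s p j)))"
    define s3 where "s3 = (if j \<in> visited s then ?s1 else s2)"
    define s4 where "s4 = (if edge T c j then s3(''par'' := (s3 ''par'')(j := Suc c)) else s3)"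
    have D4: "s4 ''D'' m = (if j \<in> visited s \<and> (m = c * n + j \<or> m = j * n + c) then Suc (table s p j) else s2 ''D'' m)" for m
      by (simp add: s3_def s4_def)
    have P4: "s4 ''par'' m = (if m = j \<and> edge T c j then Suc c else s2 ''par'' m)" for m
      by (simp add: s3_def s4_def)
    have Q: "?I (Suc j) s4"
    proof (intro conjI allI impI)
      fix a b assume ab: "a < n" "b < n"
      have I': "table s2 a b = (if a = c \<and> b \<in> visited s \<and> b < j then table s p b + 1
        else if b = c \<and> a \<in> visited s \<and> a < j then table s p a + 1 else table s a b)" using I ab by blast
      have T3: "table s4 a b = (if j \<in> visited s \<and> (a = c \<and> b = j \<or> a = j \<and> b = c) then Suc (table s p j) else table s2 a b)"
      proof -
        have eq: "(a * n + b = c * n + j) = (a = c \<and> b = j)" "(a * n + b = j * n + c) = (a = j \<and> b = c)"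
          by (rule index_eq_iff[OF ab(2) j], rule index_eq_iff[OF ab(2) c(2)])
        show ?thesis using D4[of "a * n + b"] unfolding eq table_def[of s4 a b] table_def[of s2 a b] .
      qed
      show "table s4 a b = (if a = c \<and> b \<in> visited s \<and> b < Suc j then table s p b + 1
        else if b = c \<and> a \<in> visited s \<and> a < Suc j then table s p a + 1 else table s a b)"
      proof (cases "j \<in> visited s \<and> (a = c \<and> b = j \<or> a = j \<and> b = c)")
        case True
        thus ?thesis unfolding T3 using jc by (elim conjE disjE) simp_all
      next
        case False
        have "a = c \<and> b \<in> visited s \<and> b < Suc j \<longleftrightarrow> a = c \<and> b \<in> visited s \<and> b < j"
          "b = c \<and> a \<in> visited s \<and> a < Suc j \<longleftrightarrow> b = c \<and> a \<in> visited s \<and> a < j"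
          using False less_Suc_eq by blast+
        thus ?thesis unfolding T3 I' by (simp only: False if_False)
      qed
    next
      fix m assume "n * n \<le> m"
      moreover have "c * n + j < n * n" "j * n + c < n * n" using index_less c j by auto
      ultimately show "s4 ''D'' m = 0" unfolding D4 using I by auto
    next
      fix x assume "x < n"
      thus "s4 ''par'' x = (if x < Suc j \<and> edge T c x then c + 1 else s ''par'' x)" unfolding P4 using I by (auto simp: less_Suc_eq)
    qed
    have eqs: "s2 ''c'' 0 = c" "s2 ''p'' 0 = p" "s2 ''n'' 0 = n" using c p n by (simp_all add: G)
    have tp': "j \<in> visited s \<Longrightarrow> s2 ''D'' (p * n + j) = table s p j" using tp unfolding table_def by simp
    have ne: "j \<in> visited s \<Longrightarrow> p * n + j \<noteq> c * n + j" "j \<in> visited s \<Longrightarrow> p * n + j \<noteq> j * n + c"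
      using index_eq_iff[of j n j p c] index_eq_iff[of j n c p j] pn jc j c by auto
    show "ok attach_prog 100 s2 (?I (Suc j))"
      unfolding attach_prog_def
    proof (rule ok_Seq[where ?Q1.0 = "\<lambda>s'. s' = s3" and ?T1.0 = 70 and ?T2.0 = 30])
      show "ok (Cond (Read ''vis'' (Var ''x''))
       (Assign ''D'' (Var ''c'' [*] Var ''n'' [+] Var ''x'') (Read ''D'' (Var ''p'' [*] Var ''n'' [+] Var ''x'') [+] Const 1) ;;
        Assign ''D'' (Var ''x'' [*] Var ''n'' [+] Var ''c'') (Read ''D'' (Var ''p'' [*] Var ''n'' [+] Var ''x'') [+] Const 1))
       Skip) 70 s2 (\<lambda>s'. s' = s3)"
        by (rule ok_wp) (use v eqs x tp' ne small_t in \<open>auto simp: small_def s3_def\<close>)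
      fix s' assume "s' = s3"
      thus "ok (Cond (Read ''adj'' (Var ''c'' [*] Var ''n'' [+] Var ''x'')) (Assign ''par'' (Var ''x'') (Var ''c'' [+] Const 1)) Skip)
        30 s' (?I (Suc j))"
      proof -
        assume s': "s' = s3"
        have eqs': "s' ''c'' 0 = c" "s' ''n'' 0 = n" "s' ''x'' 0 = j" "s' ''adj'' (c * n + j) \<noteq> 0 \<longleftrightarrow> edge T c j"
          using eqs x e unfolding s' s3_def by simp_all
        have "Suc c \<le> R" using c n_le by simp
        hence "ok (Cond (Read ''adj'' (Var ''c'' [*] Var ''n'' [+] Var ''x'')) (Assign ''par'' (Var ''x'') (Var ''c'' [+] Const 1)) Skip)
          30 s' (\<lambda>s''. s'' = (if edge T c j then s'(''par'' := (s' ''par'')(j := Suc c)) else s'))"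
          using eqs' by (intro ok_wp) (cases "edge T c j", simp_all add: small_def)
        thus ?thesis by (rule ok_conseq) (use Q in \<open>simp_all only: s' order_refl s4_def\<close>)
      qed
    qed simp
  next
    show "?I 0 s" using inv unfolding grow_inv_def by auto
    show "?I j (s'(''x'' := v))" if "?I j s'" for j s' v using that unfolding table_def by simp
  qed (use n n_le in \<open>auto simp: attach_prog_def\<close>)
  thus ?thesis
    by (rule ok_conseq) (use visited_finite(2)[of s] in \<open>auto simp: subset_iff\<close>)
qed

lemma grow_step:
  assumes inv: "grow_inv i s" and i: "i < n"
  shows "ok (scan_prog ;; ''p'' ::= Read ''par'' (Var ''c'') [-] Const 1 ;;
     For ''x'' (Var ''n'') attach_prog ;; Assign ''vis'' (Var ''c'') (Const 1)) (n * 160 + 60) s (grow_inv (Suc i))"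
proof (rule ok_Seq[OF scan_ok[OF inv i], where ?T2.0 = "n * 112 + 39"])
  fix s1 assume F: "frame (mods scan_prog) s s1"
    and c: "s1 ''c'' 0 < n \<and> s1 ''c'' 0 \<notin> visited s \<and> (visited s \<noteq> {} \<longrightarrow> s ''par'' (s1 ''c'' 0) \<noteq> 0)"
    and m1: "mem_le R s1"
  note F = frameD[OF F, unfolded scan_prog_def, simplified]
  define c where "c = s1 ''c'' 0"
  \<comment> \<open>In the first round the truncated subtraction gives 0, whether or not this is a
    sensible parent: no vertex is visited, so no distance is read through \<open>p\<close>.\<close>
  define p where "p = s ''par'' c - 1"
  have vis1: "visited s1 = visited s" unfolding visited_def by (simp add: F)
  have tab1: "table s1 = table s" unfolding table_def by (simp add: F)
  have inv1: "grow_inv i s1" using inv unfolding grow_inv_def vis1 tab1 by (simp add: F)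
  have cn: "c < n" "c \<notin> visited s" using c unfolding c_def by auto
  have pc: "p \<in> visited s \<and> edge T p c" if "visited s \<noteq> {}"
    using c that inv unfolding grow_inv_def p_def c_def by blast
  show "ok (''p'' ::= Read ''par'' (Var ''c'') [-] Const 1 ;;
     For ''x'' (Var ''n'') attach_prog ;; Assign ''vis'' (Var ''c'') (Const 1)) (n * 112 + 39) s1 (grow_inv (Suc i))"
  proof (rule ok_Seq[where ?T1.0 = 12 and ?T2.0 = "n * 112 + 20"])
    have "p \<le> R" using m1 unfolding p_def mem_le_def F[of "''par''", simplified, symmetric] by (meson diff_le_self le_trans)
    thus "ok (''p'' ::= Read ''par'' (Var ''c'') [-] Const 1) 12 s1 (\<lambda>s'. s' ''p'' 0 = p)"
      by (intro ok_wp) (simp_all add: small_def p_def c_def F)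
    fix s2 assume G: "frame (mods (''p'' ::= Read ''par'' (Var ''c'') [-] Const 1)) s1 s2" and p2: "s2 ''p'' 0 = p"
    note G = frameD[OF G, simplified]
    have vis2: "visited s2 = visited s" unfolding visited_def by (simp add: F G)
    have tab2: "table s2 = table s" unfolding table_def by (simp add: F G)
    have inv2: "grow_inv i s2" using inv unfolding grow_inv_def vis2 tab2 by (simp add: F G)
    have c2: "s2 ''c'' 0 = c" unfolding c_def by (simp add: G)
    have par2: "s2 ''par'' = s ''par''" by (simp add: F G)
    note A = attach_ok[OF inv2 i c2 cn(1) cn(2)[folded vis2] p2, unfolded vis2 tab2 par2]
    show "ok (For ''x'' (Var ''n'') attach_prog ;; Assign ''vis'' (Var ''c'') (Const 1)) (n * 112 + 20) s2 (grow_inv (Suc i))"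
    proof (rule ok_Seq[OF A, where ?T2.0 = 5])
      fix s3 assume H: "frame (mods (For ''x'' (Var ''n'') attach_prog)) s2 s3"
        and Q: "(\<forall>a<n. \<forall>b<n. table s3 a b = (if a = c \<and> b \<in> visited s then table s p b + 1
            else if b = c \<and> a \<in> visited s then table s p a + 1 else table s a b)) \<and>
          (\<forall>m\<ge>n * n. s3 ''D'' m = 0) \<and> (\<forall>x<n. s3 ''par'' x = (if edge T c x then c + 1 else s ''par'' x))"
      note H = frameD[OF H, unfolded attach_prog_def, simplified]
      let ?s = "s3(''vis'' := (s3 ''vis'')(c := 1))"
      have vis: "visited ?s = insert c (visited s)" unfolding visited_def using cn by (auto simp: F G H)
      have tab: "table ?s = table s3" unfolding table_def by simp
      have "grow_inv (Suc i) ?s"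
        unfolding grow_inv_def vis tab
      proof (intro conjI)
        show "card (insert c (visited s)) = Suc i" using cn visited_finite inv unfolding grow_inv_def by simp
        have zero: "table s a b = 0" if "a < n" "b < n" "\<not> (a \<in> visited s \<and> b \<in> visited s)" for a b
          using grow_invD(7)[OF inv that] .
        have V: "x < n" if "x \<in> visited s" for x using that unfolding visited_def by simp
        have cc: "table s3 c c = 0" using Q cn zero[of c c] by auto
        show "insert c (visited s) \<noteq> {} \<longrightarrow> grown (edge T) (insert c (visited s)) (table s3)"
        proof (cases "visited s = {}")
          case True
          thus ?thesis using grown.single[of "table s3" c "edge T"] cc by simp
        next
          case False
          have "grown (edge T) (insert c (visited s)) (table s3)"
          proof (rule grown.leaf[where d = "table s" and p = p])
            show "grown (edge T) (visited s) (table s)" using grow_invD(4)[OF inv False] .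
            show "table s3 x z = table s x z" if "x \<in> visited s" "z \<in> visited s" for x z
              using Q V[OF that(1)] V[OF that(2)] that cn by auto
            show "table s3 x c = table s p x + 1 \<and> table s3 c x = table s p x + 1" if "x \<in> visited s" for x
              using Q V[OF that] that cn by auto
          qed (use pc[OF False] cn cc in auto)
          thus ?thesis by simp
        qed
        show "\<forall>x<n. ?s ''par'' x \<noteq> 0 \<longrightarrow> ?s ''par'' x - 1 \<in> insert c (visited s) \<and> edge T (?s ''par'' x - 1) x"
          using Q grow_invD(5)[OF inv] by auto
        show "\<forall>x<n. ?s ''par'' x = 0 \<longrightarrow> (\<forall>a\<in>insert c (visited s). \<not> edge T a x)"
          using Q grow_invD(6)[OF inv] by auto
        show "\<forall>x<n. \<forall>y<n. \<not> (x \<in> insert c (visited s) \<and> y \<in> insert c (visited s)) \<longrightarrow> table s3 x y = 0"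
          using Q zero by auto
        show "\<forall>m\<ge>n * n. ?s ''D'' m = 0" using Q by simp
        show "?s ''n'' 0 = n" "\<forall>x<n. \<forall>y<n. (?s ''adj'' (x * n + y) \<noteq> 0) = edge T x y"
          using grow_invD(1,2)[OF inv] by (simp_all add: F G H)
      qed
      thus "ok (Assign ''vis'' (Var ''c'') (Const 1)) 5 s3 (grow_inv (Suc i))"
        using R8 by (intro ok_wp) (simp_all add: small_def H c2)
    qed (use pc in simp_all)
  qed simp
qed simp

lemma grow_ok:
  assumes "grow_inv 0 s"
  shows "ok grow_prog (n * (n * 160 + 80) + 9) s (\<lambda>s'. grown (edge T) {0..<n} (table s') \<and> (\<forall>m\<ge>n * n. s' ''D'' m = 0))"
proof -
  have n: "s ''n'' 0 = n" using assms unfolding grow_inv_def by simp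
  have "n > 0" using edge_closed_eq_verts tree verts unfolding is_tree_def Digraph_Component.connected_def strongly_connected_def
    by (cases n) auto
  have "ok grow_prog (n * (n * 160 + 80) + 9) s (grow_inv n)"
    unfolding grow_prog_def
  proof (rule ok_For[where Tb = "n * 160 + 60" and N = n and I = grow_inv])
    fix j s' assume "j < n" "grow_inv j s'"
    thus "ok (scan_prog ;; ''p'' ::= Read ''par'' (Var ''c'') [-] Const 1 ;;
       For ''x'' (Var ''n'') attach_prog ;; Assign ''vis'' (Var ''c'') (Const 1)) (n * 160 + 60) s' (grow_inv (Suc j))"
      using grow_step by blast
  next
    fix j s' v assume I: "grow_inv j s'"
    have "visited (s'(''i'' := v)) = visited s'" "table (s'(''i'' := v)) = table s'"
      by (simp_all add: visited_def table_def fun_eq_iff)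
    thus "grow_inv j (s'(''i'' := v))" using I unfolding grow_inv_def by simp
  qed (use assms n n_le in \<open>simp_all add: scan_prog_def attach_prog_def\<close>)
  thus ?thesis
  proof (rule ok_conseq)
    fix s' assume I: "grow_inv n s'"
    have "visited s' = {0..<n}" using visited_finite(2) I card_subset_eq[of "{0..<n}" "visited s'"]
      unfolding grow_inv_def by simp
    thus "grown (edge T) {0..<n} (table s') \<and> (\<forall>m\<ge>n * n. s' ''D'' m = 0)"
      using I \<open>n > 0\<close> unfolding grow_inv_def by auto
  qed simp
qed

end

section \<open>The search program\<close>

definition open_body :: prog where
  "open_body = (''a'' ::= Read ''it'' (Var ''t'') ;;
     ''b'' ::= Var ''a'' [div] Const 2 [*] Var ''n'' ;;
     Cond (Var ''a'' [mod] Const 2)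
       (Cond (Read ''D'' (Var ''b'' [+] Var ''u'') [=] Read ''D'' (Var ''b'' [+] Var ''v'')) Skip (''o'' ::= Const 0))
       (Cond ((Read ''D'' (Var ''b'' [+] Var ''u'') [<] Const 2) [+] (Read ''D'' (Var ''b'' [+] Var ''v'') [<] Const 2))
         (''o'' ::= Const 0) Skip))"

definition open_prog :: prog where
  "open_prog = (''o'' ::= Const 1 ;; For ''t'' (Var ''c'') open_body)"

text \<open>The table \<open>who\<close> holds the last vertex seen at each distance from the listener. Each search uses a fresh window
  of it, starting at \<open>base\<close>, because clearing it would need another loop.\<close>

definition fast_upd :: prog where
  "fast_upd = Cond (Var ''o'')
     (''h'' ::= Var ''base'' [+] Read ''D'' (Read ''it'' (Const 0) [div] Const 2 [*] Var ''n'' [+] Var ''u'') ;;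
      Cond (Read ''who'' (Var ''h''))
        (''f'' ::= Var ''u'' [*] Var ''n'' [+] Read ''who'' (Var ''h'')) Skip ;;
      Assign ''who'' (Var ''h'') (Var ''u'' [+] Const 1))
     Skip"

definition fast_body :: prog where
  "fast_body = (''v'' ::= Var ''u'' ;; open_prog ;; fast_upd)"

definition slow_upd :: prog where
  "slow_upd = Cond (Var ''o'' [*] (Const 1 [-] (Var ''u'' [=] Var ''v'')))
     (''h'' ::= Const 1 [+] (Const 2 [*] Read ''D'' (Read ''it'' (Const 0) [div] Const 2 [*] Var ''n'' [+] Var ''u'')
          [-] Read ''D'' (Var ''u'' [*] Var ''n'' [+] Var ''v'')) [*] (Var ''n'' [*] Var ''n'')
          [+] Var ''u'' [*] Var ''n'' [+] Var ''v'' ;;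
      Cond (Var ''f'' [<] Var ''h'') (''f'' ::= Var ''h'') Skip)
     Skip"

definition slow_body :: prog where
  "slow_body = (open_prog ;; slow_upd)"

definition find_prog :: prog where
  "find_prog = (''f'' ::= Const 0 ;;
     Cond (Var ''q'' [<] Var ''n'' [+] Const 1)
       (For ''u'' (Var ''n'') fast_body)
       (For ''u'' (Var ''n'') (For ''v'' (Var ''n'') slow_body)))"

definition pick_body :: prog where
  "pick_body = Cond (Read ''D'' (Var ''x'' [*] Var ''n'' [+] Var ''y'') [=] Const 1)
     (Cond (Var ''j'' [=] Const 1) (''w'' ::= Var ''y'') Skip ;; ''j'' ::= Var ''j'' [-] Const 1) Skip"

definition pick_prog :: prog where
  "pick_prog = (''w'' ::= Var ''x'' ;; For ''y'' (Var ''n'') pick_body)"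

definition step_prog :: prog where
  "step_prog = (
     Cond (Var ''dg'' [mod] Const 2) (''x'' ::= (Var ''f'' [-] Const 1) [mod] Var ''n'')
       (''x'' ::= (Var ''f'' [-] Const 1) [mod] (Var ''n'' [*] Var ''n'') [div] Var ''n'') ;;
     ''e'' ::= Var ''dg'' [div] Const 2 [+] Const 2 [*] (Var ''q'' [<] Var ''n'' [+] Const 1) ;;
     Cond (Var ''e'' [=] Const 0) (Assign ''it'' (Const 0) (Const 2 [*] Var ''x'' [+] Const 1))
       (Cond (Var ''e'' [=] Const 1)
         (Assign ''it'' (Var ''c'') (Const 2 [*] Var ''x'' [+] Const 1) ;; ''c'' ::= Var ''c'' [+] Const 1)
         (''j'' ::= Var ''e'' [-] Const 2 ;; pick_prog ;;
          Assign ''it'' (Var ''c'') (Const 2 [*] Var ''w'') ;; ''c'' ::= Var ''c'' [+] Const 1)))"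

definition digit_prog :: prog where
  "digit_prog = (''base'' ::= Var ''base'' [+] Var ''n'' ;;
     ''dg'' ::= Var ''code'' [mod] (Const 2 [*] Var ''k'' [+] Const 8) ;;
     ''code'' ::= Var ''code'' [div] (Const 2 [*] Var ''k'' [+] Const 8))"

definition round_prog :: prog where
  "round_prog = (find_prog ;; digit_prog ;;
     Cond (Var ''f'') step_prog
       (Cond (Var ''c'' [<] Var ''k'' [+] Const 1 [+] (Read ''it'' (Const 0) [div] Const 2 [=] Var ''n''))
          (''out'' ::= Const 1) Skip))"

definition start_prog :: prog where
  "start_prog = (''code'' ::= Var ''z'' ;; ''c'' ::= Const 1 ;;
     Assign ''it'' (Const 0) (Const 2 [*] (Var ''q'' [*] (Var ''q'' [<] Var ''n'' [+] Const 1)) [+] Const 1))"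

definition branch_prog :: prog where
  "branch_prog = (start_prog ;; For ''i'' (Var ''k'' [+] Const 1) round_prog)"

definition power_prog :: prog where
  "power_prog = (''tot'' ::= Const 1 ;;
     For ''i'' (Var ''k'' [+] Const 1) (''tot'' ::= Var ''tot'' [*] (Const 2 [*] Var ''k'' [+] Const 8)))"

text \<open>The last mode is kept out of the loop over \<open>q\<close>: its quadratic rounds would
  spoil the uniform time bound for the \<open>n + 1\<close> linear ones.\<close>

definition search_prog :: prog where
  "search_prog = (power_prog ;;
     For ''q'' (Var ''n'' [+] Const 1) (For ''z'' (Var ''tot'') branch_prog) ;;
     ''q'' ::= Var ''n'' [+] Const 1 ;; For ''z'' (Var ''tot'') branch_prog)"

section \<open>Conflict search as incrementally computed maxima\<close>

context search
begin

text \<open>Models the buckets of \<open>who\<close>. Vertices are shifted by 1 so that untouched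
  memory reads as an empty bucket.\<close>

definition last_seen :: "nat list \<Rightarrow> nat \<Rightarrow> nat \<Rightarrow> nat" where
  "last_seen xs m e = Max (insert 0 {Suc u |u. u < m \<and> opn xs u u \<and> dt (slot0 xs) u = e})"

lemma last_seen_0 [simp]: "last_seen xs 0 e = 0"
  unfolding last_seen_def by simp

lemma last_seen_finite: "finite {Suc u |u. u < m \<and> opn xs u u \<and> dt (slot0 xs) u = e}"
  by simp

lemma last_seen_Suc:
  "last_seen xs (Suc m) e = (if opn xs m m \<and> dt (slot0 xs) m = e then Suc m else last_seen xs m e)"
proof (cases "opn xs m m \<and> dt (slot0 xs) m = e")
  case True
  have "{Suc u |u. u < Suc m \<and> opn xs u u \<and> dt (slot0 xs) u = e} =
      insert (Suc m) {Suc u |u. u < m \<and> opn xs u u \<and> dt (slot0 xs) u = e}"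
    using True by (auto simp: less_Suc_eq)
  hence "last_seen xs (Suc m) e = Max (insert (Suc m) (insert 0 {Suc u |u. u < m \<and> opn xs u u \<and> dt (slot0 xs) u = e}))"
    unfolding last_seen_def by (simp add: insert_commute)
  also have "\<dots> = Suc m" using last_seen_finite by (intro Max_eqI) auto
  finally show ?thesis using True by simp
next
  case False
  hence "{Suc u |u. u < Suc m \<and> opn xs u u \<and> dt (slot0 xs) u = e} = {Suc u |u. u < m \<and> opn xs u u \<and> dt (slot0 xs) u = e}"
    by (auto simp: less_Suc_eq)
  thus ?thesis by (simp only: last_seen_def if_not_P[OF False])
qed

lemma last_seen_cases:
  "last_seen xs m e = 0 \<and> (\<forall>v<m. \<not> (opn xs v v \<and> dt (slot0 xs) v = e)) \<or>
   (\<exists>v<m. last_seen xs m e = Suc v \<and> opn xs v v \<and> dt (slot0 xs) v = e \<and>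
     (\<forall>v'<m. opn xs v' v' \<longrightarrow> dt (slot0 xs) v' = e \<longrightarrow> v' \<le> v))"
proof (induction m)
  case (Suc m)
  show ?case
  proof (cases "opn xs m m \<and> dt (slot0 xs) m = e")
    case True
    thus ?thesis unfolding last_seen_Suc by (intro disjI2 exI[of _ m]) auto
  next
    case False
    have eq: "last_seen xs (Suc m) e = last_seen xs m e" by (simp only: last_seen_Suc if_not_P[OF False])
    have old: "v < m" if "v < Suc m" "opn xs v v" "dt (slot0 xs) v = e" for v
      using that False less_Suc_eq by metis
    from Suc show ?thesis
    proof
      assume "last_seen xs m e = 0 \<and> (\<forall>v<m. \<not> (opn xs v v \<and> dt (slot0 xs) v = e))"
      thus ?thesis using old unfolding eq by blast
    next
      assume "\<exists>v<m. last_seen xs m e = Suc v \<and> opn xs v v \<and> dt (slot0 xs) v = e \<and>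
        (\<forall>v'<m. opn xs v' v' \<longrightarrow> dt (slot0 xs) v' = e \<longrightarrow> v' \<le> v)"
      then obtain v where "v < m" "last_seen xs m e = Suc v" "opn xs v v" "dt (slot0 xs) v = e"
        "\<forall>v'<m. opn xs v' v' \<longrightarrow> dt (slot0 xs) v' = e \<longrightarrow> v' \<le> v" by blast
      thus ?thesis using old unfolding eq by (intro disjI2 exI[of _ v]) auto
    qed
  qed
qed simp

definition fast_max :: "nat list \<Rightarrow> nat \<Rightarrow> nat" where
  "fast_max xs m = Max (insert 0 (fast_keys xs m))"

lemma fast_max_0 [simp]: "fast_max xs 0 = 0"
  unfolding fast_max_def fast_keys_def by simp

text \<open>A key with first vertex \<open>m\<close> exceeds all earlier ones, so the program may
  overwrite without comparing, and the last vertex in the bucket is the best partner. The shift by 1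
  in the bucket is the leading 1 of \<open>key\<close>.\<close>

lemma fast_max_Suc:
  assumes "m < n"
  shows "fast_max xs (Suc m) = (if opn xs m m \<and> last_seen xs m (dt (slot0 xs) m) \<noteq> 0
    then m * n + last_seen xs m (dt (slot0 xs) m) else fast_max xs m)"
proof (cases "opn xs m m \<and> last_seen xs m (dt (slot0 xs) m) \<noteq> 0")
  case False
  have "fast_keys xs (Suc m) = fast_keys xs m"
    using False last_seen_cases[of xs m "dt (slot0 xs) m"] unfolding fast_keys_def less_Suc_eq by fastforce
  thus ?thesis by (simp only: fast_max_def if_not_P[OF False])
next
  case True
  then obtain v where v: "v < m" "last_seen xs m (dt (slot0 xs) m) = Suc v" "opn xs v v" "dt (slot0 xs) v = dt (slot0 xs) m"
    "\<And>v'. v' < m \<Longrightarrow> opn xs v' v' \<Longrightarrow> dt (slot0 xs) v' = dt (slot0 xs) m \<Longrightarrow> v' \<le> v"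
    using last_seen_cases[of xs m "dt (slot0 xs) m"] by auto
  have "fast_max xs (Suc m) = key 0 m v"
    unfolding fast_max_def
  proof (rule Max_eqI)
    show "finite (insert 0 (fast_keys xs (Suc m)))" using finite_fast_keys by simp
    show "key 0 m v \<in> insert 0 (fast_keys xs (Suc m))" unfolding fast_keys_def
      by (rule insertI2, rule CollectI, rule exI[of _ m], rule exI[of _ v]) (use v True in simp)
    fix y assume "y \<in> insert 0 (fast_keys xs (Suc m))"
    then consider "y = 0" | a b where "y = key 0 a b" "b < a" "a < m" | b where "y = key 0 m b" "b < m" "opn xs b b" "dt (slot0 xs) m = dt (slot0 xs) b"
      unfolding fast_keys_def less_Suc_eq by blast
    thus "y \<le> key 0 m v"
    proof cases
      case 2
      have "a * n + b < Suc a * n" using 2 assms by simp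
      also have "\<dots> \<le> m * n" using 2 by (intro mult_le_mono) auto
      finally show ?thesis using 2 unfolding key_def by simp
    next
      case 3
      thus ?thesis using v(5)[of b] unfolding key_def by simp
    qed simp
  qed
  thus ?thesis using True v unfolding key_def by simp
qed

definition slow_row :: "nat list \<Rightarrow> nat \<Rightarrow> nat \<Rightarrow> nat set" where
  "slow_row xs m j = {key (2 * dt (slot0 xs) m - dt m v) m v |v. v < j \<and> m \<noteq> v \<and> opn xs m v}"

definition slow_max :: "nat list \<Rightarrow> nat \<Rightarrow> nat \<Rightarrow> nat" where
  "slow_max xs m j = Max (insert 0 (slow_keys xs m \<union> slow_row xs m j))"

lemma slow_max_0 [simp]: "slow_max xs 0 0 = 0"
  unfolding slow_max_def slow_keys_def slow_row_def by simp

lemma slow_max_row: "slow_max xs m n = slow_max xs (Suc m) 0"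
proof -
  have "slow_keys xs m \<union> slow_row xs m n = slow_keys xs (Suc m) \<union> slow_row xs (Suc m) 0"
    unfolding slow_keys_def slow_row_def less_Suc_eq by auto
  thus ?thesis unfolding slow_max_def by simp
qed

lemma slow_max_Suc:
  "slow_max xs m (Suc j) = (if m \<noteq> j \<and> opn xs m j then max (key (2 * dt (slot0 xs) m - dt m j) m j) (slow_max xs m j)
     else slow_max xs m j)"
proof (cases "m \<noteq> j \<and> opn xs m j")
  case True
  have f: "finite (slow_keys xs m \<union> slow_row xs m j)"
    using finite_slow_keys unfolding slow_row_def by simp
  have "slow_row xs m (Suc j) = insert (key (2 * dt (slot0 xs) m - dt m j) m j) (slow_row xs m j)"
    unfolding slow_row_def using True by (auto simp: less_Suc_eq)
  hence "slow_max xs m (Suc j) = Max (insert (key (2 * dt (slot0 xs) m - dt m j) m j) (insert 0 (slow_keys xs m \<union> slow_row xs m j)))"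
    unfolding slow_max_def by (simp add: insert_commute)
  thus ?thesis using f by (simp only: slow_max_def if_P[OF True]) (simp add: Max_insert)
next
  case False
  hence "slow_row xs m (Suc j) = slow_row xs m j" unfolding slow_row_def less_Suc_eq by auto
  thus ?thesis by (simp only: slow_max_def if_not_P[OF False])
qed

lemma find_key_eq: "find_key q xs = (if q \<le> n then fast_max xs n else slow_max xs n 0)"
  unfolding find_key_def fast_max_def slow_max_def slow_row_def by simp

lemma length_items: "length (items q z i) \<le> Suc i"
  by (induction i) (auto simp: step_def Let_def)

end

lemma mods_open_prog [simp]: "mods open_prog = {''o'', ''t'', ''a'', ''b''}"
  by (auto simp: open_prog_def open_body_def)

lemma mods_fast_body [simp]: "mods fast_body = {''v'', ''o'', ''t'', ''a'', ''b'', ''h'', ''f'', ''who''}"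
  by (auto simp: fast_body_def fast_upd_def)

lemma mods_slow_body [simp]: "mods slow_body = {''o'', ''t'', ''a'', ''b'', ''h'', ''f''}"
  by (auto simp: slow_body_def slow_upd_def)

lemma mods_find_prog [simp]: "mods find_prog = {''f'', ''u'', ''v'', ''o'', ''t'', ''a'', ''b'', ''h'', ''who''}"
  by (auto simp: find_prog_def)

lemma mods_pick_body [simp]: "mods pick_body = {''w'', ''j''}"
  by (auto simp: pick_body_def)

lemma mods_pick_prog [simp]: "mods pick_prog = {''w'', ''y'', ''j''}"
  by (auto simp: pick_prog_def)

lemma mods_step_prog [simp]: "mods step_prog = {''x'', ''e'', ''it'', ''c'', ''j'', ''w'', ''y''}"
  by (auto simp: step_prog_def)

lemma mods_round_prog [simp]: "mods round_prog =
    {''f'', ''u'', ''v'', ''o'', ''t'', ''a'', ''b'', ''h'', ''who'', ''base'', ''dg'', ''code'', ''x'', ''e'', ''it'', ''c'', ''j'', ''w'', ''y'', ''out''}"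
  by (auto simp: round_prog_def digit_prog_def)

lemma mods_branch_prog [simp]: "mods branch_prog = insert ''i'' (mods round_prog)"
  by (auto simp: branch_prog_def start_prog_def)

text \<open>\<open>R_branches\<close> bounds \<open>base\<close>, which advances by \<open>n\<close>
  in each of the \<open>k + 1\<close> rounds of every branch in all \<open>n + 2\<close> modes.
  \<open>R_cube\<close> bounds the keys: heights below \<open>2 * n\<close> are multiplied by
  \<open>n * n\<close>.\<close>

locale search_ram = search n d k + ram R for n :: nat and d and k R :: nat +
  assumes R_branches: "(n + 2) * M ^ (k + 1) * ((k + 1) * n) \<le> R" and R_cube: "8 * (n * n * n) \<le> R"
    and d_less: "x < n \<Longrightarrow> y < n \<Longrightarrow> d x y < n"
begin

lemma dt_less: "dt x y < n"
  using d_less n_pos unfolding dt_def by simp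

lemma R_bounds: "n \<le> R" "n * n + n \<le> R" "1 + 2 * n * (n * n) + n * n + n \<le> R" "2 * n + 1 \<le> R" "n + 2 \<le> R"
    "M ^ (k + 1) \<le> R" "M \<le> R" "k + 2 \<le> R"
proof -
  have n1: "1 \<le> n" using n_pos by simp
  have nn: "n \<le> n * n" using n1 by simp
  have nnn: "n * n \<le> n * n * n" using n1 by simp
  show "n \<le> R" "n * n + n \<le> R" "2 * n + 1 \<le> R" "n + 2 \<le> R" using n1 nn nnn R_cube by linarith+
  have "2 * n * (n * n) = 2 * (n * n * n)" by simp
  thus "1 + 2 * n * (n * n) + n * n + n \<le> R" using n1 nn nnn R_cube by linarith
  have "M ^ (k + 1) * 1 \<le> M ^ (k + 1) * ((n + 2) * ((k + 1) * n))" using n1 by (intro mult_le_mono2) simp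
  also have "\<dots> = (n + 2) * M ^ (k + 1) * ((k + 1) * n)" by (simp only: mult.assoc mult.commute mult.left_commute)
  finally show 1: "M ^ (k + 1) \<le> R" using R_branches by linarith
  have "M ^ 1 \<le> M ^ (k + 1)" by (intro power_increasing) (auto simp: M_def)
  thus "M \<le> R" using 1 by (metis le_trans power_one_right)
  thus "k + 2 \<le> R" unfolding M_def by simp
qed

section \<open>Correctness and cost of a single round\<close>

definition env :: "state \<Rightarrow> bool" where
  "env s \<longleftrightarrow> s ''n'' 0 = n \<and> s ''k'' 0 = k \<and> (\<forall>x\<le>n. \<forall>y<n. s ''D'' (x * n + y) = dt x y)"

definition rep :: "state \<Rightarrow> nat list \<Rightarrow> bool" where
  "rep s xs \<longleftrightarrow> s ''c'' 0 = length xs \<and> (\<forall>t<length xs. s ''it'' t = xs ! t)"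

text \<open>The length allows for the head and one entry from each of \<open>k + 1\<close>
  rounds.\<close>

definition good :: "nat list \<Rightarrow> bool" where
  "good xs \<longleftrightarrow> xs \<noteq> [] \<and> length xs \<le> k + 2 \<and> (\<forall>a\<in>set xs. a div 2 \<le> n)"

lemma envD: "env s \<Longrightarrow> s ''n'' 0 = n" "env s \<Longrightarrow> s ''k'' 0 = k"
  "env s \<Longrightarrow> x \<le> n \<Longrightarrow> y < n \<Longrightarrow> s ''D'' (x * n + y) = dt x y"
  unfolding env_def by auto

lemma env_frame: "env s \<Longrightarrow> frame X s s' \<Longrightarrow> ''n'' \<notin> X \<Longrightarrow> ''k'' \<notin> X \<Longrightarrow> ''D'' \<notin> X \<Longrightarrow> env s'"
  unfolding env_def frame_def by simp

lemma rep_frame: "rep s xs \<Longrightarrow> frame X s s' \<Longrightarrow> ''c'' \<notin> X \<Longrightarrow> ''it'' \<notin> X \<Longrightarrow> rep s' xs"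
  unfolding rep_def frame_def by simp

lemma rep_slot0: "rep s xs \<Longrightarrow> good xs \<Longrightarrow> s ''it'' 0 div 2 = slot0 xs"
  unfolding rep_def good_def slot0_def by (cases xs) auto

lemma slot0_le: "good xs \<Longrightarrow> slot0 xs \<le> n"
  unfolding good_def slot0_def by (cases xs) auto

lemma opn_Suc:
  "j < length xs \<Longrightarrow> opn (take (Suc j) xs) u v \<longleftrightarrow> opn (take j xs) u v \<and>
    (if even (xs ! j) then 2 \<le> dt (xs ! j div 2) u \<and> 2 \<le> dt (xs ! j div 2) v
     else dt (xs ! j div 2) u = dt (xs ! j div 2) v)"
  unfolding opn_def by (auto simp: take_Suc_conv_app_nth)

lemma open_ok:
  assumes e: "env s" "rep s xs" "good xs" and u: "s ''u'' 0 = u" "u < n" and v: "s ''v'' 0 = v" "v < n"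
  shows "ok open_prog ((k + 2) * 100 + 20) s (\<lambda>s'. s' ''o'' 0 = (if opn xs u v then 1 else 0))"
proof -
  let ?I = "\<lambda>j s'. s' ''o'' 0 = (if opn (take j xs) u v then 1 else 0)"
  have "ok open_prog ((k + 2) * 100 + 20) s (?I (length xs))"
    unfolding open_prog_def
  proof (rule ok_Seq[where ?T1.0 = 3 and ?T2.0 = "(k + 2) * 100 + 17"])
    show "ok (''o'' ::= Const 1) 3 s (?I 0)"
      using R8 by (intro ok_wp) (simp_all add: small_def opn_def)
    fix s1 assume F: "frame (mods (''o'' ::= Const 1)) s s1" and o1: "?I 0 s1"
    note F' = frameD[OF F, simplified]
    have env1: "env s1" "rep s1 xs" by (rule env_frame[OF e(1) F] rep_frame[OF e(2) F]; simp)+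
    show "ok (For ''t'' (Var ''c'') open_body) ((k + 2) * 100 + 17) s1 (?I (length xs))"
    proof (rule ok_For[where Tb = 80 and N = "length xs" and I = ?I])
      fix j s2 assume j: "j < length xs" and m: "mem_le R s2" and G: "frame (insert ''t'' (mods open_body)) s1 s2"
        and t: "s2 ''t'' 0 = j" and I: "?I j s2"
      have mo: "insert ''t'' (mods open_body) = {''o'', ''t'', ''a'', ''b''}" by (auto simp: open_body_def)
      note G = G[unfolded mo]
      note G' = frameD[OF G, simplified]
      have env2: "env s2" "rep s2 xs" by (rule env_frame[OF env1(1) G] rep_frame[OF env1(2) G]; simp)+
      define a where "a = xs ! j"
      have a: "s2 ''it'' j = a" using env2(2) j unfolding rep_def a_def by simp
      have ad: "a div 2 \<le> n" using e(3) j unfolding good_def a_def by simp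
      have aR: "a \<le> R" using m a unfolding mem_le_def by metis
      have bR: "a div 2 * n \<le> R" using mult_le_mono1[OF ad, of n] R_bounds(2) by linarith
      have uv: "s2 ''u'' 0 = u" "s2 ''v'' 0 = v" "s2 ''n'' 0 = n" using u v envD(1)[OF env2(1)] by (simp_all add: F' G')
      have D: "s2 ''D'' (a div 2 * n + u) = dt (a div 2) u" "s2 ''D'' (a div 2 * n + v) = dt (a div 2) v"
        using envD(3)[OF env2(1) ad] u v by auto
      have o2: "s2 ''o'' 0 = (if opn (take j xs) u v then 1 else 0)" using I .
      show "ok open_body 80 s2 (?I (Suc j))"
        unfolding open_body_def opn_Suc[OF j] a_def[symmetric]
        by (rule ok_wp; cases "even a"; cases "opn (take j xs) u v")
          (use t a aR bR uv D o2 in \<open>simp_all add: small_def even_iff_mod_2_eq_zero odd_iff_mod_2_eq_one\<close>)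
    next
      show "eval_expr (Var ''c'') s1 = length xs" using env1(2) unfolding rep_def by simp
      show "length xs \<le> R" using e(3) R_bounds(8) unfolding good_def by linarith
      show "length xs * (80 + expr_cost (Var ''c'') + 10) + expr_cost (Var ''c'') + 7 \<le> (k + 2) * 100 + 17"
        using e(3) unfolding good_def by simp
    qed (use o1 in \<open>auto simp: open_body_def\<close>)
  qed simp
  thus ?thesis by simp
qed

lemma fast_upd_ok:
  assumes e: "env s" "rep s xs" "good xs" and m: "m < n" "s ''u'' 0 = m"
    and o: "s ''o'' 0 = (if opn xs m m then 1 else 0)"
    and B: "s ''base'' 0 = B" "B + n \<le> R"
    and f: "s ''f'' 0 = fast_max xs m"
    and w: "\<And>e. e < n \<Longrightarrow> s ''who'' (B + e) = last_seen xs m e" "\<And>e. B + n \<le> e \<Longrightarrow> s ''who'' e = 0"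
  shows "ok fast_upd 70 s (\<lambda>s'. s' ''f'' 0 = fast_max xs (Suc m) \<and>
    (\<forall>e<n. s' ''who'' (B + e) = last_seen xs (Suc m) e) \<and> (\<forall>e\<ge>B + n. s' ''who'' e = 0))"
proof -
  define \<delta> where "\<delta> = dt (slot0 xs) m"
  have \<delta>: "\<delta> < n" unfolding \<delta>_def by (rule dt_less)
  have D: "s ''D'' (slot0 xs * n + m) = \<delta>" using envD(3)[OF e(1) slot0_le[OF e(3)] m(1)] unfolding \<delta>_def .
  have n: "s ''n'' 0 = n" using envD(1)[OF e(1)] .
  have it: "s ''it'' 0 div 2 = slot0 xs" using rep_slot0[OF e(2,3)] .
  define l where "l = last_seen xs m \<delta>"
  have wl: "s ''who'' (B + \<delta>) = l" using w(1)[OF \<delta>] unfolding l_def .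
  have l: "l \<le> m" using last_seen_cases[of xs m \<delta>] unfolding l_def by auto
  have "m * n + l \<le> n * n + n" using m l by (intro add_mono mult_le_mono) auto
  hence b: "m * n + l \<le> R" "m + 1 \<le> R" "B + \<delta> \<le> R" using R_bounds(1,2) m \<delta> B(2) by linarith+
  show ?thesis
  proof (cases "opn xs m m")
    case True
    have L: "last_seen xs (Suc m) e = (if e = \<delta> then Suc m else last_seen xs m e)" for e
      unfolding last_seen_Suc \<delta>_def using True by simp
    have F: "fast_max xs (Suc m) = (if l \<noteq> 0 then m * n + l else fast_max xs m)"
      unfolding fast_max_Suc[OF m(1)] l_def \<delta>_def using True by simp
    show ?thesis
      unfolding fast_upd_def L F
      by (rule ok_wp) (use True o m n it D B wl b f w \<delta> in \<open>simp_all add: small_def\<close>)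
  next
    case False
    have L: "last_seen xs (Suc m) e = last_seen xs m e" for e
      unfolding last_seen_Suc using False by simp
    have F: "fast_max xs (Suc m) = fast_max xs m"
      unfolding fast_max_Suc[OF m(1)] using False by simp
    show ?thesis
      unfolding fast_upd_def L F
      by (rule ok_wp) (use False o f w in \<open>simp_all add: small_def\<close>)
  qed
qed

lemma fast_ok:
  assumes e: "env s" "rep s xs" "good xs" and B: "s ''base'' 0 = B" "B + n \<le> R"
    and f: "s ''f'' 0 = 0" and w: "\<And>e. B \<le> e \<Longrightarrow> s ''who'' e = 0"
  shows "ok (For ''u'' (Var ''n'') fast_body) (n * ((k + 2) * 100 + 112) + 9) s
    (\<lambda>s'. s' ''f'' 0 = fast_max xs n \<and> (\<forall>e\<ge>B + n. s' ''who'' e = 0))"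
proof -
  let ?I = "\<lambda>m s'. s' ''f'' 0 = fast_max xs m \<and>
    (\<forall>e<n. s' ''who'' (B + e) = last_seen xs m e) \<and> (\<forall>e\<ge>B + n. s' ''who'' e = 0)"
  have "ok (For ''u'' (Var ''n'') fast_body) (n * ((k + 2) * 100 + 112) + 9) s (?I n)"
  proof (rule ok_For[where Tb = "(k + 2) * 100 + 100" and N = n and I = ?I])
    fix j s1 assume j: "j < n" and F: "frame (insert ''u'' (mods fast_body)) s s1" and u: "s1 ''u'' 0 = j" and I: "?I j s1"
    note F' = frameD[OF F, simplified]
    have env1: "env s1" "rep s1 xs" by (rule env_frame[OF e(1) F] rep_frame[OF e(2) F]; simp)+
    show "ok fast_body ((k + 2) * 100 + 100) s1 (?I (Suc j))"
      unfolding fast_body_def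
    proof (rule ok_Seq[where ?T1.0 = 4 and ?T2.0 = "(k + 2) * 100 + 90"])
      show "ok (''v'' ::= Var ''u'') 4 s1 (\<lambda>s'. s' ''v'' 0 = j)"
        using R_bounds(1) j by (intro ok_wp) (simp_all add: small_def u)
      fix s2 assume G: "frame (mods (''v'' ::= Var ''u'')) s1 s2" and v: "s2 ''v'' 0 = j"
      note G' = frameD[OF G, simplified]
      have env2: "env s2" "rep s2 xs" by (rule env_frame[OF env1(1) G] rep_frame[OF env1(2) G]; simp)+
      have u2: "s2 ''u'' 0 = j" by (simp add: G' u)
      show "ok (open_prog ;; fast_upd) ((k + 2) * 100 + 90) s2 (?I (Suc j))"
      proof (rule ok_Seq[OF open_ok[OF env2 e(3) u2 j v j], where ?T2.0 = 70])
        fix s3 assume H: "frame (mods open_prog) s2 s3" and o: "s3 ''o'' 0 = (if opn xs j j then 1 else 0)"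
        note H' = frameD[OF H, simplified]
        have env3: "env s3" "rep s3 xs" by (rule env_frame[OF env2(1) H] rep_frame[OF env2(2) H]; simp)+
        show "ok fast_upd 70 s3 (?I (Suc j))"
          by (rule fast_upd_ok[OF env3 e(3) j _ o _ B(2)]) (use I u B in \<open>simp_all add: F' G' H'\<close>)
      qed simp
    qed simp
  qed (use e f w R_bounds(1) in \<open>simp_all add: envD\<close>)
  thus ?thesis by (rule ok_conseq) simp_all
qed

lemma key_le:
  assumes "u < n" "v < n"
  shows "key (2 * dt x u - y) u v \<le> R"
proof -
  have "(2 * dt x u - y) * (n * n) \<le> 2 * n * (n * n)" using dt_less[of x u] by (intro mult_le_mono1) linarith
  moreover have "u * n + v < n * n"
  proof -
    have "u * n + v < Suc u * n" using assms by simp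
    also have "\<dots> \<le> n * n" using assms by (intro mult_le_mono) auto
    finally show ?thesis .
  qed
  ultimately show ?thesis using R_bounds(3) unfolding key_def by linarith
qed

lemma slow_upd_ok:
  assumes e: "env s" "rep s xs" "good xs" and m: "m < n" "s ''u'' 0 = m" and j: "j < n" "s ''v'' 0 = j"
    and o: "s ''o'' 0 = (if opn xs m j then 1 else 0)"
    and f: "s ''f'' 0 = slow_max xs m j"
  shows "ok slow_upd 90 s (\<lambda>s'. s' ''f'' 0 = slow_max xs m (Suc j))"
proof -
  have D: "s ''D'' (slot0 xs * n + m) = dt (slot0 xs) m" "s ''D'' (m * n + j) = dt m j"
    using envD(3)[OF e(1) slot0_le[OF e(3)] m(1)] envD(3)[OF e(1) _ j(1), of m] m by auto
  have n: "s ''n'' 0 = n" using envD(1)[OF e(1)] .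
  have it: "s ''it'' 0 div 2 = slot0 xs" using rep_slot0[OF e(2,3)] .
  have K: "Suc ((2 * dt (slot0 xs) m - dt m j) * (n * n) + m * n + j) = key (2 * dt (slot0 xs) m - dt m j) m j"
    unfolding key_def by simp
  have kR: "key (2 * dt (slot0 xs) m - dt m j) m j \<le> R" by (rule key_le[OF m(1) j(1)])
  show ?thesis
  proof (cases "m \<noteq> j \<and> opn xs m j")
    case True
    show ?thesis
      unfolding slow_upd_def slow_max_Suc if_P[OF True]
      by (rule ok_wp) (use True o m j n it D f kR in \<open>simp_all add: small_def K\<close>)
  next
    case False
    show ?thesis
      unfolding slow_upd_def slow_max_Suc if_not_P[OF False]
      by (rule ok_wp) (use False o m j f in \<open>auto simp: small_def\<close>)
  qed
qed

lemma slow_ok: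
  assumes e: "env s" "rep s xs" "good xs" and f: "s ''f'' 0 = 0"
  shows "ok (For ''u'' (Var ''n'') (For ''v'' (Var ''n'') slow_body)) (n * (n * ((k + 2) * 100 + 132) + 21) + 9) s
    (\<lambda>s'. s' ''f'' 0 = slow_max xs n 0)"
proof (rule ok_For[where Tb = "n * ((k + 2) * 100 + 132) + 9" and N = n and I = "\<lambda>m s'. s' ''f'' 0 = slow_max xs m 0"])
  fix m s1 assume m: "m < n" and F: "frame (insert ''u'' (mods (For ''v'' (Var ''n'') slow_body))) s s1"
    and u: "s1 ''u'' 0 = m" and I: "s1 ''f'' 0 = slow_max xs m 0"
  have env1: "env s1" "rep s1 xs" by (rule env_frame[OF e(1) F] rep_frame[OF e(2) F]; simp)+
  show "ok (For ''v'' (Var ''n'') slow_body) (n * ((k + 2) * 100 + 132) + 9) s1 (\<lambda>s'. s' ''f'' 0 = slow_max xs (Suc m) 0)"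
    unfolding slow_max_row[symmetric]
  proof (rule ok_For[where Tb = "(k + 2) * 100 + 120" and N = n and I = "\<lambda>j s'. s' ''f'' 0 = slow_max xs m j"])
    fix j s2 assume j: "j < n" and G: "frame (insert ''v'' (mods slow_body)) s1 s2"
      and v: "s2 ''v'' 0 = j" and I: "s2 ''f'' 0 = slow_max xs m j"
    note G' = frameD[OF G, simplified]
    have env2: "env s2" "rep s2 xs" by (rule env_frame[OF env1(1) G] rep_frame[OF env1(2) G]; simp)+
    have u2: "s2 ''u'' 0 = m" by (simp add: G' u)
    show "ok slow_body ((k + 2) * 100 + 120) s2 (\<lambda>s'. s' ''f'' 0 = slow_max xs m (Suc j))"
      unfolding slow_body_def
    proof (rule ok_Seq[OF open_ok[OF env2 e(3) u2 m v j], where ?T2.0 = 90])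
      fix s3 assume H: "frame (mods open_prog) s2 s3" and o: "s3 ''o'' 0 = (if opn xs m j then 1 else 0)"
      note H' = frameD[OF H, simplified]
      have env3: "env s3" "rep s3 xs" by (rule env_frame[OF env2(1) H] rep_frame[OF env2(2) H]; simp)+
      show "ok slow_upd 90 s3 (\<lambda>s'. s' ''f'' 0 = slow_max xs m (Suc j))"
        by (rule slow_upd_ok[OF env3 e(3) m _ j _ o]) (use I u2 v in \<open>simp_all add: H'\<close>)
    qed simp
  qed (use env1 I R_bounds(1) in \<open>simp_all add: envD\<close>)
qed (use e f R_bounds(1) in \<open>simp_all add: envD\<close>)

text \<open>Linear in \<open>n\<close> for the \<open>n + 1\<close> modes with at most one listener,
  quadratic for the one remaining mode; summed over all modes it is quadratic.\<close>

definition find_time :: "nat \<Rightarrow> nat" where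
  "find_time q = (if q \<le> n then n * ((k + 2) * 100 + 112) else n * (n * ((k + 2) * 100 + 132) + 21)) + 30"

lemma find_ok:
  assumes e: "env s" "rep s xs" "good xs" and B: "s ''base'' 0 = B" "B + n \<le> R"
    and w: "\<And>e. B \<le> e \<Longrightarrow> s ''who'' e = 0" and q: "s ''q'' 0 = q"
  shows "ok find_prog (find_time q) s (\<lambda>s'. s' ''f'' 0 = find_key q xs \<and> (\<forall>e\<ge>B + n. s' ''who'' e = 0))"
  unfolding find_prog_def
proof (rule ok_Seq[where ?T1.0 = 3 and ?T2.0 = "find_time q - 3"])
  show "ok (''f'' ::= Const 0) 3 s (\<lambda>s'. s' ''f'' 0 = 0)"
    by (rule ok_wp) (simp_all add: small_def)
  fix s1 assume F: "frame (mods (''f'' ::= Const 0)) s s1" and f: "s1 ''f'' 0 = 0"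
  note F' = frameD[OF F, simplified]
  have env1: "env s1" "rep s1 xs" by (rule env_frame[OF e(1) F] rep_frame[OF e(2) F]; simp)+
  have w1: "\<And>e. B \<le> e \<Longrightarrow> s1 ''who'' e = 0" using w by (simp add: F')
  have B1: "s1 ''base'' 0 = B" using B by (simp add: F')
  have n1: "s1 ''n'' 0 = n" using envD(1)[OF env1(1)] .
  show "ok (Cond (Var ''q'' [<] Var ''n'' [+] Const 1)
       (For ''u'' (Var ''n'') fast_body)
       (For ''u'' (Var ''n'') (For ''v'' (Var ''n'') slow_body))) (find_time q - 3) s1
       (\<lambda>s'. s' ''f'' 0 = find_key q xs \<and> (\<forall>e\<ge>B + n. s' ''who'' e = 0))"
  proof (rule ok_Cond[where ?T1.0 = "find_time q - 21"])
    assume "eval_expr (Var ''q'' [<] Var ''n'' [+] Const 1) s1 \<noteq> 0"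
    hence qn: "q \<le> n" using q n1 by (simp add: F' split: if_splits)
    show "ok (For ''u'' (Var ''n'') fast_body) (find_time q - 21) s1
       (\<lambda>s'. s' ''f'' 0 = find_key q xs \<and> (\<forall>e\<ge>B + n. s' ''who'' e = 0))"
      using ok_conseq[OF fast_ok[OF env1 e(3) B1 B(2) f w1]] qn unfolding find_time_def find_key_eq by simp
  next
    assume "eval_expr (Var ''q'' [<] Var ''n'' [+] Const 1) s1 = 0"
    hence qn: "\<not> q \<le> n" using q n1 by (simp add: F' split: if_splits)
    show "ok (For ''u'' (Var ''n'') (For ''v'' (Var ''n'') slow_body)) (find_time q - 21) s1
       (\<lambda>s'. s' ''f'' 0 = find_key q xs \<and> (\<forall>e\<ge>B + n. s' ''who'' e = 0))"
    proof (rule ok_conseq[OF slow_ok[OF env1 e(3) f]])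
      fix s2 assume G: "frame (mods (For ''u'' (Var ''n'') (For ''v'' (Var ''n'') slow_body))) s1 s2"
        and f2: "s2 ''f'' 0 = slow_max xs n 0"
      note G' = frameD[OF G, simplified]
      show "s2 ''f'' 0 = find_key q xs \<and> (\<forall>e\<ge>B + n. s2 ''who'' e = 0)"
        using f2 qn w1 unfolding find_key_eq by (simp add: G')
    qed (use qn in \<open>simp add: find_time_def\<close>)
  qed (simp_all add: small_def find_time_def)
qed (simp add: find_time_def)

end

context search_ram
begin

lemma pick_ok:
  assumes e: "env s" and x: "s ''x'' 0 = x" "x < n" and j: "s ''j'' 0 = j"
  shows "ok pick_prog (n * 62 + 20) s (\<lambda>s'. s' ''w'' 0 = pick x j n)"
proof -
  let ?N = "\<lambda>m. card {y. y < m \<and> dt x y = 1}"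
  \<comment> \<open>The truncated difference equals 1 exactly when \<open>j - 1\<close> neighbours
    have been passed. Afterwards it stays 0, so \<open>w\<close> is set at most once.\<close>
  let ?I = "\<lambda>m s'. s' ''w'' 0 = pick x j m \<and> s' ''j'' 0 = j - ?N m"
  have "ok pick_prog (n * 62 + 20) s (?I n)"
    unfolding pick_prog_def
  proof (rule ok_Seq[where ?T1.0 = 4 and ?T2.0 = "n * 62 + 9"])
    show "ok (''w'' ::= Var ''x'') 4 s (\<lambda>s'. s' ''w'' 0 = x)"
      using R_bounds(1) x by (intro ok_wp) (simp_all add: small_def)
    fix s1 assume F: "frame (mods (''w'' ::= Var ''x'')) s s1" and w: "s1 ''w'' 0 = x"
    note F' = frameD[OF F, simplified]
    have env1: "env s1" by (rule env_frame[OF e F]; simp)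
    show "ok (For ''y'' (Var ''n'') pick_body) (n * 62 + 9) s1 (?I n)"
    proof (rule ok_For[where Tb = 50 and N = n and I = ?I])
      fix m s2 assume m: "m < n" and M: "mem_le R s2" and G: "frame (insert ''y'' (mods pick_body)) s1 s2"
        and y: "s2 ''y'' 0 = m" and I: "?I m s2"
      note G' = frameD[OF G, simplified]
      have env2: "env s2" by (rule env_frame[OF env1 G]; simp)
      have D: "s2 ''D'' (x * n + m) = dt x m" using envD(3)[OF env2 _ m, of x] x by simp
      have xn: "s2 ''x'' 0 = x" "s2 ''n'' 0 = n" using x envD(1)[OF env2] by (simp_all add: F' G')
      have mR: "m \<le> R" using m R_bounds(1) by linarith
      have jR: "j - ?N m \<le> R" using M I unfolding mem_le_def by metis
      show "ok pick_body 50 s2 (?I (Suc m))"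
      proof (cases "dt x m = 1")
        case True
        have "{y. y < Suc m \<and> dt x y = 1} = insert m {y. y < m \<and> dt x y = 1}" using True by (auto simp: less_Suc_eq)
        hence N: "?N (Suc m) = Suc (?N m)" by simp
        have P: "pick x j (Suc m) = (if j - ?N m = 1 then m else pick x j m)" using True by auto
        show ?thesis unfolding pick_body_def N P
          by (rule ok_wp; cases "j - ?N m = 1") (use True I D xn y mR jR in \<open>simp_all add: small_def\<close>)
      next
        case False
        have "{y. y < Suc m \<and> dt x y = 1} = {y. y < m \<and> dt x y = 1}" using False by (auto simp: less_Suc_eq)
        hence N: "?N (Suc m) = ?N m" by simp
        have P: "pick x j (Suc m) = pick x j m" using False by simp
        show ?thesis unfolding pick_body_def N P
          by (rule ok_wp) (use False I D xn y in \<open>simp_all add: small_def\<close>)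
      qed
    qed (use w j envD(1)[OF env1] R_bounds(1) in \<open>simp_all add: F'\<close>)
  qed simp
  thus ?thesis by (rule ok_conseq) simp_all
qed

lemma rep_append:
  assumes "rep s xs"
  shows "rep (s(''it'' := (s ''it'')(length xs := a), ''c'' := (s ''c'')(0 := Suc (length xs)))) (xs @ [a])"
  using assms unfolding rep_def by (auto simp: nth_append less_Suc_eq)

lemma rep_update:
  assumes "rep s xs" "xs \<noteq> []"
  shows "rep (s(''it'' := (s ''it'')(0 := a))) (xs[0 := a])"
  using assms unfolding rep_def by (auto simp: nth_list_update)

lemma step_ok:
  assumes e: "env s" "rep s xs" "good xs" and f: "s ''f'' 0 = find_key q xs" "find_key q xs \<noteq> 0"
    and dg: "s ''dg'' 0 = dg" "dg < M" and q: "s ''q'' 0 = q"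
  shows "ok step_prog (n * 62 + 150) s (\<lambda>s'. rep s' (step q xs dg))"
proof -
  define x where "x = (if dg mod 2 = 0 then (find_key q xs - 1) mod (n * n) div n else (find_key q xs - 1) mod n)"
  define ee where "ee = dg div 2 + (if q < n + 1 then 2 else 0)"
  have xn: "x < n" using find_vertices(1,2)[OF f(2)] unfolding x_def by simp
  have st: "step q xs dg = (if ee = 0 then xs[0 := 2 * x + 1] else if ee = 1 then xs @ [2 * x + 1] else xs @ [2 * pick x (ee - 2) n])"
    unfolding step_def Let_def x_def ee_def using f(2) by simp
  have n: "s ''n'' 0 = n" using envD(1)[OF e(1)] .
  have xR: "x \<le> R" "2 * x + 1 \<le> R" using xn R_bounds(1,4) by linarith+
  have "dg div 2 < k + 4" using dg(2) unfolding M_def by linarith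
  hence eR: "ee \<le> R" using R_bounds(7) unfolding ee_def M_def by auto
  have len: "Suc (length xs) \<le> k + 3" "xs \<noteq> []" using e(3) unfolding good_def by auto
  have lR: "Suc (length xs) \<le> R" using len(1) R_bounds(7) unfolding M_def by simp
  show ?thesis
    unfolding step_prog_def
  proof (rule ok_Seq[where ?T1.0 = 40 and ?T2.0 = "n * 62 + 110"])
    show "ok (Cond (Var ''dg'' [mod] Const 2) (''x'' ::= (Var ''f'' [-] Const 1) [mod] Var ''n'')
       (''x'' ::= (Var ''f'' [-] Const 1) [mod] (Var ''n'' [*] Var ''n'') [div] Var ''n'')) 40 s (\<lambda>s'. s' ''x'' 0 = x)"
      by (rule ok_wp; cases "dg mod 2 = 0")
        (use f dg n xR in \<open>simp_all add: small_def x_def\<close>)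
    fix s1 assume F: "frame (mods (Cond (Var ''dg'' [mod] Const 2) (''x'' ::= (Var ''f'' [-] Const 1) [mod] Var ''n'')
       (''x'' ::= (Var ''f'' [-] Const 1) [mod] (Var ''n'' [*] Var ''n'') [div] Var ''n''))) s s1" and x1: "s1 ''x'' 0 = x"
    note F' = frameD[OF F, simplified]
    have env1: "env s1" "rep s1 xs" by (rule env_frame[OF e(1) F] rep_frame[OF e(2) F]; simp)+
    let ?R = "Cond (Var ''e'' [=] Const 0) (Assign ''it'' (Const 0) (Const 2 [*] Var ''x'' [+] Const 1))
       (Cond (Var ''e'' [=] Const 1)
         (Assign ''it'' (Var ''c'') (Const 2 [*] Var ''x'' [+] Const 1) ;; ''c'' ::= Var ''c'' [+] Const 1)
         (''j'' ::= Var ''e'' [-] Const 2 ;; pick_prog ;;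
          Assign ''it'' (Var ''c'') (Const 2 [*] Var ''w'') ;; ''c'' ::= Var ''c'' [+] Const 1))"
    show "ok (''e'' ::= Var ''dg'' [div] Const 2 [+] Const 2 [*] (Var ''q'' [<] Var ''n'' [+] Const 1) ;; ?R) (n * 62 + 110) s1
      (\<lambda>s'. rep s' (step q xs dg))"
    proof (rule ok_Seq[where ?T1.0 = 16 and ?T2.0 = "n * 62 + 90"])
      show "ok (''e'' ::= Var ''dg'' [div] Const 2 [+] Const 2 [*] (Var ''q'' [<] Var ''n'' [+] Const 1)) 16 s1 (\<lambda>s'. s' ''e'' 0 = ee)"
        by (rule ok_wp; cases "q < n + 1") (use dg q n eR in \<open>simp_all add: small_def F' ee_def\<close>)
      fix s2 assume G: "frame (mods (''e'' ::= Var ''dg'' [div] Const 2 [+] Const 2 [*] (Var ''q'' [<] Var ''n'' [+] Const 1))) s1 s2"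
        and e2: "s2 ''e'' 0 = ee"
      note G' = frameD[OF G, simplified]
      have env2: "env s2" "rep s2 xs" by (rule env_frame[OF env1(1) G] rep_frame[OF env1(2) G]; simp)+
      have x2: "s2 ''x'' 0 = x" using x1 by (simp add: G')
      have c2: "s2 ''c'' 0 = length xs" using env2(2) unfolding rep_def by simp
      show "ok ?R (n * 62 + 90) s2 (\<lambda>s'. rep s' (step q xs dg))"
      proof (rule ok_Cond[where ?T1.0 = "n * 62 + 80"])
        assume "eval_expr (Var ''e'' [=] Const 0) s2 \<noteq> 0"
        hence "ee = 0" using e2 by (simp split: if_splits)
        thus "ok (Assign ''it'' (Const 0) (Const 2 [*] Var ''x'' [+] Const 1)) (n * 62 + 80) s2 (\<lambda>s'. rep s' (step q xs dg))"
          using rep_update[OF env2(2) len(2), of "2 * x + 1"] xR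
          by (intro ok_wp) (simp_all add: st small_def x2)
      next
        assume "eval_expr (Var ''e'' [=] Const 0) s2 = 0"
        hence e0: "ee \<noteq> 0" using e2 by (simp split: if_splits)
        show "ok (Cond (Var ''e'' [=] Const 1)
         (Assign ''it'' (Var ''c'') (Const 2 [*] Var ''x'' [+] Const 1) ;; ''c'' ::= Var ''c'' [+] Const 1)
         (''j'' ::= Var ''e'' [-] Const 2 ;; pick_prog ;;
          Assign ''it'' (Var ''c'') (Const 2 [*] Var ''w'') ;; ''c'' ::= Var ''c'' [+] Const 1)) (n * 62 + 80) s2
          (\<lambda>s'. rep s' (step q xs dg))"
        proof (rule ok_Cond[where ?T1.0 = "n * 62 + 70"])
          assume "eval_expr (Var ''e'' [=] Const 1) s2 \<noteq> 0"
          hence "ee = 1" using e2 by (simp split: if_splits)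
          thus "ok (Assign ''it'' (Var ''c'') (Const 2 [*] Var ''x'' [+] Const 1) ;; ''c'' ::= Var ''c'' [+] Const 1) (n * 62 + 70) s2
            (\<lambda>s'. rep s' (step q xs dg))"
            using rep_append[OF env2(2), of "2 * x + 1"] xR lR
            by (intro ok_wp) (simp_all add: st small_def x2 c2)
        next
          assume "eval_expr (Var ''e'' [=] Const 1) s2 = 0"
          hence e1: "ee \<noteq> 1" using e2 by (simp split: if_splits)
          show "ok (''j'' ::= Var ''e'' [-] Const 2 ;; pick_prog ;;
            Assign ''it'' (Var ''c'') (Const 2 [*] Var ''w'') ;; ''c'' ::= Var ''c'' [+] Const 1) (n * 62 + 70) s2
            (\<lambda>s'. rep s' (step q xs dg))"
          proof (rule ok_Seq[where ?T1.0 = 10 and ?T2.0 = "n * 62 + 50"])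
            show "ok (''j'' ::= Var ''e'' [-] Const 2) 10 s2 (\<lambda>s'. s' ''j'' 0 = ee - 2)"
              by (rule ok_wp) (use e2 eR in \<open>simp_all add: small_def\<close>)
            fix s3 assume H: "frame (mods (''j'' ::= Var ''e'' [-] Const 2)) s2 s3" and j3: "s3 ''j'' 0 = ee - 2"
            note H' = frameD[OF H, simplified]
            have env3: "env s3" "rep s3 xs" by (rule env_frame[OF env2(1) H] rep_frame[OF env2(2) H]; simp)+
            have x3: "s3 ''x'' 0 = x" using x2 by (simp add: H')
            show "ok (pick_prog ;; Assign ''it'' (Var ''c'') (Const 2 [*] Var ''w'') ;; ''c'' ::= Var ''c'' [+] Const 1)
              (n * 62 + 50) s3 (\<lambda>s'. rep s' (step q xs dg))"
            proof (rule ok_Seq[OF pick_ok[OF env3(1) x3 xn j3], where ?T2.0 = 20])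
              fix s4 assume K: "frame (mods pick_prog) s3 s4" and w4: "s4 ''w'' 0 = pick x (ee - 2) n"
              have rep4: "rep s4 xs" by (rule rep_frame[OF env3(2) K]; simp)
              have c4: "s4 ''c'' 0 = length xs" using rep4 unfolding rep_def by simp
              have "2 * pick x (ee - 2) n \<le> R" using pick_cases[of x "ee - 2" n] xn R_bounds(4) by auto
              thus "ok (Assign ''it'' (Var ''c'') (Const 2 [*] Var ''w'') ;; ''c'' ::= Var ''c'' [+] Const 1) 20 s4
                (\<lambda>s'. rep s' (step q xs dg))"
                using rep_append[OF rep4, of "2 * pick x (ee - 2) n"] lR e0 e1
                by (intro ok_wp) (simp_all add: st small_def w4 c4)
            qed simp
          qed simp
        qed (simp_all add: small_def)
      qed (simp_all add: small_def)
    qed simp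
  qed simp
qed

section \<open>Rounds, branches and modes\<close>

lemma good_items: "i \<le> k + 1 \<Longrightarrow> good (items q z i)"
  using wf_items_items[of q z i] length_items[of q z i] unfolding wf_items_def good_def slot0_def
  by (cases "items q z i") auto

text \<open>The flag \<open>out\<close> is never reset; \<open>acc\<close> is what earlier branches
  have contributed to it. A list without conflict is left unchanged by \<open>step\<close>, so the
  rounds after acceptance only repeat the same test.\<close>

definition round_inv :: "nat \<Rightarrow> nat \<Rightarrow> nat \<Rightarrow> bool \<Rightarrow> nat \<Rightarrow> state \<Rightarrow> bool" where
  "round_inv q z B acc i s \<longleftrightarrow> rep s (items q z i) \<and> s ''code'' 0 = z div M ^ i \<and> s ''base'' 0 = B + i * n \<and>
     (\<forall>e\<ge>B + i * n. s ''who'' e = 0) \<and> (s ''out'' 0 \<noteq> 0 \<longleftrightarrow> acc \<or> (\<exists>i'<i. accepts_at q z i'))"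

lemma round_ok:
  assumes e: "env s" and q: "s ''q'' 0 = q" and I: "round_inv q z B acc i s" and i: "i < k + 1"
    and B: "B + (k + 1) * n \<le> R" and z: "z \<le> R"
  shows "ok round_prog (find_time q + n * 62 + 250) s (round_inv q z B acc (Suc i))"
proof -
  define xs where "xs = items q z i"
  define b where "b = B + i * n"
  have I': "rep s xs" "s ''code'' 0 = z div M ^ i" "s ''base'' 0 = b" "\<And>e. b \<le> e \<Longrightarrow> s ''who'' e = 0"
    "s ''out'' 0 \<noteq> 0 \<longleftrightarrow> acc \<or> (\<exists>i'<i. accepts_at q z i')"
    using I unfolding round_inv_def xs_def b_def by auto
  have good: "good xs" unfolding xs_def using good_items i by simp
  have "Suc i * n \<le> (k + 1) * n" using i by (intro mult_le_mono1) simp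
  hence bR: "b + n \<le> R" using B unfolding b_def mult_Suc by linarith
  define dg where "dg = z div M ^ i mod M"
  have dgM: "dg < M" unfolding dg_def M_def by simp
  have cd: "z div M ^ i div M = z div M ^ Suc i" by (metis div_mult2_eq power_Suc2)
  have zi: "z div M ^ i \<le> R" "z div M ^ Suc i \<le> R" using z div_le_dividend le_trans by blast+
  have dgR: "dg \<le> R" using dgM R_bounds(7) by linarith
  have nx: "items q z (Suc i) = step q xs dg" unfolding xs_def dg_def by simp
  let ?C = "Cond (Var ''f'') step_prog
       (Cond (Var ''c'' [<] Var ''k'' [+] Const 1 [+] (Read ''it'' (Const 0) [div] Const 2 [=] Var ''n''))
          (''out'' ::= Const 1) Skip)"
  show ?thesis
    unfolding round_prog_def
  proof (rule ok_Seq[OF find_ok[OF e I'(1) good I'(3) bR I'(4) q], where ?T2.0 = "n * 62 + 250"])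
    fix s1 assume F: "frame (mods find_prog) s s1"
      and f1: "s1 ''f'' 0 = find_key q xs \<and> (\<forall>e\<ge>b + n. s1 ''who'' e = 0)"
    note F' = frameD[OF F, simplified]
    have env1: "env s1" "rep s1 xs" by (rule env_frame[OF e F] rep_frame[OF I'(1) F]; simp)+
    show "ok (digit_prog ;; ?C) (n * 62 + 250) s1 (round_inv q z B acc (Suc i))"
    proof (rule ok_Seq[where ?T1.0 = 50 and ?T2.0 = "n * 62 + 200"])
      show "ok digit_prog 50 s1 (\<lambda>s'. s' ''base'' 0 = b + n \<and> s' ''dg'' 0 = dg \<and> s' ''code'' 0 = z div M ^ Suc i)"
        unfolding digit_prog_def
        by (rule ok_wp) (use bR dgR zi I'(2,3) envD(1,2)[OF env1(1)] cd in
          \<open>simp_all add: small_def F' dg_def M_def del: power_Suc\<close>)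
      fix s2 assume G: "frame (mods digit_prog) s1 s2"
        and s2: "s2 ''base'' 0 = b + n \<and> s2 ''dg'' 0 = dg \<and> s2 ''code'' 0 = z div M ^ Suc i"
      have md: "mods digit_prog = {''base'', ''dg'', ''code''}" by (auto simp: digit_prog_def)
      note G = G[unfolded md]
      note G' = frameD[OF G, simplified]
      have env2: "env s2" "rep s2 xs" by (rule env_frame[OF env1(1) G] rep_frame[OF env1(2) G]; simp)+
      have f2: "s2 ''f'' 0 = find_key q xs" and w2: "\<And>e. b + n \<le> e \<Longrightarrow> s2 ''who'' e = 0"
        and q2: "s2 ''q'' 0 = q" and o2: "s2 ''out'' 0 \<noteq> 0 \<longleftrightarrow> acc \<or> (\<exists>i'<i. accepts_at q z i')"
        using f1 q I'(5) by (simp_all add: F' G')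
      have bi: "B + Suc i * n = b + n" unfolding b_def by simp
      show "ok ?C (n * 62 + 200) s2 (round_inv q z B acc (Suc i))"
      proof (rule ok_Cond[where ?T1.0 = "n * 62 + 150"])
        assume "eval_expr (Var ''f'') s2 \<noteq> 0"
        hence f0: "find_key q xs \<noteq> 0" using f2 by simp
        show "ok step_prog (n * 62 + 150) s2 (round_inv q z B acc (Suc i))"
        proof (rule ok_conseq[OF step_ok[OF env2 good f2 f0 _ dgM q2]])
          show "s2 ''dg'' 0 = dg" using s2 by simp
          fix s3 assume H: "frame (mods step_prog) s2 s3" and r3: "rep s3 (step q xs dg)"
          note H' = frameD[OF H, simplified]
          have "\<not> accepts_at q z i" using f0 unfolding accepts_at_def xs_def by simp
          hence "acc \<or> (\<exists>i'<Suc i. accepts_at q z i') \<longleftrightarrow> acc \<or> (\<exists>i'<i. accepts_at q z i')"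
            using less_Suc_eq by auto
          thus "round_inv q z B acc (Suc i) s3"
            unfolding round_inv_def nx bi using r3 s2 w2 o2 by (simp add: H' del: power_Suc)
        qed simp
      next
        assume "eval_expr (Var ''f'') s2 = 0"
        hence f0: "find_key q xs = 0" using f2 by simp
        have st: "step q xs dg = xs" unfolding step_def Let_def using f0 by simp
        have c2: "s2 ''c'' 0 = length xs" using env2(2) unfolding rep_def by simp
        have acc: "accepts_at q z i \<longleftrightarrow> length xs < k + 1 + (if slot0 xs = n then 1 else 0)"
          unfolding accepts_at_def using f0 unfolding xs_def by simp
        have acc': "acc \<or> (\<exists>i'<Suc i. accepts_at q z i') \<longleftrightarrow> s2 ''out'' 0 \<noteq> 0 \<or> accepts_at q z i"
          using less_Suc_eq o2 by auto
        have B2: "eval_expr (Var ''c'' [<] Var ''k'' [+] Const 1 [+] (Read ''it'' (Const 0) [div] Const 2 [=] Var ''n'')) s2 \<noteq> 0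
          \<longleftrightarrow> accepts_at q z i"
          unfolding acc using c2 envD(1,2)[OF env2(1)] rep_slot0[OF env2(2) good] by simp
        have inv: "round_inv q z B acc (Suc i) s3 \<longleftrightarrow> (s3 ''out'' 0 \<noteq> 0 \<longleftrightarrow> s2 ''out'' 0 \<noteq> 0 \<or> accepts_at q z i)"
          if H: "frame {''out''} s2 s3" for s3
        proof -
          note H' = frameD[OF H, simplified]
          have "rep s3 xs" by (rule rep_frame[OF env2(2) H]; simp)
          thus ?thesis unfolding round_inv_def nx bi st acc' using s2 w2 by (simp add: H' del: power_Suc)
        qed
        show "ok (Cond (Var ''c'' [<] Var ''k'' [+] Const 1 [+] (Read ''it'' (Const 0) [div] Const 2 [=] Var ''n''))
          (''out'' ::= Const 1) Skip) (n * 62 + 150) s2 (round_inv q z B acc (Suc i))"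
        proof (rule ok_Cond[where ?T1.0 = 10])
          assume "eval_expr (Var ''c'' [<] Var ''k'' [+] Const 1 [+] (Read ''it'' (Const 0) [div] Const 2 [=] Var ''n'')) s2 \<noteq> 0"
          hence a: "accepts_at q z i" using B2 by blast
          have "ok (''out'' ::= Const 1) 10 s2 (\<lambda>s'. s' ''out'' 0 \<noteq> 0)"
            using R8 by (intro ok_wp) (simp_all add: small_def)
          thus "ok (''out'' ::= Const 1) 10 s2 (round_inv q z B acc (Suc i))"
            by (rule ok_conseq) (use inv a in simp_all)
        next
          assume "eval_expr (Var ''c'' [<] Var ''k'' [+] Const 1 [+] (Read ''it'' (Const 0) [div] Const 2 [=] Var ''n'')) s2 = 0"
          hence a: "\<not> accepts_at q z i" using B2 by blast
          show "ok Skip 10 s2 (round_inv q z B acc (Suc i))"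
            by (rule ok_wp) (use inv[OF frame_refl] a in simp_all)
        qed (simp_all add: small_def)
      qed (simp_all add: small_def)
    qed simp
  qed simp_all
qed

definition branch_time :: "nat \<Rightarrow> nat" where
  "branch_time q = (k + 1) * (find_time q + n * 62 + 264) + 50"

definition total_inv :: "nat \<Rightarrow> bool \<Rightarrow> (nat \<Rightarrow> bool) \<Rightarrow> nat \<Rightarrow> state \<Rightarrow> bool" where
  "total_inv B acc A z s \<longleftrightarrow> s ''base'' 0 = B + z * ((k + 1) * n) \<and> (\<forall>e\<ge>B + z * ((k + 1) * n). s ''who'' e = 0) \<and>
     (s ''out'' 0 \<noteq> 0 \<longleftrightarrow> acc \<or> (\<exists>z'<z. A z'))"

lemma branch_ok:
  assumes e: "env s" and q: "s ''q'' 0 = q" "q \<le> n + 1" and z: "s ''z'' 0 = z" "z < M ^ (k + 1)"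
    and I: "total_inv B acc (\<lambda>z. \<exists>i<k + 1. accepts_at q z i) z s" and B: "B + Suc z * ((k + 1) * n) \<le> R"
  shows "ok branch_prog (branch_time q) s (total_inv B acc (\<lambda>z. \<exists>i<k + 1. accepts_at q z i) (Suc z))"
proof -
  define b where "b = B + z * ((k + 1) * n)"
  define a where "a \<longleftrightarrow> acc \<or> (\<exists>z'<z. \<exists>i<k + 1. accepts_at q z' i)"
  have I': "s ''base'' 0 = b" "\<And>e. b \<le> e \<Longrightarrow> s ''who'' e = 0" "s ''out'' 0 \<noteq> 0 \<longleftrightarrow> a"
    using I unfolding total_inv_def a_def b_def by auto
  have zR: "z \<le> R" using z R_bounds(6) by linarith
  have n: "s ''n'' 0 = n" "s ''k'' 0 = k" using envD(1,2)[OF e] .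
  have q0: "2 * (q * (if q < n + 1 then 1 else 0)) + 1 \<le> R" using q R_bounds(4) by auto
  have bR: "b + (k + 1) * n \<le> R" using B unfolding b_def by simp
  have "ok branch_prog (branch_time q) s (round_inv q z b a (k + 1))"
    unfolding branch_prog_def
  proof (rule ok_Seq[where ?T1.0 = 35 and ?T2.0 = "branch_time q - 35"])
    have "rep (s(''code'' := (s ''code'')(0 := z), ''c'' := (s ''c'')(0 := 1),
      ''it'' := (s ''it'')(0 := 2 * (q * (if q < n + 1 then 1 else 0)) + 1))) (items q z 0)"
      using q by (simp add: rep_def)
    thus "ok start_prog 35 s (round_inv q z b a 0)"
      unfolding start_prog_def
      by (intro ok_wp; cases "q < n + 1") (use zR q z n q0 R8 I' in \<open>simp_all add: small_def round_inv_def\<close>)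
    fix s1 assume F: "frame (mods start_prog) s s1" and i0: "round_inv q z b a 0 s1"
    have ms: "mods start_prog = {''code'', ''c'', ''it''}" by (auto simp: start_prog_def)
    note F = F[unfolded ms]
    note F' = frameD[OF F, simplified]
    have env1: "env s1" by (rule env_frame[OF e F]; simp)
    show "ok (For ''i'' (Var ''k'' [+] Const 1) round_prog) (branch_time q - 35) s1 (round_inv q z b a (k + 1))"
    proof (rule ok_For[where Tb = "find_time q + n * 62 + 250" and N = "k + 1" and I = "round_inv q z b a"])
      fix i s2 assume i: "i < k + 1" and G: "frame (insert ''i'' (mods round_prog)) s1 s2" and i2: "round_inv q z b a i s2"
      note G' = frameD[OF G, simplified]
      have env2: "env s2" by (rule env_frame[OF env1 G]; simp)
      show "ok round_prog (find_time q + n * 62 + 250) s2 (round_inv q z b a (Suc i))"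
        by (rule round_ok[OF env2 _ i2 i bR zR]) (simp add: F' G' q)
    next
      show "k + 1 \<le> R" using R_bounds(8) by linarith
      show "round_inv q z b a j (s'(''i'' := v))" if "round_inv q z b a j s'" for j s' v
        using that unfolding round_inv_def rep_def by simp
      show "eval_expr (Var ''k'' [+] Const 1) s1 = k + 1" using envD(2)[OF env1] by simp
      have X: "find_time q + n * 62 + 250 + expr_cost (Var ''k'' [+] Const 1) + 10 = find_time q + n * 62 + 264" by simp
      show "(k + 1) * (find_time q + n * 62 + 250 + expr_cost (Var ''k'' [+] Const 1) + 10) + expr_cost (Var ''k'' [+] Const 1) + 7
        \<le> branch_time q - 35"
        unfolding X branch_time_def by simp
    qed (use i0 in simp_all)
  qed (simp add: branch_time_def)
  thus ?thesis
  proof (rule ok_conseq)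
    fix s' assume "round_inv q z b a (k + 1) s'"
    hence R: "s' ''base'' 0 = b + (k + 1) * n" "\<forall>e\<ge>b + (k + 1) * n. s' ''who'' e = 0"
      "s' ''out'' 0 \<noteq> 0 \<longleftrightarrow> a \<or> (\<exists>i<k + 1. accepts_at q z i)"
      unfolding round_inv_def by blast+
    have b': "b + (k + 1) * n = B + Suc z * ((k + 1) * n)" unfolding b_def by simp
    have "a \<or> (\<exists>i<k + 1. accepts_at q z i) \<longleftrightarrow> acc \<or> (\<exists>z'<Suc z. \<exists>i<k + 1. accepts_at q z' i)"
      unfolding a_def less_Suc_eq by blast
    thus "total_inv B acc (\<lambda>z. \<exists>i<k + 1. accepts_at q z i) (Suc z) s'"
      using R unfolding total_inv_def b' by simp
  qed simp
qed

lemma branches_ok: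
  assumes e: "env s" and tot: "s ''tot'' 0 = M ^ (k + 1)" and q: "s ''q'' 0 = q" "q \<le> n + 1"
    and I: "total_inv B acc (\<lambda>z. \<exists>i<k + 1. accepts_at q z i) 0 s" and B: "B + M ^ (k + 1) * ((k + 1) * n) \<le> R"
  shows "ok (For ''z'' (Var ''tot'') branch_prog) (M ^ (k + 1) * (branch_time q + 12) + 9) s
    (total_inv B acc (\<lambda>z. \<exists>i<k + 1. accepts_at q z i) (M ^ (k + 1)))"
proof (rule ok_For[where Tb = "branch_time q" and N = "M ^ (k + 1)" and I = "total_inv B acc (\<lambda>z. \<exists>i<k + 1. accepts_at q z i)"])
  fix z s2 assume z: "z < M ^ (k + 1)" and G: "frame (insert ''z'' (mods branch_prog)) s s2" and z2: "s2 ''z'' 0 = z"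
    and i2: "total_inv B acc (\<lambda>z. \<exists>i<k + 1. accepts_at q z i) z s2"
  note G' = frameD[OF G, simplified]
  have env2: "env s2" by (rule env_frame[OF e G]; simp)
  have "Suc z * ((k + 1) * n) \<le> M ^ (k + 1) * ((k + 1) * n)" using z by (intro mult_le_mono1) simp
  hence "B + Suc z * ((k + 1) * n) \<le> R" using B by linarith
  thus "ok branch_prog (branch_time q) s2 (total_inv B acc (\<lambda>z. \<exists>i<k + 1. accepts_at q z i) (Suc z))"
    by (intro branch_ok[OF env2 _ q(2) z2 z i2]) (simp add: G' q)
next
  show "total_inv B acc (\<lambda>z. \<exists>i<k + 1. accepts_at q z i) j (s'(''z'' := v))"
    if "total_inv B acc (\<lambda>z. \<exists>i<k + 1. accepts_at q z i) j s'" for j s' v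
    using that unfolding total_inv_def by simp
qed (use I tot R_bounds(6) in simp_all)

lemma power_ok:
  assumes e: "env s"
  shows "ok power_prog ((k + 1) * 40 + 30) s (\<lambda>s'. s' ''tot'' 0 = M ^ (k + 1))"
  unfolding power_prog_def
proof (rule ok_Seq[where ?T1.0 = 3 and ?T2.0 = "(k + 1) * 40 + 20"])
  show "ok (''tot'' ::= Const 1) 3 s (\<lambda>s'. s' ''tot'' 0 = 1)"
    using R8 by (intro ok_wp) (simp_all add: small_def)
  fix s1 assume F: "frame (mods (''tot'' ::= Const 1)) s s1" and t: "s1 ''tot'' 0 = 1"
  have env1: "env s1" by (rule env_frame[OF e F]; simp)
  show "ok (For ''i'' (Var ''k'' [+] Const 1) (''tot'' ::= Var ''tot'' [*] (Const 2 [*] Var ''k'' [+] Const 8)))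
    ((k + 1) * 40 + 20) s1 (\<lambda>s'. s' ''tot'' 0 = M ^ (k + 1))"
  proof (rule ok_For[where Tb = 20 and N = "k + 1" and I = "\<lambda>i s'. s' ''tot'' 0 = M ^ i"])
    fix i s2 assume i: "i < k + 1"
      and G: "frame (insert ''i'' (mods (''tot'' ::= Var ''tot'' [*] (Const 2 [*] Var ''k'' [+] Const 8)))) s1 s2"
      and t: "s2 ''tot'' 0 = M ^ i"
    have env2: "env s2" by (rule env_frame[OF env1 G]; simp)
    have "M ^ Suc i \<le> M ^ (k + 1)" using i by (intro power_increasing) (auto simp: M_def)
    hence "M ^ i * M \<le> R" using R_bounds(6) unfolding power_Suc2 by linarith
    thus "ok (''tot'' ::= Var ''tot'' [*] (Const 2 [*] Var ''k'' [+] Const 8)) 20 s2 (\<lambda>s'. s' ''tot'' 0 = M ^ Suc i)"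
      by (intro ok_wp) (simp_all add: small_def t envD(2)[OF env2] M_def[symmetric] mult.commute[of "M ^ i" M])
  qed (use t envD(2)[OF env1] R_bounds(8) in simp_all)
qed simp

definition search_time :: nat where
  "search_time = (k + 1) * 40 + 30 + ((n + 1) * (M ^ (k + 1) * (branch_time 0 + 12) + 30) + 30)
     + (M ^ (k + 1) * (branch_time (n + 1) + 12) + 9)"

lemma search_ok:
  assumes e: "env s" and s0: "s ''base'' 0 = 0" "\<And>e. s ''who'' e = 0" "s ''out'' 0 = 0"
  shows "ok search_prog search_time s (\<lambda>s'. s' ''out'' 0 \<noteq> 0 \<longleftrightarrow> (\<exists>q<n + 2. \<exists>z<M ^ (k + 1). \<exists>i<k + 1. accepts_at q z i))"
proof -
  define S where "S = M ^ (k + 1) * ((k + 1) * n)"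
  define A where "A q = (\<exists>z<M ^ (k + 1). \<exists>i<k + 1. accepts_at q z i)" for q
  have S: "(n + 2) * S \<le> R" using R_branches unfolding S_def by (simp only: mult.assoc)
  let ?I = "\<lambda>q s. s ''base'' 0 = q * S \<and> (\<forall>e\<ge>q * S. s ''who'' e = 0) \<and> (s ''out'' 0 \<noteq> 0 \<longleftrightarrow> (\<exists>q'<q. A q'))"
  have branches: "ok (For ''z'' (Var ''tot'') branch_prog) (M ^ (k + 1) * (branch_time q + 12) + 9) s' (?I (Suc q))"
    if "env s'" "s' ''tot'' 0 = M ^ (k + 1)" "s' ''q'' 0 = q" "q \<le> n + 1" "?I q s'" for q s'
  proof (rule ok_conseq[OF branches_ok[OF that(1-4), where B = "q * S" and acc = "\<exists>q'<q. A q'"]])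
    show "total_inv (q * S) (\<exists>q'<q. A q') (\<lambda>z. \<exists>i<k + 1. accepts_at q z i) 0 s'"
      using that(5) unfolding total_inv_def by simp
    have "Suc q * S \<le> (n + 2) * S" using that(4) by (intro mult_le_mono1) simp
    thus "q * S + M ^ (k + 1) * ((k + 1) * n) \<le> R" using S unfolding S_def[symmetric] by simp
    fix s'' assume "total_inv (q * S) (\<exists>q'<q. A q') (\<lambda>z. \<exists>i<k + 1. accepts_at q z i) (M ^ (k + 1)) s''"
    hence "s'' ''base'' 0 = q * S + S" "\<forall>e\<ge>q * S + S. s'' ''who'' e = 0" "s'' ''out'' 0 \<noteq> 0 \<longleftrightarrow> (\<exists>q'<q. A q') \<or> A q"
      unfolding total_inv_def S_def[symmetric] A_def[symmetric] by blast+
    moreover have "(\<exists>q'<q. A q') \<or> A q \<longleftrightarrow> (\<exists>q'<Suc q. A q')" unfolding less_Suc_eq by blast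
    ultimately show "?I (Suc q) s''" by (simp add: add.commute)
  qed simp
  have bt: "branch_time q = branch_time 0" if "q \<le> n" for q
    using that unfolding branch_time_def find_time_def by simp
  have "ok search_prog search_time s (?I (Suc (n + 1)))"
    unfolding search_prog_def
  proof (rule ok_Seq[OF power_ok[OF e], where ?T2.0 = "search_time - ((k + 1) * 40 + 30)"])
    fix s1 assume F: "frame (mods power_prog) s s1" and t1: "s1 ''tot'' 0 = M ^ (k + 1)"
    have mp: "mods power_prog = {''tot'', ''i''}" by (auto simp: power_prog_def)
    note F' = frameD[OF F, unfolded mp, simplified]
    have env1: "env s1" by (rule env_frame[OF e F]; simp add: mp)
    show "ok (For ''q'' (Var ''n'' [+] Const 1) (For ''z'' (Var ''tot'') branch_prog) ;;
      ''q'' ::= Var ''n'' [+] Const 1 ;; For ''z'' (Var ''tot'') branch_prog) (search_time - ((k + 1) * 40 + 30)) s1 (?I (Suc (n + 1)))"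
    proof (rule ok_Seq[where ?T1.0 = "(n + 1) * (M ^ (k + 1) * (branch_time 0 + 12) + 30) + 20"
          and ?T2.0 = "10 + (M ^ (k + 1) * (branch_time (n + 1) + 12) + 9)"])
      show "ok (For ''q'' (Var ''n'' [+] Const 1) (For ''z'' (Var ''tot'') branch_prog))
        ((n + 1) * (M ^ (k + 1) * (branch_time 0 + 12) + 30) + 20) s1 (?I (n + 1))"
      proof (rule ok_For[where Tb = "M ^ (k + 1) * (branch_time 0 + 12) + 9" and N = "n + 1" and I = ?I])
        fix q s2 assume q: "q < n + 1" and G: "frame (insert ''q'' (mods (For ''z'' (Var ''tot'') branch_prog))) s1 s2"
          and q2: "s2 ''q'' 0 = q" and i2: "?I q s2"
        note G' = frameD[OF G, simplified]
        have env2: "env s2" by (rule env_frame[OF env1 G]; simp)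
        show "ok (For ''z'' (Var ''tot'') branch_prog) (M ^ (k + 1) * (branch_time 0 + 12) + 9) s2 (?I (Suc q))"
          using branches[OF env2 _ q2 _ i2] bt[of q] q t1 by (simp add: G')
        next
        have ec: "expr_cost (Var ''n'' [+] Const 1) = 4" by simp
        have le: "(n + 1) * (P + 9 + 4 + 10) + 4 + 7 \<le> (n + 1) * (P + 30) + 20" for P :: nat
          by (simp add: algebra_simps)
        show "(n + 1) * (M ^ (k + 1) * (branch_time 0 + 12) + 9 + expr_cost (Var ''n'' [+] Const 1) + 10) +
          expr_cost (Var ''n'' [+] Const 1) + 7 \<le> (n + 1) * (M ^ (k + 1) * (branch_time 0 + 12) + 30) + 20"
          unfolding ec by (rule le)
      qed (use s0 envD(1)[OF env1] R_bounds(5) in \<open>simp_all add: F'\<close>)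
      fix s2 assume G: "frame (mods (For ''q'' (Var ''n'' [+] Const 1) (For ''z'' (Var ''tot'') branch_prog))) s1 s2"
        and i2: "?I (n + 1) s2"
      note G' = frameD[OF G, simplified]
      have env2: "env s2" by (rule env_frame[OF env1 G]; simp)
      show "ok (''q'' ::= Var ''n'' [+] Const 1 ;; For ''z'' (Var ''tot'') branch_prog)
        (10 + (M ^ (k + 1) * (branch_time (n + 1) + 12) + 9)) s2 (?I (Suc (n + 1)))"
      proof (rule ok_Seq[where ?T1.0 = 10])
        show "ok (''q'' ::= Var ''n'' [+] Const 1) 10 s2 (\<lambda>s'. s' ''q'' 0 = n + 1)"
          using R_bounds(5) by (intro ok_wp) (simp_all add: small_def envD(1)[OF env2])
        fix s3 assume H: "frame (mods (''q'' ::= Var ''n'' [+] Const 1)) s2 s3" and q3: "s3 ''q'' 0 = n + 1"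
        note H' = frameD[OF H, simplified]
        have env3: "env s3" by (rule env_frame[OF env2 H]; simp)
        have t3: "s3 ''tot'' 0 = M ^ (k + 1)" using t1 by (simp add: G' H')
        have i3: "?I (n + 1) s3" using i2 by (simp add: H')
        show "ok (For ''z'' (Var ''tot'') branch_prog) (M ^ (k + 1) * (branch_time (n + 1) + 12) + 9) s3 (?I (Suc (n + 1)))"
          by (rule branches[OF env3 t3 q3 _ i3]) simp
      qed simp
    qed (simp add: search_time_def)
  qed (simp add: search_time_def)
  thus ?thesis by (rule ok_conseq) (simp_all add: A_def)
qed

end

section \<open>Running time and main theorem\<close>

text \<open>Substituting successors for \<open>n\<close> and \<open>t\<close> leaves polynomials
  with natural coefficients, which can be compared monomial by monomial; 2000 is a generous
  constant.\<close>

lemma polynomial_time_bound: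
  fixes n k t :: nat
  assumes "1 \<le> n" "1 \<le> t"
  shows "n * (n * 160 + 80) + 9 + ((k + 1) * 40 + 30 +
      ((n + 1) * (t * ((k + 1) * (n * ((k + 2) * 100 + 112) + 30 + n * 62 + 264) + 50 + 12) + 30) + 30) +
      (t * ((k + 1) * (n * (n * ((k + 2) * 100 + 132) + 21) + 30 + n * 62 + 264) + 50 + 12) + 9))
    \<le> 2000 * ((k + 3) * (k + 3)) * t * (n * n)"
proof -
  obtain m u where "n = Suc m" "t = Suc u" using assms by (metis Suc_le_D One_nat_def)
  thus ?thesis by (simp add: algebra_simps)
qed

text \<open>The power counts the branches. One factor \<open>k + 3\<close> covers the rounds of a
  branch, the other the length of the list scanned for each pair.\<close>

definition step_factor :: "nat \<Rightarrow> nat" where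
  "step_factor k = 2000 * ((k + 3) * (k + 3)) * (2 * k + 8) ^ (k + 1)"

lemma log_step_factor: "(\<lambda>k. log 2 (real (step_factor k))) \<in> O(\<lambda>k. real k * ln (real k))"
proof -
  have "log 2 (real (step_factor k)) = log 2 2000 + 2 * log 2 (real k + 3) + (real k + 1) * log 2 (2 * real k + 8)" for k
  proof -
    have eq: "real (step_factor k) = 2000 * ((real k + 3) * (real k + 3)) * (2 * real k + 8) ^ (k + 1)"
      unfolding step_factor_def by simp
    have "log 2 (2000 * (a * a) * b ^ m) = log 2 2000 + 2 * log 2 a + real m * log 2 b"
      if "0 < a" "0 < b" for a b :: real and m :: nat
      using that by (simp add: log_mult log_nat_power)
    from this[of "real k + 3" "2 * real k + 8" "k + 1"] eq show ?thesis by (simp del: power_Suc)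
  qed
  moreover have "(\<lambda>k::nat. log 2 2000 + 2 * log 2 (real k + 3) + (real k + 1) * log 2 (2 * real k + 8))
      \<in> O(\<lambda>k. real k * ln (real k))"
    by real_asymp
  ultimately show ?thesis by simp
qed

lemma (in search_ram) total_time:
  "n * (n * 160 + 80) + 9 + search_time \<le> step_factor k * (n * n)"
proof -
  have "1 \<le> M ^ (k + 1)" by (simp add: M_def)
  moreover have "1 \<le> n" using n_pos by simp
  moreover have "find_time 0 = n * ((k + 2) * 100 + 112) + 30" "find_time (n + 1) = n * (n * ((k + 2) * 100 + 132) + 21) + 30"
    unfolding find_time_def by auto
  ultimately show ?thesis
    using polynomial_time_bound[of n "M ^ (k + 1)" k]
    unfolding search_time_def branch_time_def step_factor_def M_def[symmetric] by simp
qed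

text \<open>The square is needed for the keys, which are cubic in \<open>n\<close>, whereas the time
  bound is only quadratic.\<close>

lemma bounds_suffice:
  fixes n k :: nat
  assumes "1 \<le> n"
  defines "R \<equiv> (step_factor k * (n * n)) ^ 2"
  shows "8 \<le> R" "n \<le> R" "k \<le> R" "(n + 2) * (2 * k + 8) ^ (k + 1) * ((k + 1) * n) \<le> R" "8 * (n * n * n) \<le> R"
proof -
  define Z where "Z = step_factor k * (n * n)"
  define t where "t = (2 * k + 8) ^ (k + 1)"
  have t: "1 \<le> t" unfolding t_def by simp
  have Z: "Z = 2000 * ((k + 3) * (k + 3)) * t * (n * n)" unfolding Z_def step_factor_def t_def ..
  obtain m u where mu: "n = Suc m" "t = Suc u" using assms(1) t by (metis Suc_le_D One_nat_def)
  have "8 \<le> Z" "n \<le> Z" "k \<le> Z" "(n + 2) * t * ((k + 1) * n) \<le> Z" and Z8: "8 * (n * n) \<le> Z"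
    unfolding Z mu by (simp_all add: algebra_simps)
  moreover have "Z \<le> R" unfolding R_def Z_def[symmetric] by (simp add: power2_eq_square)
  ultimately show "8 \<le> R" "n \<le> R" "k \<le> R" "(n + 2) * (2 * k + 8) ^ (k + 1) * ((k + 1) * n) \<le> R"
    unfolding t_def[symmetric] by linarith+
  have "8 * (n * n * n) \<le> (8 * (n * n)) * (8 * (n * n))" using assms(1) by simp
  also have "\<dots> \<le> Z * Z" using Z8 by (intro mult_le_mono)
  finally show "8 * (n * n * n) \<le> R" unfolding R_def Z_def[symmetric] by (simp add: power2_eq_square)
qed

definition detection_prog :: prog where
  "detection_prog = (grow_prog ;; search_prog)"

lemma mods_grow_prog: "mods grow_prog = {''i'', ''c'', ''y'', ''p'', ''x'', ''D'', ''par'', ''vis''}"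
  by (auto simp: grow_prog_def scan_prog_def attach_prog_def)

lemma detection_prog_correct:
  fixes n k :: nat
  assumes tree: "is_tree T" and verts: "pverts T = {0..<n}"
  defines "Z \<equiv> step_factor k * (n * n)"
  shows "\<exists>t s. exec ((Z ^ 2) ^ 40) detection_prog (input_state n k T) t s \<and> t \<le> Z \<and>
    (accepting s \<longleftrightarrow> (\<exists>W L. detection_pair T W L \<and> card W + card L \<le> k))"
proof -
  let ?s = "input_state n k T"
  let ?R = "Z ^ 2"
  interpret tree_graph T by standard (rule tree)
  have n1: "1 \<le> n" using tree verts
    unfolding is_tree_def Digraph_Component.connected_def strongly_connected_def by (cases n) auto
  note R = bounds_suffice[OF n1, of k, folded Z_def]
  interpret grow_ram T ?R n by standard (use R verts in auto)
  have adj: "?s ''adj'' (x * n + y) \<noteq> 0 \<longleftrightarrow> edge T x y" if "x < n" "y < n" for x y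
    using index_less[OF that] that unfolding input_state_def edge_def by simp
  have z: "?s a = (\<lambda>_. 0)" if "a \<notin> {''n'', ''k'', ''adj''}" for a
    using that unfolding input_state_def by simp
  have n: "?s ''n'' 0 = n" "?s ''k'' 0 = k" unfolding input_state_def by simp_all
  have mem: "mem_le ?R ?s" using R(1-3) unfolding mem_le_def input_state_def by auto
  have "grow_inv 0 ?s"
    using adj n z unfolding grow_inv_def visited_def table_def by simp
  then obtain t1 s1 where 1: "exec (?R ^ 40) grow_prog ?s t1 s1" "t1 \<le> n * (n * 160 + 80) + 9" "mem_le ?R s1"
    and g: "grown (edge T) {0..<n} (table s1)" and D: "\<forall>m\<ge>n * n. s1 ''D'' m = 0"
    using grow_ok[of ?s] mem unfolding ok_def by blast
  note F = frameD[OF exec_frame[OF 1(1)], unfolded mods_grow_prog]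
  interpret M: tree_metric "{0..<n}" "table s1" using grown_tree_metric[OF g] .
  interpret search n "table s1" k by standard (use n1 in simp)
  interpret search_ram n "table s1" k ?R
    by standard (use R(4,5) grown_less_card[OF g] in \<open>auto simp: M_def\<close>)
  \<comment> \<open>For \<open>x = n\<close> the index lies beyond the table, where the growing
    phase has left zeros.\<close>
  have "s1 ''D'' (x * n + y) = dt x y" if "x \<le> n" "y < n" for x y
    using that D unfolding dt_def table_def by (cases "x = n") auto
  hence env1: "env s1" unfolding env_def using n by (simp add: F)
  have "ok search_prog search_time s1
    (\<lambda>s'. s' ''out'' 0 \<noteq> 0 \<longleftrightarrow> (\<exists>q<n + 2. \<exists>z<M ^ (k + 1). \<exists>i<k + 1. accepts_at q z i))"
    by (rule search_ok[OF env1]) (simp_all add: F z)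
  then obtain t2 s2 where 2: "exec (?R ^ 40) search_prog s1 t2 s2" "t2 \<le> search_time"
    "s2 ''out'' 0 \<noteq> 0 \<longleftrightarrow> (\<exists>q<n + 2. \<exists>z<M ^ (k + 1). \<exists>i<k + 1. accepts_at q z i)"
    using 1(3) unfolding ok_def by blast
  have "exec (?R ^ 40) detection_prog ?s (t1 + t2) s2"
    unfolding detection_prog_def by (rule exec.Seq[OF 1(1) 2(1)])
  moreover have "t1 + t2 \<le> Z" using 1(2) 2(2) total_time unfolding Z_def by linarith
  moreover have "accepting s2 \<longleftrightarrow> (\<exists>W L. detection_pair T W L \<and> card W + card L \<le> k)"
    unfolding accepting_def 2(3) accepts_iff using detection_pair_iff_sol[of "table s1"] g verts by simp
  ultimately show ?thesis by blast
qed

theorem theorem9: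
  shows "\<exists>(P :: prog) (f :: nat \<Rightarrow> real) (c :: nat).
    f \<in> O(\<lambda>k. real k * ln (real k)) \<and>
    (\<forall>(n :: nat) (k :: nat) (T :: nat pair_pre_digraph).
       is_tree T \<and> pverts T = {0..<n} \<and> 1 \<le> k \<longrightarrow>
       (\<exists>s. halts_within c P (input_state n k T) (2 powr f k * real n ^ 2) s \<and>
            (accepting s \<longleftrightarrow> (\<exists>W L. detection_pair T W L \<and> card W + card L \<le> k))))"
proof (rule exI[of _ detection_prog], rule exI[of _ "\<lambda>k. log 2 (real (step_factor k))"], rule exI[of _ 80], intro conjI allI impI)
  show "(\<lambda>k. log 2 (real (step_factor k))) \<in> O(\<lambda>k. real k * ln (real k))"
    by (rule log_step_factor)
  fix n k :: nat and T :: "nat pair_pre_digraph"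
  assume T: "is_tree T \<and> pverts T = {0..<n} \<and> 1 \<le> k"
  define Z where "Z = step_factor k * (n * n)"
  have "2 powr log 2 (real (step_factor k)) = real (step_factor k)"
    by (simp add: step_factor_def)
  hence Z: "2 powr log 2 (real (step_factor k)) * real n ^ 2 = real Z"
    unfolding Z_def by (simp add: power2_eq_square)
  obtain t s where s: "exec ((Z ^ 2) ^ 40) detection_prog (input_state n k T) t s" "t \<le> Z"
    "accepting s \<longleftrightarrow> (\<exists>W L. detection_pair T W L \<and> card W + card L \<le> k)"
    using detection_prog_correct[of T n k] T unfolding Z_def by blast
  \<comment> \<open>The exponent 80 comes from memory below \<open>Z ^ 2\<close> and expressions of
    size at most 40.\<close>
  have "real ((Z ^ 2) ^ 40) \<le> real Z ^ 80" by (simp flip: power_mult)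
  hence "halts_within 80 detection_prog (input_state n k T) (2 powr log 2 (real (step_factor k)) * real n ^ 2) s"
    unfolding halts_within_def Z using s(1,2) of_nat_le_iff by blast
  thus "\<exists>s. halts_within 80 detection_prog (input_state n k T) (2 powr log 2 (real (step_factor k)) * real n ^ 2) s \<and>
      (accepting s \<longleftrightarrow> (\<exists>W L. detection_pair T W L \<and> card W + card L \<le> k))"
    using s(3) by blast
qed

end
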